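(* Let $\nu\in\mathcal{M}(\Phi)$ and let $x_0\in\mathbb{R}^d$ be a $\sigma$-point of $\nu$. Let $\ell=D\nu(x_0)$. (i) If $d\in\{1,2,3\}$, then $$\lim_{|x-x_0|<\alpha t\to0}\mathbb{P}_t\nu(x)=\ell,\qquad\forall\,\alpha>0.\qquad( * )$$ (ii) If $d\ge4$, then $( * )$ holds if it is additionally assumed that $$\lim_{r\to0^+}\frac{|\nu-\ell\,dy|(B_r(x_0))}{r^{d-3}}=0.$$
   Context: Fix $d\ge1$. A locally finite complex measure in $\mathbb{R}^d$ is $\nu=\nu_1+i\nu_2$ where $\nu_1,\nu_2$ are signed Borel measures which are finite on compact sets; $|\nu|$ denotes its total variation (a positive Borel measure, finite on compact sets). $dy$ denotes Lebesgue measure, $|E|$ the Lebesgue measure of $E$, $B_r(x)=\{y\in\mathbb{R}^d:|y-x|<r\}$; for $\ell\in\mathbb{C}$, $\nu-\ell\,dy$ is the locally finite complex measure $E\mapsto\nu(E)-\ell|E|$ (for bounded Borel $E$). $\sigma$-point: $x_0$ is a $\sigma$-point of $\nu$ if there exists $\ell\in\mathbb{C}$ such that $$\lim_{|x-x_0|+r\to0}\frac{|(\nu-\ell\,dy)(B_r(x))|}{(|x-x_0|+r)^d}=0,$$ the limit being over $x\in\mathbb{R}^d$, $r>0$. In that case the symmetric derivative $D\nu(x_0)=\lim_{r\to0^+}\frac{\nu(B_r(x_0))}{|B_r(x_0)|}$ exists and equals $\ell$. Poisson–Hermite semigroup: let $L=-\Delta+|x|^2$ be the Hermite operator in $\mathbb{R}^d$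 and $\mathbb{P}_t=e^{-t\sqrt L}=\frac{t}{\sqrt{4\pi}}\int_0^\infty e^{-t^2/(4\tau)}e^{-\tau L}\frac{d\tau}{\tau^{3/2}}$, $t>0$. Its integral kernel is $$\mathbb{P}_t(x,y)=c_d\,t\int_0^1\frac{e^{-t^2/\kappa(s)}(1-s^2)^{\frac d2-1}e^{-\frac14\left(\frac{|x-y|^2}{s}+s|x+y|^2\right)}}{s^{d/2}\,\kappa(s)^{3/2}}\,ds,\qquad \kappa(s)=2\ln\frac{1+s}{1-s},$$ where $c_d=8(4\pi)^{-(d+1)/2}>0$. Let $\Phi(y)=\dfrac{e^{-|y|^2/2}}{(1+|y|)^{d/2}[\log(e+|y|)]^{3/2}}$, and let $\mathcal{M}(\Phi)$ be the set of locally finite complex measures $\nu$ in $\mathbb{R}^d$ with $\int_{\mathbb{R}^d}\Phi\,d|\nu|<\infty$. For $\nu\in\mathcal{M}(\Phi)$ set $\mathbb{P}_t\nu(x)=\int_{\mathbb{R}^d}\mathbb{P}_t(x,y)\,d\nu(y)$, which converges absolutely for all $t>0$, $x\in\mathbb{R}^d$. The notation $\lim_{|x-x_0|<\alpha t\to0}$ means the limit as $(t,x)\to(0,x_0)$ over points $(t,x)\in(0,\infty)\times\mathbb{R}^d$ with $|x-x_0|<\alpha t$. *)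

theory Defs
  imports "HOL-Analysis.Analysis"
begin

text \<open>
  A signed or complex measure on \<open>\<real>\<^sup>d\<close> that is finite on compact sets is in general only defined on
  the bounded Borel sets (its positive and negative parts may both be infinite), so it is
  represented by a set function of which only the values on bounded Borel sets matter. Countable
  additivity on disjoint sequences with bounded union includes \<open>\<mu> {} = 0\<close>.
\<close>

definition locally_finite_signed_measure :: "('a::euclidean_space set \<Rightarrow> real) \<Rightarrow> bool" where
  "locally_finite_signed_measure \<mu> \<longleftrightarrow>
     (\<forall>A :: nat \<Rightarrow> 'a set.
        range A \<subseteq> sets borel \<longrightarrow> disjoint_family A \<longrightarrow> bounded (\<Union>i. A i) \<longrightarrow>
        (\<lambda>i. \<mu> (A i)) sums \<mu> (\<Union>i. A i))"

definition locally_finite_complex_measure :: "('a::euclidean_space set \<Rightarrow> complex) \<Rightarrow> bool" where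
  "locally_finite_complex_measure \<nu> \<longleftrightarrow>
     locally_finite_signed_measure (\<lambda>E. Re (\<nu> E)) \<and>
     locally_finite_signed_measure (\<lambda>E. Im (\<nu> E))"

text \<open>
  Total variation \<open>|\<nu>|\<close>: the usual supremum over finite Borel partitions, with the pieces required
  to be bounded so that \<open>\<nu>\<close> is defined on them (they need not cover \<open>E\<close>, which does not affect the
  supremum).
\<close>

definition total_variation :: "('a::euclidean_space set \<Rightarrow> complex) \<Rightarrow> 'a measure" where
  "total_variation \<nu> = measure_of UNIV (sets borel)
     (\<lambda>E. SUP P \<in> {P. finite P \<and> disjoint P \<and> (\<forall>A\<in>P. A \<in> sets borel \<and> bounded A \<and> A \<subseteq> E)}.
            \<Sum>A\<in>P. ennreal (norm (\<nu> A)))"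

text \<open>
  Positive part of the Jordan decomposition. Note that \<^term>\<open>ennreal\<close> maps negative reals to 0.
  The negative part of \<open>\<mu>\<close> is the positive part of \<open>- \<mu>\<close>.
\<close>

definition positive_variation :: "('a::euclidean_space set \<Rightarrow> real) \<Rightarrow> 'a measure" where
  "positive_variation \<mu> = measure_of UNIV (sets borel)
     (\<lambda>E. SUP A \<in> {A. A \<in> sets borel \<and> bounded A \<and> A \<subseteq> E}. ennreal (\<mu> A))"

definition signed_integral ::
    "('a::euclidean_space set \<Rightarrow> real) \<Rightarrow> ('a \<Rightarrow> complex) \<Rightarrow> complex" where
  "signed_integral \<mu> f =
     (LINT y|positive_variation \<mu>. f y) - (LINT y|positive_variation (\<lambda>E. - \<mu> E). f y)"

definition complex_measure_integral ::
    "('a::euclidean_space set \<Rightarrow> complex) \<Rightarrow> ('a \<Rightarrow> complex) \<Rightarrow> complex" where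
  "complex_measure_integral \<nu> f =
     signed_integral (\<lambda>E. Re (\<nu> E)) f + \<i> * signed_integral (\<lambda>E. Im (\<nu> E)) f"

text \<open>The measure \<open>\<nu> - \<ell> dy\<close>.\<close>

definition minus_lebesgue ::
    "('a::euclidean_space set \<Rightarrow> complex) \<Rightarrow> complex \<Rightarrow> 'a set \<Rightarrow> complex" where
  "minus_lebesgue \<nu> l E = \<nu> E - l * complex_of_real (measure lborel E)"

definition sigma_point :: "('a::euclidean_space set \<Rightarrow> complex) \<Rightarrow> 'a \<Rightarrow> bool" where
  "sigma_point \<nu> x0 \<longleftrightarrow>
     (\<exists>l. ((\<lambda>(x, r). norm (minus_lebesgue \<nu> l (ball x r)) / (norm (x - x0) + r) ^ DIM('a))
            \<longlongrightarrow> 0) (at (x0, 0) within UNIV \<times> {0<..}))"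

definition symmetric_derivative :: "('a::euclidean_space set \<Rightarrow> complex) \<Rightarrow> 'a \<Rightarrow> complex" where
  "symmetric_derivative \<nu> x0 =
     Lim (at_right 0) (\<lambda>r. \<nu> (ball x0 r) / complex_of_real (measure lborel (ball x0 r)))"

definition kappa :: "real \<Rightarrow> real" where
  "kappa s = 2 * ln ((1 + s) / (1 - s))"

definition poisson_hermite_kernel :: "real \<Rightarrow> 'a::euclidean_space \<Rightarrow> 'a \<Rightarrow> real" where
  "poisson_hermite_kernel t x y =
     8 * (4 * pi) powr (- (real DIM('a) + 1) / 2) * t *
     (LBINT s:{0<..<1}.
        exp (- t\<^sup>2 / kappa s) * (1 - s\<^sup>2) powr (real DIM('a) / 2 - 1) *
        exp (- (1 / 4) * ((norm (x - y))\<^sup>2 / s + s * (norm (x + y))\<^sup>2)) /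
        (s powr (real DIM('a) / 2) * kappa s powr (3 / 2)))"

definition poisson_hermite ::
    "real \<Rightarrow> ('a::euclidean_space set \<Rightarrow> complex) \<Rightarrow> 'a \<Rightarrow> complex" where
  "poisson_hermite t \<nu> x =
     complex_measure_integral \<nu> (\<lambda>y. complex_of_real (poisson_hermite_kernel t x y))"

definition Phi :: "'a::euclidean_space \<Rightarrow> real" where
  "Phi y = exp (- (norm y)\<^sup>2 / 2) /
     ((1 + norm y) powr (real DIM('a) / 2) * ln (exp 1 + norm y) powr (3 / 2))"

definition measures_Phi :: "('a::euclidean_space set \<Rightarrow> complex) set" where
  "measures_Phi =
     {\<nu>. locally_finite_complex_measure \<nu> \<and>
          (\<integral>\<^sup>+ y. ennreal (Phi y) \<partial>total_variation \<nu>) < \<infinity>}"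

definition nontangential_limit ::
    "real \<Rightarrow> 'a::euclidean_space \<Rightarrow> (real \<Rightarrow> 'a \<Rightarrow> complex) \<Rightarrow> complex \<Rightarrow> bool" where
  "nontangential_limit \<alpha> x0 u l \<longleftrightarrow>
     ((\<lambda>(t, x). u t x) \<longlongrightarrow> l) (at (0, x0) within {(t, x). 0 < t \<and> norm (x - x0) < \<alpha> * t})"

end

theory Submission
  imports Defs "HOL-Probability.Distributions"
begin

text \<open>
  For fixed \<open>s \<in> (0,1)\<close> the integrand of the Poisson--Hermite kernel contains Mehler's kernel.
  Completing the square in \<open>y\<close> gives
  \<open>|x - y|\<^sup>2/s + s|x + y|\<^sup>2 = (s + 1/s) |y - \<theta> x|\<^sup>2 + 4s/(1 + s\<^sup>2) |x|\<^sup>2\<close> with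
  \<open>\<theta> = (1 - s\<^sup>2)/(1 + s\<^sup>2)\<close>, so that, as a function of \<open>y\<close>, Mehler's kernel is exactly a Gaussian
  which is radial about the point \<open>\<theta> x\<close> instead of \<open>x\<close> (\<open>mehler_kernel_shift\<close>). Integrating a
  radial Gaussian, cut off at distance \<open>\<delta>\<close> from its centre, against a measure only involves the
  values of the measure on balls about that centre (\<open>gaussian_layer_cake\<close>). This is why a condition
  on the balls \<open>B\<^sub>r(x)\<close> for all \<open>x\<close> near \<open>x\<^sub>0\<close>, and not only on those centred at \<open>x\<^sub>0\<close>, is the right
  one: the centre \<open>\<theta> x\<close> moves with \<open>s\<close>, but \<open>|\<theta> x - x| \<le> 2s\<^sup>2|x|\<close> is at most of the order of the
  width \<open>\<surd>s\<close> of the Gaussian.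

  The remaining factor of the integrand is a probability density in \<open>s\<close>, the \<open>subordinator\<close>; the
  substitution \<open>s = tanh (t\<^sup>2/(4q\<^sup>2))\<close> turns it into a half-Gaussian in \<open>q\<close>. If
  \<open>\<mu> = \<nu> - \<ell> dy\<close> satisfies \<open>|\<mu>(B\<^sub>r(z))| \<le> \<epsilon> (|z - x\<^sub>0| + r)\<^sup>d\<close> for small balls, then the part of
  \<open>\<integral> P\<^sub>t(x,y) d\<mu>(y)\<close> with \<open>s\<close> small and \<open>y\<close> close to \<open>\<theta> x\<close> is at most a multiple of \<open>\<epsilon>\<close> times the mean of
  \<open>(\<alpha>t/\<surd>s + C)\<^sup>d\<close> over \<open>s\<close>. That mean is bounded independently of \<open>t\<close>, because the density
  contains \<open>exp (- t\<^sup>2/\<kappa>(s))\<close> and, for small \<open>s\<close>, \<open>\<kappa>(s)\<close> is comparable to \<open>s\<close> (\<open>norm_sum_near_centre_le\<close>).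

  Everywhere else no cancellation is needed: the integrand there is \<open>O(t \<Phi>(y))\<close> after integration in
  \<open>s\<close>, for \<open>x\<close> in a bounded set, and \<open>\<Phi>\<close> is integrable with respect to \<open>|\<mu>|\<close>
  (\<open>nn_integral_far_from_centre\<close>). The logarithm and the power in \<open>\<Phi>\<close> come from \<open>s\<close> near \<open>1\<close>.

  Finally \<open>\<integral> P\<^sub>t(x,y) dy\<close> is computed from Gaussian integrals and tends to \<open>1\<close>
  (\<open>poisson_hermite_lborel_tendsto_one\<close>), which restores the term \<open>\<ell>\<close>. To avoid integrals against
  set functions, \<open>\<mu>\<close> is handled as a complex linear combination of five positive measures: the
  positive and negative variations of the real and imaginary parts of \<open>\<nu>\<close>, and Lebesgue measure.
\<close>

section \<open>Variation measures\<close>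

lemma SUP_add_SUP_le:
  fixes c :: ennreal
  assumes "\<And>a b. a \<in> I \<Longrightarrow> b \<in> J \<Longrightarrow> f a + g b \<le> c" and "I \<noteq> {}" "J \<noteq> {}"
  shows "(SUP a\<in>I. f a) + (SUP b\<in>J. g b) \<le> c"
proof -
  have "f a + (SUP b\<in>J. g b) \<le> c" if "a \<in> I" for a
    using assms that by (subst ennreal_SUP_add_right) (auto intro: SUP_least)
  then show ?thesis
    using assms by (subst ennreal_SUP_add_left[symmetric]) (auto intro: SUP_least)
qed

text \<open>
  Both variations are suprema over families of bounded sets. For such suprema, superadditivity on two
  disjoint sets comes from joining families and countable subadditivity from cutting one family, so
  these two properties are the convenient route to countable additivity.
\<close>

lemma emeasure_measure_of_superadditive:
  fixes V :: "'a::topological_space set \<Rightarrow> ennreal"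
  assumes empty: "V {} = 0"
    and super: "\<And>A B. A \<in> sets borel \<Longrightarrow> B \<in> sets borel \<Longrightarrow> A \<inter> B = {} \<Longrightarrow> V A + V B \<le> V (A \<union> B)"
    and sub: "\<And>A :: nat \<Rightarrow> 'a set. range A \<subseteq> sets borel \<Longrightarrow> disjoint_family A \<Longrightarrow> V (\<Union>i. A i) \<le> (\<Sum>i. V (A i))"
    and E: "E \<in> sets borel"
  shows "emeasure (measure_of UNIV (sets borel) V) E = V E"
proof (rule emeasure_measure_of_sigma)
  show "sigma_algebra UNIV (sets borel :: 'a set set)"
    using sets.sigma_algebra_axioms[of "borel :: 'a measure"] by simp
  show "positive (sets borel) V" by (simp add: positive_def empty)
  show "countably_additive (sets borel) V"
  proof (rule countably_additiveI)
    fix A :: "nat \<Rightarrow> 'a set"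
    assume A: "range A \<subseteq> sets borel" "disjoint_family A"
    have m: "(\<Union>i\<in>I. A i) \<in> sets borel" for I
      using A by (intro sets.countable_UN') auto
    have mono: "V B \<le> V C" if "B \<in> sets borel" "C \<in> sets borel" "B \<subseteq> C" for B C
    proof -
      have "V B \<le> V B + V (C - B)" by simp
      also have "\<dots> \<le> V (B \<union> (C - B))" using that by (intro super) auto
      also have "B \<union> (C - B) = C" using that by auto
      finally show ?thesis .
    qed
    have fin: "(\<Sum>i<n. V (A i)) \<le> V (\<Union>i<n. A i)" for n
    proof (induction n)
      case (Suc n)
      have "(\<Sum>i<Suc n. V (A i)) \<le> V (\<Union>i<n. A i) + V (A n)"
        using Suc by (simp add: add_right_mono)
      also have "\<dots> \<le> V ((\<Union>i<n. A i) \<union> A n)"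
      proof (intro super m)
        show "A n \<in> sets borel" using A by auto
        show "(\<Union>i<n. A i) \<inter> A n = {}"
          using disjoint_family_onD[OF A(2), of _ n] by fastforce
      qed
      also have "(\<Union>i<n. A i) \<union> A n = (\<Union>i<Suc n. A i)" by (auto simp: lessThan_Suc)
      finally show ?case .
    qed (simp add: empty)
    have "(\<Sum>i. V (A i)) \<le> V (\<Union>i. A i)"
      unfolding suminf_eq_SUP
    proof (rule SUP_least)
      fix n
      show "(\<Sum>i<n. V (A i)) \<le> V (\<Union>i. A i)"
        using fin[of n] by (rule order_trans) (intro mono m, auto)
    qed
    with sub[OF A] show "(\<Sum>i. V (A i)) = V (\<Union>i. A i)" by (rule antisym[rotated])
  qed
qed (use E in simp)

context
  fixes \<mu> :: "'a::euclidean_space set \<Rightarrow> real"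
  assumes \<mu>: "locally_finite_signed_measure \<mu>"
begin

lemma locally_finite_signed_measure_sums:
  assumes "range A \<subseteq> sets borel" "disjoint_family A" "bounded (\<Union>i::nat. A i)"
  shows "(\<lambda>i. \<mu> (A i)) sums \<mu> (\<Union>i. A i)"
  using \<mu> assms unfolding locally_finite_signed_measure_def by blast

lemma locally_finite_signed_measure_empty: "\<mu> {} = 0"
proof -
  have "(\<lambda>i::nat. \<mu> {}) sums \<mu> (\<Union>i::nat. {})"
    by (rule locally_finite_signed_measure_sums) (auto simp: disjoint_family_on_def)
  then have "summable (\<lambda>i::nat. \<mu> {})" by (rule sums_summable)
  then show ?thesis by (simp add: summable_const_iff)
qed

lemma locally_finite_signed_measure_Un:
  assumes "A \<in> sets borel" "B \<in> sets borel" "bounded A" "bounded B" "A \<inter> B = {}"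
  shows "\<mu> (A \<union> B) = \<mu> A + \<mu> B"
proof -
  have "(\<lambda>i. \<mu> (binaryset A B i)) sums \<mu> (\<Union>i. binaryset A B i)"
    using assms by (intro locally_finite_signed_measure_sums)
      (auto simp: range_binaryset_eq UN_binaryset_eq disjoint_family_on_def binaryset_def)
  moreover have "(\<lambda>i. \<mu> (binaryset A B i)) sums (\<mu> A + \<mu> B)"
    by (rule binaryset_sums) (rule locally_finite_signed_measure_empty)
  ultimately show ?thesis by (simp add: UN_binaryset_eq sums_unique2)
qed

end

lemma locally_finite_signed_measure_uminus:
  "locally_finite_signed_measure \<mu> \<Longrightarrow> locally_finite_signed_measure (\<lambda>E. - \<mu> E)"
  unfolding locally_finite_signed_measure_def by (auto intro: sums_minus)

lemma locally_finite_complex_measureD: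
  assumes "locally_finite_complex_measure \<nu>"
  shows "range A \<subseteq> sets borel \<Longrightarrow> disjoint_family A \<Longrightarrow> bounded (\<Union>i::nat. A i) \<Longrightarrow>
           (\<lambda>i. \<nu> (A i)) sums \<nu> (\<Union>i. A i)"
    and "\<nu> {} = 0"
proof -
  have re: "locally_finite_signed_measure (\<lambda>E. Re (\<nu> E))"
    and im: "locally_finite_signed_measure (\<lambda>E. Im (\<nu> E))"
    using assms by (auto simp: locally_finite_complex_measure_def)
  show "\<nu> {} = 0"
    using locally_finite_signed_measure_empty[OF re] locally_finite_signed_measure_empty[OF im]
    by (simp add: complex_eq_iff)
  show "(\<lambda>i. \<nu> (A i)) sums \<nu> (\<Union>i. A i)"
    if "range A \<subseteq> sets borel" "disjoint_family A" "bounded (\<Union>i::nat. A i)"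
    unfolding sums_complex_iff
    using locally_finite_signed_measure_sums[OF re that] locally_finite_signed_measure_sums[OF im that]
    by blast
qed

lemma space_variation [simp]:
  "space (positive_variation \<mu>) = UNIV" "space (total_variation \<nu>) = UNIV"
  by (simp_all add: positive_variation_def total_variation_def space_measure_of_conv)

lemma sets_variation [simp, measurable_cong]:
  "sets (positive_variation \<mu>) = sets borel" "sets (total_variation \<nu>) = sets borel"
  unfolding positive_variation_def total_variation_def
  by (simp_all only: space_borel[symmetric] sets.sets_measure_of_eq)

text \<open>
  For the two inequalities required of the supremum: two competitors inside disjoint sets have a union
  that is again a bounded competitor, and a bounded competitor inside a countable union is cut into
  its pieces, over which \<open>\<mu>\<close> is summable.
\<close>

lemma emeasure_positive_variation:
  fixes \<mu> :: "'a::euclidean_space set \<Rightarrow> real"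
  assumes \<mu>: "locally_finite_signed_measure \<mu>" and E: "E \<in> sets borel"
  shows "emeasure (positive_variation \<mu>) E =
    (SUP A \<in> {A. A \<in> sets borel \<and> bounded A \<and> A \<subseteq> E}. ennreal (\<mu> A))"
  unfolding positive_variation_def
proof (rule emeasure_measure_of_superadditive[OF _ _ _ E], goal_cases)
  case 1
  have "{A. A \<in> sets borel \<and> bounded A \<and> A \<subseteq> {}} = {{} :: 'a set}" by auto
  then show ?case using \<mu> by (simp add: locally_finite_signed_measure_empty)
next
  case (2 E F)
  let ?V = "\<lambda>E. SUP A \<in> {A. A \<in> sets borel \<and> bounded A \<and> A \<subseteq> E}. ennreal (\<mu> A)"
  let ?B = "\<lambda>E::'a set. {A. A \<in> sets borel \<and> bounded A \<and> A \<subseteq> E}"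
  have ne: "?B E \<noteq> {}" for E by (auto intro!: exI[of _ "{}"])
  have "ennreal (\<mu> A) + ennreal (\<mu> B) \<le> ?V (E \<union> F)"
    if A: "A \<in> ?B E" and B: "B \<in> ?B F" for A B
  proof -
    have up: "ennreal (\<mu> C) \<le> ?V (E \<union> F)" if "C \<in> ?B (E \<union> F)" for C
      by (rule SUP_upper[OF that])
    consider "\<mu> A < 0" | "\<mu> B < 0" | "0 \<le> \<mu> A" "0 \<le> \<mu> B" by linarith
    then show ?thesis
    proof cases
      case 3
      have "\<mu> (A \<union> B) = \<mu> A + \<mu> B"
        using A B 2 by (intro locally_finite_signed_measure_Un[OF \<mu>]) auto
      then show ?thesis using up[of "A \<union> B"] A B 3 by (auto simp: ennreal_plus)
    qed (use up[of A] up[of B] A B in \<open>auto simp: ennreal_neg\<close>)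
  qed
  then show ?case by (intro SUP_add_SUP_le ne)
next
  case (3 E)
  show ?case
  proof (rule SUP_least)
    fix A :: "'a set" assume "A \<in> {A. A \<in> sets borel \<and> bounded A \<and> A \<subseteq> (\<Union>i. E i)}"
    then have A: "A \<in> sets borel" "bounded A" "A \<subseteq> (\<Union>i. E i)" by auto
    let ?V = "\<lambda>E. SUP A \<in> {A. A \<in> sets borel \<and> bounded A \<and> A \<subseteq> E}. ennreal (\<mu> A)"
    have eq: "(\<Union>i. A \<inter> E i) = A" using A by auto
    have "(\<lambda>i. \<mu> (A \<inter> E i)) sums \<mu> A"
      using locally_finite_signed_measure_sums[OF \<mu>, of "\<lambda>i. A \<inter> E i"] 3 A eq
      by (auto simp: disjoint_family_on_def)
    then have lim: "(\<lambda>n. ennreal (\<Sum>i<n. \<mu> (A \<inter> E i))) \<longlonglongrightarrow> ennreal (\<mu> A)"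
      by (auto simp: sums_def)
    have sum_le: "ennreal (\<Sum>i<n. f i) \<le> (\<Sum>i<n. ennreal (f i))" for f :: "nat \<Rightarrow> real" and n
      proof (induction n)
      case (Suc n)
      have "ennreal (a + b) \<le> ennreal a + ennreal b" for a b
        by (cases "a \<ge> 0"; cases "b \<ge> 0")
          (auto simp: ennreal_neg intro: ennreal_leI simp flip: ennreal_plus)
      from this[of "\<Sum>i<n. f i" "f n"] Suc show ?case
        by (auto intro: order_trans add_right_mono)
    qed simp
    have "ennreal (\<Sum>i<n. \<mu> (A \<inter> E i)) \<le> (\<Sum>i. ?V (E i))" for n
    proof -
      have "ennreal (\<Sum>i<n. \<mu> (A \<inter> E i)) \<le> (\<Sum>i<n. ennreal (\<mu> (A \<inter> E i)))" by (rule sum_le)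
      also have "\<dots> \<le> (\<Sum>i<n. ?V (E i))"
        using A 3 by (intro sum_mono SUP_upper) (auto intro: bounded_subset)
      also have "\<dots> \<le> (\<Sum>i. ?V (E i))" by (rule sum_le_suminf) auto
      finally show ?thesis .
    qed
    then show "ennreal (\<mu> A) \<le> (\<Sum>i. ?V (E i))"
      by (intro LIMSEQ_le_const2[OF lim]) auto
  qed
qed

text \<open>
  As for the positive variation, with finite disjoint families in place of single sets. Joining or
  cutting families may identify members, but only empty ones, on which \<open>\<nu>\<close> vanishes.
\<close>

lemma emeasure_total_variation:
  fixes \<nu> :: "'a::euclidean_space set \<Rightarrow> complex"
  assumes \<nu>: "locally_finite_complex_measure \<nu>" and E: "E \<in> sets borel"
  shows "emeasure (total_variation \<nu>) E =
    (SUP P \<in> {P. finite P \<and> disjoint P \<and> (\<forall>A\<in>P. A \<in> sets borel \<and> bounded A \<and> A \<subseteq> E)}.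
            \<Sum>A\<in>P. ennreal (norm (\<nu> A)))"
  unfolding total_variation_def
proof (rule emeasure_measure_of_superadditive[OF _ _ _ E], goal_cases)
  note \<nu>0 = locally_finite_complex_measureD(2)[OF \<nu>]
  case 1
  have "(\<Sum>A\<in>P. ennreal (norm (\<nu> A))) = 0" if "\<forall>A\<in>P. A \<subseteq> {}" for P
    using that by (intro sum.neutral) (auto simp: \<nu>0)
  then show ?case by (intro antisym SUP_least) auto
next
  note \<nu>0 = locally_finite_complex_measureD(2)[OF \<nu>]
  case (2 E F)
  let ?B = "\<lambda>E::'a set. {P. finite P \<and> disjoint P \<and> (\<forall>A\<in>P. A \<in> sets borel \<and> bounded A \<and> A \<subseteq> E)}"
  let ?V = "\<lambda>E. SUP P \<in> ?B E. \<Sum>A\<in>P. ennreal (norm (\<nu> A))"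
  have ne: "?B E \<noteq> {}" for E by (auto intro!: exI[of _ "{}"])
  have "(\<Sum>A\<in>P. ennreal (norm (\<nu> A))) + (\<Sum>A\<in>Q. ennreal (norm (\<nu> A))) \<le> ?V (E \<union> F)"
    if P: "P \<in> ?B E" and Q: "Q \<in> ?B F" for P Q
  proof -
    \<comment> \<open>A common member lies in both of the disjoint sets, hence is empty.\<close>
    have z: "\<forall>A\<in>P \<inter> Q. ennreal (norm (\<nu> A)) = 0"
    proof
      fix A assume "A \<in> P \<inter> Q"
      then have "A \<subseteq> E \<inter> F" using P Q by auto
      then show "ennreal (norm (\<nu> A)) = 0" using 2 by (auto simp: \<nu>0)
    qed
    have "(\<Sum>A\<in>P \<union> Q. ennreal (norm (\<nu> A))) = (\<Sum>A\<in>P. ennreal (norm (\<nu> A))) + (\<Sum>A\<in>Q. ennreal (norm (\<nu> A)))"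
      using P Q z by (intro sum.union_inter_neutral) auto
    moreover have "P \<union> Q \<in> ?B (E \<union> F)"
    proof -
      have "disjoint (P \<union> Q)"
        unfolding pairwise_def disjnt_def
      proof (intro ballI impI)
        fix A B assume AB: "A \<in> P \<union> Q" "B \<in> P \<union> Q" "A \<noteq> B"
        have "A \<inter> B = {}" if "A \<in> P" "B \<in> P" using P that AB by (auto simp: pairwise_def disjnt_def)
        moreover have "A \<inter> B = {}" if "A \<in> Q" "B \<in> Q" using Q that AB by (auto simp: pairwise_def disjnt_def)
        moreover have "A \<inter> B = {}" if "A \<in> P" "B \<in> Q"
        proof -
          have "A \<subseteq> E" "B \<subseteq> F" using that P Q by auto
          then show ?thesis using 2 by blast
        qed
        moreover have "A \<inter> B = {}" if "A \<in> Q" "B \<in> P"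
        proof -
          have "A \<subseteq> F" "B \<subseteq> E" using that P Q by auto
          then show ?thesis using 2 by blast
        qed
        ultimately show "A \<inter> B = {}" using AB by blast
      qed
      then show ?thesis using P Q by auto
    qed
    ultimately show ?thesis by (metis (no_types, lifting) SUP_upper)
  qed
  then show ?case by (intro SUP_add_SUP_le ne)
next
  note \<nu>0 = locally_finite_complex_measureD(2)[OF \<nu>]
  case (3 E)
  let ?B = "\<lambda>E::'a set. {P. finite P \<and> disjoint P \<and> (\<forall>A\<in>P. A \<in> sets borel \<and> bounded A \<and> A \<subseteq> E)}"
  let ?V = "\<lambda>E. SUP P \<in> ?B E. \<Sum>A\<in>P. ennreal (norm (\<nu> A))"
  show ?case
  proof (rule SUP_least)
    fix P assume P: "P \<in> ?B (\<Union>i. E i)"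
    have le1: "ennreal (norm (\<nu> A)) \<le> (\<Sum>i. ennreal (norm (\<nu> (A \<inter> E i))))" if "A \<in> P" for A
    proof -
      have A: "A \<in> sets borel" "bounded A" "A \<subseteq> (\<Union>i. E i)" using P that by auto
      have eq: "(\<Union>i. A \<inter> E i) = A" using A by auto
      have "(\<lambda>i. \<nu> (A \<inter> E i)) sums \<nu> A"
        using locally_finite_complex_measureD(1)[OF \<nu>, of "\<lambda>i. A \<inter> E i"] 3 A eq
        by (auto simp: disjoint_family_on_def)
      then have lim: "(\<lambda>n. ennreal (norm (\<Sum>i<n. \<nu> (A \<inter> E i)))) \<longlonglongrightarrow> ennreal (norm (\<nu> A))"
        by (auto simp: sums_def intro!: tendsto_ennrealI tendsto_norm)
      have "ennreal (norm (\<Sum>i<n. \<nu> (A \<inter> E i))) \<le> (\<Sum>i. ennreal (norm (\<nu> (A \<inter> E i))))" for n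
      proof -
        have "ennreal (norm (\<Sum>i<n. \<nu> (A \<inter> E i))) \<le> (\<Sum>i<n. ennreal (norm (\<nu> (A \<inter> E i))))"
          by (subst sum_ennreal) (auto intro!: ennreal_leI norm_sum)
        also have "\<dots> \<le> (\<Sum>i. ennreal (norm (\<nu> (A \<inter> E i))))" by (rule sum_le_suminf) auto
        finally show ?thesis .
      qed
      then show ?thesis by (intro LIMSEQ_le_const2[OF lim]) auto
    qed
    have le2: "(\<Sum>A\<in>P. ennreal (norm (\<nu> (A \<inter> E i)))) \<le> ?V (E i)" for i
    proof -
      have nz: "\<nu> (A \<inter> E i) = 0" if "A \<in> P" "B \<in> P" "A \<noteq> B" "A \<inter> E i = B \<inter> E i" for A B
      proof -
        have "A \<inter> B = {}" using P that by (auto simp: pairwise_def disjnt_def)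
        then have "A \<inter> E i = {}" using that by blast
        then show ?thesis by (simp add: \<nu>0)
      qed
      have "(\<Sum>A\<in>P. ennreal (norm (\<nu> (A \<inter> E i)))) = (\<Sum>A\<in>(\<lambda>A. A \<inter> E i) ` P. ennreal (norm (\<nu> A)))"
        using P nz by (subst sum.reindex_nontrivial) (auto simp: o_def)
      also have "\<dots> \<le> ?V (E i)"
      proof (rule SUP_upper)
        have "disjoint ((\<lambda>A. A \<inter> E i) ` P)"
          using P unfolding pairwise_def disjnt_def by fast
        then show "(\<lambda>A. A \<inter> E i) ` P \<in> ?B (E i)"
          using P 3 by (auto intro: bounded_subset)
      qed
      finally show ?thesis .
    qed
    have "(\<Sum>A\<in>P. ennreal (norm (\<nu> A))) \<le> (\<Sum>A\<in>P. \<Sum>i. ennreal (norm (\<nu> (A \<inter> E i))))"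
      by (intro sum_mono le1)
    also have "\<dots> = (\<Sum>i. \<Sum>A\<in>P. ennreal (norm (\<nu> (A \<inter> E i))))"
      by (rule suminf_sum[symmetric]) auto
    also have "\<dots> \<le> (\<Sum>i. ?V (E i))" by (intro suminf_le le2) auto
    finally show "(\<Sum>A\<in>P. ennreal (norm (\<nu> A))) \<le> (\<Sum>i. ?V (E i))" .
  qed
qed

lemma positive_variation_le_total_variation:
  fixes \<nu> :: "'a::euclidean_space set \<Rightarrow> complex"
  assumes \<nu>: "locally_finite_complex_measure \<nu>" and \<mu>: "locally_finite_signed_measure \<mu>"
    and le: "\<And>A. \<mu> A \<le> norm (\<nu> A)"
  shows "positive_variation \<mu> \<le> total_variation \<nu>"
proof (subst le_measure, simp, intro ballI)
  fix E :: "'a set" assume "E \<in> sets (positive_variation \<mu>)"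
  then have E: "E \<in> sets borel" by simp
  show "emeasure (positive_variation \<mu>) E \<le> emeasure (total_variation \<nu>) E"
    unfolding emeasure_positive_variation[OF \<mu> E] emeasure_total_variation[OF \<nu> E]
  proof (rule SUP_mono)
    fix A assume "A \<in> {A. A \<in> sets borel \<and> bounded A \<and> A \<subseteq> E}"
    then show "\<exists>P\<in>{P. finite P \<and> disjoint P \<and> (\<forall>A\<in>P. A \<in> sets borel \<and> bounded A \<and> A \<subseteq> E)}.
        ennreal (\<mu> A) \<le> (\<Sum>A\<in>P. ennreal (norm (\<nu> A)))"
      by (intro bexI[of _ "{A}"]) (auto intro: ennreal_leI le)
  qed
qed

text \<open>
  The Jordan decomposition without a Hahn set: for \<open>B \<subseteq> A\<close> one has \<open>\<mu> B = \<mu> A + (- \<mu>) (A - B)\<close>, and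
  taking suprema over \<open>B\<close> compares the two variations. Finiteness makes the subtraction legitimate.
\<close>

lemma signed_measure_eq_diff_variation:
  fixes \<mu> :: "'a::euclidean_space set \<Rightarrow> real"
  assumes \<mu>: "locally_finite_signed_measure \<mu>"
    and A: "A \<in> sets borel" "bounded A"
    and fin: "emeasure (positive_variation \<mu>) A < \<infinity>"
      "emeasure (positive_variation (\<lambda>E. - \<mu> E)) A < \<infinity>"
  shows "\<mu> A = measure (positive_variation \<mu>) A - measure (positive_variation (\<lambda>E. - \<mu> E)) A"
proof -
  have le: "measure (positive_variation \<mu>) A \<le> \<mu> A + measure (positive_variation (\<lambda>E. - \<mu> E)) A"
    if \<mu>: "locally_finite_signed_measure \<mu>"
      and fin: "emeasure (positive_variation \<mu>) A < \<infinity>"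
        "emeasure (positive_variation (\<lambda>E. - \<mu> E)) A < \<infinity>" for \<mu> :: "'a set \<Rightarrow> real"
  proof -
    let ?n = "measure (positive_variation (\<lambda>E. - \<mu> E)) A"
    have n: "- \<mu> B \<le> ?n" if "B \<in> sets borel" "B \<subseteq> A" for B
    proof -
      have "ennreal (- \<mu> B) \<le> emeasure (positive_variation (\<lambda>E. - \<mu> E)) A"
        unfolding emeasure_positive_variation[OF locally_finite_signed_measure_uminus[OF \<mu>] A(1)]
        using that A by (intro SUP_upper) (auto intro: bounded_subset)
      also have "\<dots> = ennreal ?n" using fin by (intro emeasure_eq_ennreal_measure) auto
      finally show ?thesis by (subst (asm) ennreal_le_iff) auto
    qed
    have p: "\<mu> B \<le> \<mu> A + ?n" if "B \<in> sets borel" "B \<subseteq> A" for B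
    proof -
      have "\<mu> (B \<union> (A - B)) = \<mu> B + \<mu> (A - B)"
        using A that by (intro locally_finite_signed_measure_Un[OF \<mu>]) (auto intro: bounded_subset)
      moreover have "B \<union> (A - B) = A" using that by auto
      ultimately show ?thesis using n[of "A - B"] that A by auto
    qed
    have "emeasure (positive_variation \<mu>) A \<le> ennreal (\<mu> A + ?n)"
      unfolding emeasure_positive_variation[OF \<mu> A(1)]
      by (intro SUP_least ennreal_leI p) auto
    then have "ennreal (measure (positive_variation \<mu>) A) \<le> ennreal (\<mu> A + ?n)"
      using fin by (subst emeasure_eq_ennreal_measure[symmetric]) auto
    moreover have "0 \<le> \<mu> A + ?n"
      using p[of "{}"] by (simp add: locally_finite_signed_measure_empty[OF \<mu>])
    ultimately show ?thesis by (simp add: ennreal_le_iff)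
  qed
  \<comment> \<open>The reverse inequality is the same statement for \<open>- \<mu>\<close>.\<close>
  from le[OF \<mu> fin] le[OF locally_finite_signed_measure_uminus[OF \<mu>]] fin
  show ?thesis by simp
qed

section \<open>Subordination of Mehler's kernel\<close>

text \<open>
  The normalisation, including \<open>1 - s\<^sup>2\<close>, makes this a probability density on \<open>(0,1)\<close>, and leaves
  exactly the kernel of \<open>exp (- \<tau> L)\<close> with \<open>s = tanh \<tau>\<close> as the other factor of the
  Poisson--Hermite integrand.
\<close>

definition subordinator :: "real \<Rightarrow> real \<Rightarrow> real" where
  "subordinator t s = 4 * t * exp (- t\<^sup>2 / kappa s) / (sqrt pi * kappa s powr (3 / 2) * (1 - s\<^sup>2))"

text \<open>
  The kernel of \<open>exp (- \<tau> L)\<close> at the time \<open>\<tau>\<close> given by \<open>s = tanh \<tau>\<close>.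
\<close>

definition mehler_kernel :: "real \<Rightarrow> 'a::euclidean_space \<Rightarrow> 'a \<Rightarrow> real" where
  "mehler_kernel s x y = ((1 - s\<^sup>2) / (4 * pi * s)) powr (real DIM('a) / 2) *
     exp (- (1 / 4) * ((norm (x - y))\<^sup>2 / s + s * (norm (x + y))\<^sup>2))"

definition mehler_centre :: "real \<Rightarrow> 'a::euclidean_space \<Rightarrow> 'a" where
  "mehler_centre s x = ((1 - s\<^sup>2) / (1 + s\<^sup>2)) *\<^sub>R x"

lemma one_minus_square_pos: "0 < s \<Longrightarrow> s < 1 \<Longrightarrow> 0 < 1 - (s::real)\<^sup>2"
  by (simp add: power_less_one_iff abs_square_less_1)

lemma kappa_ge:
  assumes "0 < s" "s < 1" 
  shows "2 * ln (1 / (1 - s)) \<le> kappa s" "2 * s \<le> kappa s"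
proof -
  have "ln (1 / (1 - s)) \<le> ln ((1 + s) / (1 - s))"
    using assms by (intro ln_mono) (auto simp: divide_right_mono)
  then show 1: "2 * ln (1 / (1 - s)) \<le> kappa s" by (simp add: kappa_def)
  have "ln (1 - s) \<le> - s" using ln_le_minus_one[of "1 - s"] assms by simp
  then show "2 * s \<le> kappa s" using 1 assms by (simp add: ln_div)
qed

lemma kappa_le: 
  assumes "0 < s" "s \<le> 1 / 2" 
  shows "kappa s \<le> 8 * s"
proof -
  have "ln ((1 + s) / (1 - s)) \<le> (1 + s) / (1 - s) - 1"
    using assms by (intro ln_le_minus_one) auto
  also have "\<dots> = 2 * s / (1 - s)" using assms by (simp add: field_simps)
  also have "\<dots> \<le> 2 * s / (1 / 2)" using assms by (intro divide_left_mono) auto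
  finally show ?thesis by (simp add: kappa_def)
qed

lemma kappa_pos: "0 < s \<Longrightarrow> s < 1 \<Longrightarrow> 0 < kappa s"
  using kappa_ge(2)[of s] by simp

lemma kappa_mono: 
  assumes "0 < r" "r \<le> s" "s < 1" shows "kappa r \<le> kappa s"
  unfolding kappa_def using assms
  by (intro mult_left_mono ln_mono frac_le) auto

lemma kappa_tanh: "kappa (tanh u) = 4 * u"
proof -
  define e where "e = exp (- (2 * u))"
  have e: "e > 0" "tanh u = (1 - e) / (1 + e)" by (simp_all add: e_def tanh_real_altdef)
  have "(1 + tanh u) / (1 - tanh u) = 1 / e" 
  proof -
    have "1 + (1 - e) / (1 + e) = 2 / (1 + e)" "1 - (1 - e) / (1 + e) = 2 * e / (1 + e)"
      using e(1) by (simp_all add: field_simps)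
    moreover have "1 + e \<noteq> 0" "e \<noteq> 0" using e(1) by auto
    ultimately show ?thesis unfolding e(2) by (simp add: divide_simps)
  qed
  also have "\<dots> = exp (2 * u)" by (simp add: e_def exp_minus field_simps)
  finally show ?thesis by (simp add: kappa_def)
qed

lemma tanh_kappa:
  assumes "0 < s" "s < 1" shows "tanh (kappa s / 4) = s"
proof -
  have "exp (- (2 * (kappa s / 4))) = 1 / exp (ln ((1 + s) / (1 - s)))"
    by (simp add: kappa_def exp_minus inverse_eq_divide)
  also have "\<dots> = (1 - s) / (1 + s)" using assms by simp
  finally have E: "exp (- (2 * (kappa s / 4))) = (1 - s) / (1 + s)" .
  have "1 - (1 - s) / (1 + s) = 2 * s / (1 + s)" "1 + (1 - s) / (1 + s) = 2 / (1 + s)"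
    using assms by (simp_all add: field_simps)
  then show ?thesis
    using assms E unfolding tanh_real_altdef by simp
qed

lemma kappa_measurable [measurable]: "kappa \<in> borel_measurable borel"
  unfolding kappa_def by measurable

lemma subordinator_measurable [measurable]: "subordinator t \<in> borel_measurable borel"
  unfolding subordinator_def by measurable

lemma subordinator_nonneg: "0 \<le> t \<Longrightarrow> 0 < s \<Longrightarrow> s < 1 \<Longrightarrow> 0 \<le> subordinator t s"
  using one_minus_square_pos[of s] by (simp add: subordinator_def)

lemma mehler_kernel_nonneg: "0 \<le> mehler_kernel s x y"
  by (simp add: mehler_kernel_def)

lemma poisson_hermite_kernel_eq:
  fixes x y :: "'a::euclidean_space"
  shows "poisson_hermite_kernel t x y = (LBINT s:{0<..<1}. subordinator t s * mehler_kernel s x y)"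
proof -
  let ?d = "real DIM('a)"
  have c: "8 * (4 * pi) powr (- (?d + 1) / 2) = 4 / (sqrt pi * (4 * pi) powr (?d / 2))"
  proof -
    have "(4 * pi) powr (- (?d + 1) / 2) = (4 * pi) powr (- (?d / 2)) * (4 * pi) powr (- (1 / 2))"
      by (simp add: field_simps flip: powr_add)
    also have "(4 * pi) powr (- (1 / 2)) = 1 / (2 * sqrt pi)"
      by (simp add: powr_minus powr_half_sqrt real_sqrt_mult field_simps)
    finally show ?thesis by (simp add: powr_minus field_simps)
  qed
  have "subordinator t s * mehler_kernel s x y =
     8 * (4 * pi) powr (- (?d + 1) / 2) * t *
        (exp (- t\<^sup>2 / kappa s) * (1 - s\<^sup>2) powr (?d / 2 - 1) *
        exp (- (1 / 4) * ((norm (x - y))\<^sup>2 / s + s * (norm (x + y))\<^sup>2)) /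
        (s powr (?d / 2) * kappa s powr (3 / 2)))" if s: "s \<in> {0<..<1}" for s
  proof -
    have p: "0 < 1 - s\<^sup>2" using s one_minus_square_pos by auto
    have "(1 - s\<^sup>2) powr (?d / 2 - 1) = (1 - s\<^sup>2) powr (?d / 2) / (1 - s\<^sup>2)"
      using p by (simp add: powr_diff)
    moreover have "((1 - s\<^sup>2) / (4 * pi * s)) powr (?d / 2) =
        (1 - s\<^sup>2) powr (?d / 2) / ((4 * pi) powr (?d / 2) * s powr (?d / 2))"
      using p s by (simp add: powr_divide powr_mult)
    ultimately show ?thesis
      unfolding c subordinator_def mehler_kernel_def by (simp add: mult_ac)
  qed
  then have "(LBINT s:{0<..<1}. subordinator t s * mehler_kernel s x y) = (LBINT s:{0<..<1}.
        8 * (4 * pi) powr (- (?d + 1) / 2) * t *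
        (exp (- t\<^sup>2 / kappa s) * (1 - s\<^sup>2) powr (?d / 2 - 1) *
        exp (- (1 / 4) * ((norm (x - y))\<^sup>2 / s + s * (norm (x + y))\<^sup>2)) /
        (s powr (?d / 2) * kappa s powr (3 / 2))))"
    by (intro set_lebesgue_integral_cong) auto
  then show ?thesis
    unfolding poisson_hermite_kernel_def by (simp only: set_integral_mult_right)
qed

text \<open>
  Completing the square in \<open>y\<close>.
\<close>

lemma mehler_kernel_shift:
  fixes x y :: "'a::euclidean_space"
  assumes "0 < s"
  shows "mehler_kernel s x y = ((1 - s\<^sup>2) / (4 * pi * s)) powr (real DIM('a) / 2) *
     exp (- (s / (1 + s\<^sup>2) * (norm x)\<^sup>2)) * exp (- ((1 + s\<^sup>2) / (4 * s) * (norm (y - mehler_centre s x))\<^sup>2))"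
proof -
  have p: "1 + s\<^sup>2 > 0" by (simp add: add_pos_nonneg)
  have e: "- (1 / 4) * ((norm (x - y))\<^sup>2 / s + s * (norm (x + y))\<^sup>2) =
     - (s / (1 + s\<^sup>2) * (norm x)\<^sup>2) + - ((1 + s\<^sup>2) / (4 * s) * (norm (y - mehler_centre s x))\<^sup>2)"
  proof -
    define a b c where "a = x \<bullet> x" and "b = x \<bullet> y" and "c = y \<bullet> y"
    have 1: "(norm (x - y))\<^sup>2 = a - 2 * b + c" "(norm (x + y))\<^sup>2 = a + 2 * b + c" "(norm x)\<^sup>2 = a"
      unfolding a_def b_def c_def
      by (simp_all add: power2_norm_eq_inner inner_diff inner_add inner_commute)
    define q where "q = (1 - s\<^sup>2) / (1 + s\<^sup>2)"
    have 2: "(norm (y - mehler_centre s x))\<^sup>2 = c - 2 * q * b + q\<^sup>2 * a"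
      unfolding a_def b_def c_def mehler_centre_def q_def[symmetric]
      by (simp add: power2_norm_eq_inner inner_diff inner_commute algebra_simps) (simp add: power2_eq_square)
    have q: "(1 + s\<^sup>2) * q = 1 - s\<^sup>2" using p by (simp add: q_def)
    have 3: "(1 + s\<^sup>2) / (4 * s) * (c - 2 * q * b + q\<^sup>2 * a) =
      ((1 + s\<^sup>2) * c - 2 * ((1 + s\<^sup>2) * q) * b + ((1 + s\<^sup>2) * q) * q * a) / (4 * s)"
      by (simp add: algebra_simps power2_eq_square add_divide_distrib diff_divide_distrib)
    have 4: "s / (1 + s\<^sup>2) + (1 - s\<^sup>2) * q / (4 * s) = (1 + s\<^sup>2) / (4 * s)"
      unfolding q_def using p assms by (simp add: divide_simps) (simp add: algebra_simps power2_eq_square)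
    have "s / (1 + s\<^sup>2) * a + ((1 + s\<^sup>2) * c - 2 * (1 - s\<^sup>2) * b + (1 - s\<^sup>2) * q * a) / (4 * s)
      = (s / (1 + s\<^sup>2) + (1 - s\<^sup>2) * q / (4 * s)) * a + ((1 + s\<^sup>2) * c - 2 * (1 - s\<^sup>2) * b) / (4 * s)"
      by (simp add: add_divide_distrib diff_divide_distrib algebra_simps)
    also have "\<dots> = (1 / 4) * ((a - 2 * b + c) / s + s * (a + 2 * b + c))"
      unfolding 4 using assms by (simp add: field_simps power2_eq_square)
    finally show ?thesis unfolding 1 2 3 q by linarith
  qed
  show ?thesis unfolding mehler_kernel_def e exp_add by simp
qed

text \<open>
  Substituting \<open>s = tanh (t\<^sup>2/(4q\<^sup>2))\<close>, that is \<open>\<kappa>(s) = t\<^sup>2/q\<^sup>2\<close>, carries the measure with density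
  \<^term>\<open>subordinator t\<close> on \<open>(0,1)\<close> to the one with density \<open>2/\<surd>\<pi> exp (- q\<^sup>2)\<close> on \<open>(0,\<infinity>)\<close>.
\<close>

lemma subordinator_integral:
  assumes t: "0 < t"
  shows "set_integrable lborel {0<..<1} (subordinator t)" "(LBINT s:{0<..<1}. subordinator t s) = 1"
proof -
  define g where "g q = tanh (t\<^sup>2 / (4 * q\<^sup>2))" for q :: real
  define g' where "g' q = (1 - (g q)\<^sup>2) * (- (t\<^sup>2 / (2 * q ^ 3)))" for q :: real
  have deriv: "(g has_field_derivative g' q) (at q within {0<..})" if "q \<in> {0<..}" for q
    unfolding g_def g'_def using that
    by (auto intro!: derivative_eq_intros simp: power2_eq_square power3_eq_cube field_simps)
  have inj: "inj_on g {0<..}"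
    unfolding g_def using t by (intro inj_onI) (auto simp: power_eq_iff_eq_base)
  have img: "g ` {0<..} = {0<..<1}"
  proof (intro equalityI subsetI)
    fix s assume "s \<in> g ` {0<..}"
    then show "s \<in> {0<..<1}" using t by (auto simp: g_def tanh_real_lt_1)
  next
    fix s :: real assume s: "s \<in> {0<..<1}"
    define q where "q = t / sqrt (kappa s)"
    have k: "0 < kappa s" using s kappa_pos by auto
    have "t\<^sup>2 / (4 * q\<^sup>2) = kappa s / 4" using t k by (simp add: q_def power_divide)
    then have "g q = s" using s unfolding g_def by (metis greaterThanLessThan_iff tanh_kappa)
    moreover have "q > 0" using t k by (simp add: q_def)
    ultimately show "s \<in> g ` {0<..}" by force
  qed
  have eq: "\<bar>g' q\<bar> *\<^sub>R subordinator t (g q) = 2 / sqrt pi * exp (- q\<^sup>2)" if q: "q \<in> {0<..}" for q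
  proof -
    have g: "0 < g q" "g q < 1" using img q by auto
    have p: "0 < 1 - (g q)\<^sup>2" using one_minus_square_pos[OF g] .
    have k: "kappa (g q) = t\<^sup>2 / q\<^sup>2" by (simp add: g_def kappa_tanh)
    have "kappa (g q) powr (3 / 2) = ((t / q) powr 2) powr (3 / 2)"
      using t q by (simp add: k power_divide)
    also have "\<dots> = (t / q) powr 3" by (subst powr_powr) simp
    also have "\<dots> = t ^ 3 / q ^ 3" using t q by (simp add: power_divide)
    finally have k3: "kappa (g q) powr (3 / 2) = t ^ 3 / q ^ 3" .
    have ek: "- t\<^sup>2 / kappa (g q) = - q\<^sup>2" using t by (simp add: k)
    have g'q: "\<bar>g' q\<bar> = (1 - (g q)\<^sup>2) * (t\<^sup>2 / (2 * q ^ 3))"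
      using p q by (simp add: g'_def abs_mult)
    define e u where "e = exp (- q\<^sup>2)" and "u = 1 - (g q)\<^sup>2"
    show ?thesis
      unfolding subordinator_def k3 ek g'q e_def[symmetric] u_def[symmetric]
      using p[folded u_def] t q by (simp add: field_simps power2_eq_square power3_eq_cube)
  qed
  let ?f = "\<lambda>q. 2 / sqrt pi * exp (- q\<^sup>2) :: real"
  have hb: "has_bochner_integral lborel (\<lambda>q. indicator {0..} q *\<^sub>R ?f q) 1"
    using has_bochner_integral_mult_right[OF gaussian_moment_0, of "2 / sqrt pi"]
    by (simp add: mult_ac)
  then have hb': "has_bochner_integral lborel (\<lambda>q. indicator {0<..} q *\<^sub>R ?f q) 1"
    by (rule has_bochner_integral_cong_AE[THEN iffD1, rotated -1])
      (auto intro!: AE_I[of _ _ "{0}"] simp: indicator_def)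
  have abs: "?f absolutely_integrable_on {0<..}"
    using hb' by (auto simp: set_integrable_def has_bochner_integral_iff intro!: integrable_completion[THEN iffD2])
  have int: "integral {0<..} ?f = 1"
  proof -
    have "integral {0<..} ?f = (LINT q:{0<..}|lebesgue. ?f q)"
      by (rule set_lebesgue_integral_eq_integral(2)[OF abs, symmetric])
    also have "\<dots> = (LBINT q:{0<..}. ?f q)"
      unfolding set_lebesgue_integral_def by (subst integral_completion) auto
    also have "\<dots> = 1"
      using hb' unfolding set_lebesgue_integral_def by (rule has_bochner_integral_integral_eq)
    finally show ?thesis .
  qed
  have "(\<lambda>q. \<bar>g' q\<bar> *\<^sub>R subordinator t (g q)) absolutely_integrable_on {0<..} \<and>
        integral {0<..} (\<lambda>q. \<bar>g' q\<bar> *\<^sub>R subordinator t (g q)) = 1"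
  proof
    show "(\<lambda>q. \<bar>g' q\<bar> *\<^sub>R subordinator t (g q)) absolutely_integrable_on {0<..}"
      by (subst set_integrable_cong[OF refl refl eq]) (use abs in simp_all)
    show "integral {0<..} (\<lambda>q. \<bar>g' q\<bar> *\<^sub>R subordinator t (g q)) = 1"
      by (subst Henstock_Kurzweil_Integration.integral_cong[OF eq]) (rule int | assumption)+
  qed
  then have sub: "subordinator t absolutely_integrable_on {0<..<1}" "integral {0<..<1} (subordinator t) = 1"
    using has_absolute_integral_change_of_variables_1'[OF _ deriv inj, of "subordinator t" 1]
    unfolding img by simp_all
  show "set_integrable lborel {0<..<1} (subordinator t)"
    using sub(1) unfolding set_integrable_def by (subst (asm) integrable_completion) auto
  have "(LBINT s:{0<..<1}. subordinator t s) = (LINT s:{0<..<1}|lebesgue. subordinator t s)"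
    unfolding set_lebesgue_integral_def by (subst integral_completion) auto
  then show "(LBINT s:{0<..<1}. subordinator t s) = 1"
    using sub by (simp add: set_lebesgue_integral_eq_integral(2))
qed

lemma nn_integral_gaussian_real:
  assumes "0 < (a::real)"
  shows "(\<integral>\<^sup>+u. ennreal (exp (- (a * (u - c)\<^sup>2))) \<partial>lborel) = ennreal (sqrt (pi / a))"
proof -
  define \<sigma> where "\<sigma> = 1 / sqrt (2 * a)"
  have \<sigma>: "\<sigma> > 0" "\<sigma>\<^sup>2 = 1 / (2 * a)" using assms by (simp_all add: \<sigma>_def power_divide)
  have "exp (- (a * (u - c)\<^sup>2)) = sqrt (pi / a) * normal_density c \<sigma> u" for u
    using assms by (simp add: normal_density_def \<sigma>(2) real_sqrt_divide field_simps)
  then have "(\<integral>\<^sup>+u. ennreal (exp (- (a * (u - c)\<^sup>2))) \<partial>lborel)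
     = ennreal (sqrt (pi / a)) * (\<integral>\<^sup>+u. ennreal (normal_density c \<sigma> u) \<partial>lborel)"
    using assms by (simp add: ennreal_mult' nn_integral_cmult)
  also have "(\<integral>\<^sup>+u. ennreal (normal_density c \<sigma> u) \<partial>lborel) = 1"
    using \<sigma> by (subst nn_integral_eq_integral) (auto simp: integral_normal_density)
  finally show ?thesis by simp
qed

lemma nn_integral_gaussian:
  fixes z :: "'a::euclidean_space"
  assumes a: "0 < a"
  shows "(\<integral>\<^sup>+y. ennreal (exp (- (a * (norm (y - z))\<^sup>2))) \<partial>lborel) = ennreal ((pi / a) powr (real DIM('a) / 2))"
proof -
  have "ennreal (exp (- (a * (norm (y - z))\<^sup>2))) = (\<Prod>b\<in>Basis. ennreal (exp (- (a * (y \<bullet> b - z \<bullet> b)\<^sup>2))))" for y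
  proof -
    have "(norm (y - z))\<^sup>2 = (\<Sum>b\<in>Basis. (y \<bullet> b - z \<bullet> b)\<^sup>2)"
      unfolding power2_norm_eq_inner by (subst euclidean_inner) (simp add: inner_diff_left power2_eq_square)
    then have "exp (- (a * (norm (y - z))\<^sup>2)) = (\<Prod>b\<in>Basis. exp (- (a * (y \<bullet> b - z \<bullet> b)\<^sup>2)))"
      by (simp add: sum_distrib_left sum_negf[symmetric] exp_sum)
    then show ?thesis by (simp add: prod_ennreal)
  qed
  then have "(\<integral>\<^sup>+y. ennreal (exp (- (a * (norm (y - z))\<^sup>2))) \<partial>lborel) =
     (\<Prod>b\<in>(Basis::'a set). \<integral>\<^sup>+u. ennreal (exp (- (a * (u - z \<bullet> b)\<^sup>2))) \<partial>lborel)"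
    by (subst nn_integral_lborel_prod[symmetric]) auto
  also have "\<dots> = ennreal (sqrt (pi / a) ^ DIM('a))"
    using a by (simp add: nn_integral_gaussian_real ennreal_power)
  also have "sqrt (pi / a) ^ DIM('a) = (pi / a) powr (real DIM('a) / 2)"
    using a by (simp add: powr_half_sqrt[symmetric] powr_realpow[symmetric] powr_powr)
  finally show ?thesis .
qed

section \<open>Bounds by the weight\<close>

text \<open>
  With \<open>u = c v / p\<close> this is the \<open>p\<close>-th power of \<open>u \<le> exp u\<close>.
\<close>

lemma powr_le_exp:
  assumes "0 \<le> (p::real)" "0 < c"
  obtains C where "0 < C" "\<And>v. 0 \<le> v \<Longrightarrow> v powr p \<le> C * exp (c * v)"
proof (cases "p = 0")
  case True
  have "v powr p \<le> 1 * exp (c * v)" if "0 \<le> v" for v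
    using that assms True by simp
  with that[of 1] show ?thesis by simp
next
  case False
  then have p: "p > 0" using assms by simp
  have "v powr p \<le> (p / c) powr p * exp (c * v)" if v: "0 \<le> v" for v
  proof -
    have "c * v / p \<le> exp (c * v / p)" using exp_ge_add_one_self[of "c * v / p"] by linarith
    then have "(c * v / p) powr p \<le> exp (c * v / p) powr p"
      using p assms v by (intro powr_mono2) auto
    also have "\<dots> = exp (c * v)" using p by (simp add: powr_def)
    finally have "(p / c) powr p * (c * v / p) powr p \<le> (p / c) powr p * exp (c * v)"
      by (intro mult_left_mono) auto
    also have "(p / c) powr p * (c * v / p) powr p = v powr p"
      using p assms v by (simp flip: powr_mult)
    finally show ?thesis .
  qed
  then show ?thesis using p assms by (intro that[of "(p / c) powr p"]) auto
qed

lemma ln_exp1_plus_bounds: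
  assumes "0 \<le> (r::real)" shows "1 \<le> ln (exp 1 + r)" "ln (exp 1 + r) \<le> 1 + r"
proof -
  have "ln (exp 1) \<le> ln (exp 1 + r)" using assms by (subst ln_le_cancel_iff) (auto intro: add_pos_nonneg)
  then show "1 \<le> ln (exp 1 + r)" by simp
  have "exp 1 + r \<le> exp 1 * (1 + r)"
    using assms exp_ge_add_one_self[of "1::real"] mult_right_mono[of 1 "exp 1" r] by (simp add: algebra_simps)
  also have "\<dots> \<le> exp 1 * exp r" by (intro mult_left_mono) auto
  finally have "ln (exp 1 + r) \<le> ln (exp (1 + r))"
    using assms by (intro ln_mono) (auto simp: exp_add intro: add_pos_nonneg)
  then show "ln (exp 1 + r) \<le> 1 + r" by simp
qed

lemma Phi_pos: "0 < Phi y"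
  using ln_exp1_plus_bounds(1)[of "norm y"] add_pos_nonneg[of 1 "norm y"]
  by (auto simp: Phi_def intro!: divide_pos_pos mult_pos_pos)

lemma Phi_measurable [measurable]: "Phi \<in> borel_measurable borel"
  unfolding Phi_def by measurable

lemma Phi_le_gaussian: "Phi (y :: 'a::euclidean_space) \<le> exp (- (norm y)\<^sup>2 / 2)"
proof -
  have "1 * 1 \<le> (1 + norm y) powr (real DIM('a) / 2) * ln (exp 1 + norm y) powr (3 / 2)"
    using ln_exp1_plus_bounds(1)[of "norm y"] by (intro mult_mono ge_one_powr_ge_zero) auto
  then show ?thesis unfolding Phi_def by (simp add: divide_le_eq)
qed

text \<open>
  Any Gaussian exponent larger than the \<open>1/2\<close> in \<^const>\<open>Phi\<close> would do, since the surplus absorbs the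
  power and the logarithm.
\<close>

lemma gaussian_le_Phi:
  obtains C where "0 < C" "\<And>y::'a::euclidean_space. exp (- (3 / 4 * (norm y)\<^sup>2)) \<le> C * Phi y"
proof -
  let ?d = "real DIM('a) / 2"
  obtain C where C: "0 < C" "\<And>v. 0 \<le> v \<Longrightarrow> v powr (?d + 3 / 2) \<le> C * exp (1 * v)"
    using powr_le_exp[of "?d + 3 / 2" 1] by auto
  have "exp (- (3 / 4 * (norm y)\<^sup>2)) \<le> C * exp 2 * Phi y" for y :: 'a
  proof -
    define r where "r = norm y"
    have r: "0 \<le> r" by (simp add: r_def)
    let ?D = "(1 + r) powr ?d * ln (exp 1 + r) powr (3 / 2)"
    have D: "0 < ?D" using r ln_exp1_plus_bounds(1)[OF r] by (auto intro!: mult_pos_pos)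
    have "?D \<le> (1 + r) powr ?d * (1 + r) powr (3 / 2)"
      using r ln_exp1_plus_bounds[OF r] by (intro mult_left_mono powr_mono2) auto
    also have "\<dots> = (1 + r) powr (?d + 3 / 2)" by (simp add: powr_add)
    also have "\<dots> \<le> C * exp (1 + r)" using C(2)[of "1 + r"] r by simp
    also have "\<dots> \<le> C * exp (2 + r\<^sup>2 / 4)"
      using C(1) zero_le_power2[of "r / 2 - 1"]
      by (intro mult_left_mono) (auto simp: power2_eq_square algebra_simps)
    finally have "exp (- (3 / 4 * r\<^sup>2)) * ?D \<le> exp (- (3 / 4 * r\<^sup>2)) * (C * exp (2 + r\<^sup>2 / 4))"
      by (intro mult_left_mono) auto
    also have "\<dots> = C * exp 2 * exp (- r\<^sup>2 / 2)"
      by (simp add: field_simps flip: exp_add)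
    finally show ?thesis
      unfolding Phi_def r_def[symmetric] using D by (simp add: pos_le_divide_eq)
  qed
  with C(1) that[of "C * exp 2"] show ?thesis by simp
qed

lemma Phi_bounded_below:
  obtains c where "0 < c" "\<And>y::'a::euclidean_space. norm y \<le> R \<Longrightarrow> c \<le> Phi y"
proof -
  obtain C where C: "0 < C" "\<And>y::'a. exp (- (3 / 4 * (norm y)\<^sup>2)) \<le> C * Phi y"
    using gaussian_le_Phi by metis
  have "exp (- (3 / 4 * R\<^sup>2)) / C \<le> Phi y" if "norm y \<le> R" for y :: 'a
  proof -
    have "exp (- (3 / 4 * R\<^sup>2)) \<le> exp (- (3 / 4 * (norm y)\<^sup>2))"
      using that by (auto intro!: power_mono)
    also have "\<dots> \<le> C * Phi y" by (rule C(2))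
    finally show ?thesis using C(1) by (simp add: divide_le_eq mult.commute)
  qed
  then show ?thesis using C(1) by (intro that[of "exp (- (3 / 4 * R\<^sup>2)) / C"]) auto
qed

lemma nn_integral_Phi_lborel: "(\<integral>\<^sup>+y. ennreal (Phi (y::'a::euclidean_space)) \<partial>lborel) < \<infinity>"
proof -
  have "(\<integral>\<^sup>+y. ennreal (Phi (y::'a)) \<partial>lborel) \<le> (\<integral>\<^sup>+y. ennreal (exp (- (1 / 2 * (norm (y - (0::'a)))\<^sup>2))) \<partial>lborel)"
    by (intro nn_integral_mono ennreal_leI) (use Phi_le_gaussian in simp)
  also have "\<dots> < \<infinity>" by (subst nn_integral_gaussian) auto
  finally show ?thesis .
qed

lemma norm_mehler_centre_le:
  assumes "0 < s" "s < 1" shows "norm (mehler_centre s x) \<le> norm x"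
proof -
  have "\<bar>(1 - s\<^sup>2) / (1 + s\<^sup>2)\<bar> \<le> 1"
    using one_minus_square_pos[OF assms] by (simp add: divide_le_eq add_pos_nonneg)
  then show ?thesis
    unfolding mehler_centre_def norm_scaleR by (intro mult_left_le_one_le) auto
qed

lemma norm_mehler_centre_diff_le:
  assumes "0 < s" "s < 1" shows "norm (mehler_centre s x - x) \<le> 2 * s\<^sup>2 * norm x"
proof -
  have p: "1 + s\<^sup>2 > 0" by (simp add: add_pos_nonneg)
  have "(1 - s\<^sup>2) / (1 + s\<^sup>2) - 1 = - (2 * s\<^sup>2 / (1 + s\<^sup>2))"
    using p by (simp add: field_simps)
  then have "mehler_centre s x - x = - (2 * s\<^sup>2 / (1 + s\<^sup>2)) *\<^sub>R x"
    by (metis mehler_centre_def scaleR_left_diff_distrib scaleR_one)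
  then have "norm (mehler_centre s x - x) = 2 * s\<^sup>2 / (1 + s\<^sup>2) * norm x"
    using p by simp
  also have "\<dots> \<le> 2 * s\<^sup>2 * norm x"
  proof (intro mult_right_mono)
    show "2 * s\<^sup>2 / (1 + s\<^sup>2) \<le> 2 * s\<^sup>2"
      using p by (simp add: divide_le_eq mult_le_cancel_left1)
  qed simp
  finally show ?thesis .
qed

text \<open>
  The bound by a Gaussian of width \<open>\<surd>s\<close>, useful for small \<open>s\<close>; it forgets the factor \<open>1 + s\<^sup>2\<close> in the
  exponent and the decay in \<open>x\<close>.
\<close>

lemma mehler_kernel_le:
  fixes x y :: "'a::euclidean_space"
  assumes "0 < s" "s < 1"
  shows "mehler_kernel s x y \<le> s powr (- (real DIM('a) / 2)) * exp (- ((norm (y - mehler_centre s x))\<^sup>2 / (4 * s)))"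
proof -
  have p: "0 < 1 - s\<^sup>2" using one_minus_square_pos[OF assms] .
  have "(1 - s\<^sup>2) / (4 * pi * s) \<le> 1 / (1 * s)"
    using assms pi_gt3 by (intro frac_le) auto
  then have "((1 - s\<^sup>2) / (4 * pi * s)) powr (real DIM('a) / 2) \<le> (1 / s) powr (real DIM('a) / 2)"
    using p assms by (intro powr_mono2) auto
  also have "\<dots> = s powr (- (real DIM('a) / 2))"
    using assms by (simp add: powr_divide powr_minus field_simps)
  finally have 1: "((1 - s\<^sup>2) / (4 * pi * s)) powr (real DIM('a) / 2) \<le> s powr (- (real DIM('a) / 2))" .
  have 2: "exp (- (s / (1 + s\<^sup>2) * (norm x)\<^sup>2)) \<le> 1" using assms by simp
  have "(norm (y - mehler_centre s x))\<^sup>2 / (4 * s) \<le> (1 + s\<^sup>2) / (4 * s) * (norm (y - mehler_centre s x))\<^sup>2"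
    using assms by (simp add: divide_right_mono mult_right_mono distrib_right)
  then have 3: "exp (- ((1 + s\<^sup>2) / (4 * s) * (norm (y - mehler_centre s x))\<^sup>2))
    \<le> exp (- ((norm (y - mehler_centre s x))\<^sup>2 / (4 * s)))" by simp
  show ?thesis
    unfolding mehler_kernel_shift[OF assms(1)]
    using mult_mono[OF mult_mono[OF 1 2] 3] by simp
qed

lemma subordinator_le:
  assumes "0 < t" "0 < s" "s \<le> 1 / 2"
  shows "subordinator t s \<le> 6 * t * s powr (- (3 / 2)) * exp (- t\<^sup>2 / kappa s)"
proof -
  have "s\<^sup>2 \<le> (1 / 2)\<^sup>2" using assms by (intro power_mono) auto
  then have s2: "3 / 4 \<le> 1 - s\<^sup>2" by (simp add: power2_eq_square)
  have "1 * s powr (3 / 2) * (3 / 4) \<le> sqrt pi * kappa s powr (3 / 2) * (1 - s\<^sup>2)"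
    using assms s2 kappa_ge(2)[of s] pi_gt3 by (intro mult_mono powr_mono2) auto
  then have "subordinator t s \<le> 4 * t * exp (- t\<^sup>2 / kappa s) / (1 * s powr (3 / 2) * (3 / 4))"
    unfolding subordinator_def using assms by (intro divide_left_mono) (use s2 kappa_pos[of s] in \<open>auto intro!: mult_pos_pos simp: power_less_one_iff\<close>)
  also have "\<dots> \<le> 6 * t * exp (- t\<^sup>2 / kappa s) / s powr (3 / 2)"
    using assms by (simp add: field_simps)
  finally show ?thesis by (simp add: powr_minus field_simps)
qed

text \<open>
  For small \<open>s\<close> the Gaussian is far narrower than needed: half of its exponent beats the singular
  power of \<open>s\<close>, using the distance \<open>\<delta>\<close> to the centre, and for \<open>s \<le> 1/8\<close> the other half still
  contains \<open>exp (- |y - \<theta> x|\<^sup>2)\<close>, which decays faster than \<^const>\<open>Phi\<close>.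
\<close>

lemma subordinated_mehler_off_centre:
  assumes "0 < \<delta>"
  obtains C where "0 < C"
    "\<And>t s (x::'a::euclidean_space) y. \<lbrakk>0 < t; 0 < s; s \<le> 1 / 8; norm x \<le> X; \<delta> \<le> norm (y - mehler_centre s x)\<rbrakk>
       \<Longrightarrow> subordinator t s * mehler_kernel s x y \<le> C * t * Phi y"
proof -
  let ?p = "real DIM('a) / 2 + 3 / 2"
  obtain C1 where C1: "0 < C1" "\<And>y::'a. exp (- (3 / 4 * (norm y)\<^sup>2)) \<le> C1 * Phi y"
    using gaussian_le_Phi by metis
  obtain C2 where C2: "0 < C2" "\<And>v. 0 \<le> v \<Longrightarrow> v powr ?p \<le> C2 * exp (\<delta>\<^sup>2 / 8 * v)"
    using powr_le_exp[of ?p "\<delta>\<^sup>2 / 8"] assms by auto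
  let ?C = "6 * C2 * exp (3 * X\<^sup>2) * C1"
  have "subordinator t s * mehler_kernel s x y \<le> ?C * t * Phi y"
    if t: "0 < t" and s: "0 < s" "s \<le> 1 / 8" and x: "norm x \<le> X"
      and y: "\<delta> \<le> norm (y - mehler_centre s x)" for t s and x y :: 'a
  proof -
    define z where "z = mehler_centre s x"
    have z: "norm z \<le> X" using norm_mehler_centre_le[of s x] s x by (simp add: z_def)
    have sub: "subordinator t s \<le> 6 * t * s powr (- (3 / 2))"
    proof -
      have "subordinator t s \<le> 6 * t * s powr (- (3 / 2)) * exp (- t\<^sup>2 / kappa s)"
        using subordinator_le[OF t] s by auto
      also have "\<dots> \<le> 6 * t * s powr (- (3 / 2)) * 1"
        using kappa_pos[of s] s t by (intro mult_left_mono) (auto simp: divide_nonneg_pos less_imp_le)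
      finally show ?thesis by simp
    qed
    have sq: "\<delta>\<^sup>2 / (8 * s) + (norm (y - z))\<^sup>2 \<le> (norm (y - z))\<^sup>2 / (4 * s)"
    proof -
      have "\<delta>\<^sup>2 \<le> (norm (y - z))\<^sup>2" using y assms by (intro power_mono) (auto simp: z_def)
      then have "\<delta>\<^sup>2 / (8 * s) \<le> (norm (y - z))\<^sup>2 / (8 * s)" using s by (intro divide_right_mono) auto
      moreover have "(norm (y - z))\<^sup>2 / 1 \<le> (norm (y - z))\<^sup>2 / (8 * s)"
        using s by (intro divide_left_mono) auto
      moreover have "(norm (y - z))\<^sup>2 / (4 * s) = (norm (y - z))\<^sup>2 / (8 * s) + (norm (y - z))\<^sup>2 / (8 * s)"
        by simp
      ultimately show ?thesis by simp
    qed
    \<comment> \<open>The weight decays in \<open>|y|\<close> and not in \<open>|y - z|\<close>; the shift by \<open>z\<close> costs a quarter of the exponent.\<close>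
    have sq2: "3 / 4 * (norm y)\<^sup>2 - 3 * X\<^sup>2 \<le> (norm (y - z))\<^sup>2"
    proof -
      have "norm y \<le> norm (y - z) + X" using norm_triangle_sub[of y z] z by linarith
      then have "(norm y)\<^sup>2 \<le> (norm (y - z) + X)\<^sup>2" by (intro power_mono) auto
      moreover have "0 \<le> (norm (y - z) - 3 * X)\<^sup>2" by simp
      ultimately show ?thesis by (simp add: power2_eq_square algebra_simps)
    qed
    have "mehler_kernel s x y \<le> s powr (- (real DIM('a) / 2)) * exp (- ((norm (y - z))\<^sup>2 / (4 * s)))"
      unfolding z_def using s by (intro mehler_kernel_le) auto
    also have "\<dots> \<le> s powr (- (real DIM('a) / 2)) * exp (- (\<delta>\<^sup>2 / (8 * s)) + 3 * X\<^sup>2 + - (3 / 4 * (norm y)\<^sup>2))"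
      using sq sq2 by (intro mult_left_mono) auto
    also have "\<dots> = s powr (- (real DIM('a) / 2)) * exp (- (\<delta>\<^sup>2 / (8 * s))) * exp (3 * X\<^sup>2) * exp (- (3 / 4 * (norm y)\<^sup>2))"
      unfolding exp_add by simp
    finally have "subordinator t s * mehler_kernel s x y \<le> 6 * t * s powr (- (3 / 2)) *
       (s powr (- (real DIM('a) / 2)) * exp (- (\<delta>\<^sup>2 / (8 * s))) * exp (3 * X\<^sup>2) * exp (- (3 / 4 * (norm y)\<^sup>2)))"
      using sub s t by (intro mult_mono) (auto intro: mehler_kernel_nonneg)
    also have "\<dots> = 6 * t * ((1 / s) powr ?p * exp (- (\<delta>\<^sup>2 / 8 * (1 / s)))) * exp (3 * X\<^sup>2) * exp (- (3 / 4 * (norm y)\<^sup>2))"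
    proof -
      have "(1 / s) powr ?p = s powr (- ?p)" by (subst powr_minus_divide) (use s in \<open>simp add: powr_divide\<close>)
      also have "\<dots> = s powr (- (3 / 2)) * s powr (- (real DIM('a) / 2))"
        by (subst powr_add[symmetric]) (simp add: algebra_simps)
      finally show ?thesis by (simp add: mult_ac)
    qed
    also have "\<dots> \<le> 6 * t * C2 * exp (3 * X\<^sup>2) * (C1 * Phi y)"
    proof -
      have "(1 / s) powr ?p * exp (- (\<delta>\<^sup>2 / 8 * (1 / s))) \<le> C2"
        using C2(2)[of "1 / s"] s by (simp add: exp_minus field_simps)
      then show ?thesis using t C2(1) by (intro mult_mono C1(2)) auto
    qed
    finally show ?thesis by (simp add: mult_ac)
  qed
  then show ?thesis using that[of ?C] C1(1) C2(1) by auto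
qed

text \<open>
  Near \<open>s = 1\<close> the exponent of Mehler's kernel is \<open>|y|\<^sup>2/2\<close>, which is where the Gaussian factor of
  \<^const>\<open>Phi\<close> comes from. With \<open>w = (1 - s)|y|\<close> the excess is at least \<open>1/s\<close> times a quadratic polynomial
  in \<open>w\<close>, and any linear function of \<open>w\<close> lies below it up to a constant; the slope \<open>3\<close> is enough to absorb the loss
  \<open>exp (3/2 w)\<close> of \<open>inverse_kappa_powr_le\<close> and still leave exponential decay in \<open>w\<close>.
\<close>

lemma mehler_exponent_ge:
  fixes x y :: "'a::euclidean_space"
  assumes s: "0 < s0" "s0 \<le> s" "s < 1" and x: "norm x \<le> X"
  shows "(norm y)\<^sup>2 / 2 + 3 * ((1 - s) * norm y) - (X + 3)\<^sup>2 / s0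
    \<le> (1 / 4) * ((norm (x - y))\<^sup>2 / s + s * (norm (x + y))\<^sup>2)"
proof -
  define a b r u where "a = x \<bullet> x" and "b = x \<bullet> y" and "r = norm y" and "u = 1 - s"
  have s0: "0 < s" using s by simp
  have 1: "(norm (x - y))\<^sup>2 = a - 2 * b + r\<^sup>2" "(norm (x + y))\<^sup>2 = a + 2 * b + r\<^sup>2"
    unfolding a_def b_def r_def
    by (simp_all add: power2_norm_eq_inner inner_diff inner_add inner_commute)
  have r: "0 \<le> r" and u: "0 < u" "u < 1" using s by (auto simp: r_def u_def)
  have X: "0 \<le> X" using x norm_ge_zero order_trans by blast
  have "b \<le> norm x * norm y" unfolding b_def by (rule norm_cauchy_schwarz)
  also have "\<dots> \<le> X * r" unfolding r_def using x by (intro mult_right_mono) auto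
  finally have b: "b \<le> X * r" .
  have "0 \<le> 1 - s\<^sup>2" using one_minus_square_pos[OF s0 s(3)] by simp
  then have p1: "(1 - s\<^sup>2) * b \<le> (1 - s\<^sup>2) * (X * r)" by (intro mult_left_mono b)
  have "(1 - s\<^sup>2) * (X * r) \<le> (2 * u) * (X * r)"
  proof (intro mult_right_mono)
    have "1 - s\<^sup>2 = u * (1 + s)" by (simp add: u_def power2_eq_square algebra_simps)
    also have "\<dots> \<le> u * 2" using u s by (intro mult_left_mono) auto
    finally show "1 - s\<^sup>2 \<le> 2 * u" by simp
  qed (use X r in auto)
  then have p2: "(1 - s\<^sup>2) * (X * r) \<le> 2 * (u * r * X)" by (simp add: mult_ac)
  have p3: "0 \<le> (1 + s\<^sup>2) * a" by (simp add: a_def)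
  \<comment> \<open>The square is chosen so that the linear term \<open>- 4 X (u r)\<close> is turned into \<open>+ 12 (u r)\<close>.\<close>
  have "0 \<le> (u * r - 2 * (X + 3))\<^sup>2" by simp
  also have "\<dots> = (u * r)\<^sup>2 - 4 * (u * r * X) - 12 * (u * r) + 4 * (X + 3)\<^sup>2"
    by (simp add: power2_eq_square algebra_simps)
  finally have p4: "0 \<le> (u * r)\<^sup>2 - 4 * (u * r * X) - 12 * (u * r) + 4 * (X + 3)\<^sup>2" .
  have p5: "(1 + s\<^sup>2) * r\<^sup>2 = 2 * s * r\<^sup>2 + (u * r)\<^sup>2"
    by (simp add: u_def power2_eq_square algebra_simps)
  have p6: "(1 + s\<^sup>2) * (a + r\<^sup>2) - 2 * (1 - s\<^sup>2) * b =
      (1 + s\<^sup>2) * a + (1 + s\<^sup>2) * r\<^sup>2 - 2 * ((1 - s\<^sup>2) * b)"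
    by (simp add: algebra_simps)
  have arith: "x2 + 4 * (3 * w - Z) \<le> e" if "P \<le> Q" "Q \<le> 2 * V" "0 \<le> N" "0 \<le> W - 4 * V - 12 * w + 4 * Z"
    "M = x2 + W" "e = N + M - 2 * P" for P Q N M W V Z w e x2 :: real
    unfolding that(5,6) using that(1-4) by (simp add: algebra_simps)
  have main: "2 * s * r\<^sup>2 + 4 * (3 * (u * r) - (X + 3)\<^sup>2) \<le> (1 + s\<^sup>2) * (a + r\<^sup>2) - 2 * (1 - s\<^sup>2) * b"
    by (rule arith[OF p1 p2 p3 p4 p5 p6])
  have "(1 / 4) * ((norm (x - y))\<^sup>2 / s + s * (norm (x + y))\<^sup>2) = ((1 + s\<^sup>2) * (a + r\<^sup>2) - 2 * (1 - s\<^sup>2) * b) / (4 * s)"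
    unfolding 1 using s0 by (simp add: field_simps power2_eq_square)
  also have "\<dots> \<ge> (2 * s * r\<^sup>2 + 4 * (3 * (u * r) - (X + 3)\<^sup>2)) / (4 * s)"
    using s0 by (intro divide_right_mono main) auto
  also have "(2 * s * r\<^sup>2 + 4 * (3 * (u * r) - (X + 3)\<^sup>2)) / (4 * s) = r\<^sup>2 / 2 + 3 * (u * r) / s - (X + 3)\<^sup>2 / s"
    using s0 by (simp add: add_divide_distrib diff_divide_distrib)
  finally have "r\<^sup>2 / 2 + 3 * (u * r) / s - (X + 3)\<^sup>2 / s \<le> (1 / 4) * ((norm (x - y))\<^sup>2 / s + s * (norm (x + y))\<^sup>2)" .
  moreover have "3 * (u * r) / 1 \<le> 3 * (u * r) / s" using u r s s0 by (intro divide_left_mono) auto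
  moreover have "(X + 3)\<^sup>2 / s \<le> (X + 3)\<^sup>2 / s0" using s by (intro divide_left_mono) auto
  ultimately show ?thesis unfolding r_def[symmetric] u_def[symmetric] by simp
qed

text \<open>
  This produces the logarithm of \<^const>\<open>Phi\<close>. Near \<open>s = 1\<close> the function \<open>\<kappa>(s)\<close> is of the size
  \<open>ln (1/(1 - s))\<close>; writing \<open>e + r \<le> (e + w)/(1 - s)\<close> with \<open>w = (1 - s) r\<close> bounds \<open>ln (e + r)\<close> by
  \<open>\<kappa>(s)\<close> up to a factor growing at most like \<open>exp w\<close>.
\<close>

lemma inverse_kappa_powr_le:
  assumes s: "0 < s0" "s0 \<le> s" "s < 1" and r: "0 \<le> r"
  shows "1 / kappa s powr (3 / 2) \<le>
    (1 + 1 / ln (1 / (1 - s0))) powr (3 / 2) * exp (3 / 2 * ((1 - s) * r)) / ln (exp 1 + r) powr (3 / 2)"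
proof -
  define u A where "u = 1 - s" and "A = 1 + 1 / ln (1 / (1 - s0))"
  have u: "0 < u" "u < 1" using s by (auto simp: u_def)
  have c0: "0 < ln (1 / (1 - s0))" using s by (intro ln_gt_zero) auto
  then have A: "1 \<le> A" by (simp add: A_def)
  have L: "1 \<le> ln (exp 1 + r)" using ln_exp1_plus_bounds[OF r] by auto
  have k: "0 < kappa s" using kappa_pos s by auto
  have lu: "ln (1 / (1 - s0)) \<le> ln (1 / u)"
    using s u by (intro ln_mono divide_left_mono) (auto simp: u_def)
  have ur: "0 \<le> u * r" using u r by simp
  have "exp 1 + r \<le> (exp 1 + u * r) / u"
    using u r by (simp add: field_simps mult_left_le)
  then have "ln (exp 1 + r) \<le> ln ((exp 1 + u * r) / u)"
    using r by (intro ln_mono) (auto intro: add_pos_nonneg)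
  also have "\<dots> = ln (exp 1 + u * r) + ln (1 / u)"
    using u ur by (subst ln_divide_pos) (auto simp: ln_div intro: add_pos_nonneg)
  also have "\<dots> \<le> (1 + u * r) + ln (1 / u)"
    using ln_exp1_plus_bounds(2)[OF ur] by simp
  also have "\<dots> \<le> (1 + u * r) * (ln (1 / u) / ln (1 / (1 - s0))) + (1 + u * r) * ln (1 / u)"
  proof (intro add_mono)
    show "1 + u * r \<le> (1 + u * r) * (ln (1 / u) / ln (1 / (1 - s0)))"
      using ur lu c0 by (subst mult_le_cancel_left1) auto
    show "ln (1 / u) \<le> (1 + u * r) * ln (1 / u)"
      using ur lu c0 by (subst mult_le_cancel_right1) auto
  qed
  also have "\<dots> = A * (1 + u * r) * ln (1 / u)"
    by (simp add: A_def algebra_simps)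
  also have "\<dots> \<le> A * exp (u * r) * kappa s"
  proof (intro mult_mono)
    show "ln (1 / u) \<le> kappa s" using kappa_ge(1)[of s] s lu c0 unfolding u_def by linarith
  qed (use A ur lu c0 exp_ge_add_one_self[of "u * r"] in auto)
  finally have "ln (exp 1 + r) \<le> A * exp (u * r) * kappa s" .
  then have "ln (exp 1 + r) powr (3 / 2) \<le> (A * exp (u * r) * kappa s) powr (3 / 2)"
    using L by (intro powr_mono2) auto
  also have "\<dots> = A powr (3 / 2) * exp (3 / 2 * (u * r)) * kappa s powr (3 / 2)"
    using A k by (simp add: powr_mult exp_powr_real mult.commute)
  finally show ?thesis
    unfolding u_def[symmetric] A_def[symmetric] using k L by (simp add: field_simps)
qed

text \<open>
  The two preceding estimates combined. The power of \<open>1 - s\<close> is that of the amplitude of Mehler's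
  kernel, lowered by one through the denominator \<open>1 - s\<^sup>2\<close> of the density.
\<close>

lemma subordinated_mehler_near_one:
  assumes s0: "0 < s0" "s0 < 1"
  obtains C where "0 < C"
    "\<And>t s (x::'a::euclidean_space) y. \<lbrakk>0 < t; s0 \<le> s; s < 1; norm x \<le> X\<rbrakk>
       \<Longrightarrow> subordinator t s * mehler_kernel s x y \<le>
         C * t * (exp (- (norm y)\<^sup>2 / 2) / ln (exp 1 + norm y) powr (3 / 2)) *
         ((1 - s) powr (real DIM('a) / 2 - 1) * exp (- ((1 - s) * (1 + norm y))))"
proof -
  let ?d = "real DIM('a) / 2"
  define A K where "A = (1 + 1 / ln (1 / (1 - s0))) powr (3 / 2)" and "K = (X + 3)\<^sup>2 / s0"
  have "0 < ln (1 / (1 - s0))" using s0 by (intro ln_gt_zero) auto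
  then have "0 < 1 + 1 / ln (1 / (1 - s0))" by (intro add_pos_pos) auto
  then have A: "0 < A" by (simp add: A_def)
  let ?C = "4 * (2 / s0) powr ?d * A * exp K * exp 1"
  have "subordinator t s * mehler_kernel s x y \<le>
         ?C * t * (exp (- (norm y)\<^sup>2 / 2) / ln (exp 1 + norm y) powr (3 / 2)) *
         ((1 - s) powr (?d - 1) * exp (- ((1 - s) * (1 + norm y))))"
    if t: "0 < t" and s: "s0 \<le> s" "s < 1" and x: "norm x \<le> X" for t s and x y :: 'a
  proof -
    define r u L where "r = norm y" and "u = 1 - s" and "L = ln (exp 1 + r) powr (3 / 2)"
    have r: "0 \<le> r" and u: "0 < u" "u < 1" using s s0 by (auto simp: r_def u_def)
    have sp: "0 < s" using s s0 by simp
    have p: "0 < 1 - s\<^sup>2" using one_minus_square_pos sp s by simp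
    have k: "0 < kappa s" using kappa_pos sp s by auto
    have su: "u \<le> 1 - s\<^sup>2" "1 - s\<^sup>2 \<le> 2 * u"
    proof -
      have eq: "1 - s\<^sup>2 = u * (1 + s)" by (simp add: u_def power2_eq_square algebra_simps)
      show "u \<le> 1 - s\<^sup>2" unfolding eq using u sp by (simp add: mult_le_cancel_left1)
      have "u * (1 + s) \<le> u * 2" using u s by (intro mult_left_mono) auto
      then show "1 - s\<^sup>2 \<le> 2 * u" unfolding eq by simp
    qed
    have L: "1 \<le> ln (exp 1 + r)" "0 < L" using ln_exp1_plus_bounds[OF r] by (auto simp: L_def)
    have sub: "subordinator t s \<le> 4 * t * (1 / kappa s powr (3 / 2)) / u"
    proof -
      have "subordinator t s \<le> 4 * t * 1 / (1 * kappa s powr (3 / 2) * u)"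
        unfolding subordinator_def using t k p u su pi_gt3
        by (intro frac_le mult_mono) (auto simp: divide_nonneg_pos)
      then show ?thesis by simp
    qed
    have k32: "1 / kappa s powr (3 / 2) \<le> A * exp (3 / 2 * (u * r)) / L"
      unfolding A_def u_def L_def using inverse_kappa_powr_le[OF s0(1) s r] .
    have m1: "((1 - s\<^sup>2) / (4 * pi * s)) powr ?d \<le> (2 / s0) powr ?d * u powr ?d"
    proof -
      have "(1 - s\<^sup>2) / (4 * pi * s) \<le> (2 * u) / (1 * s0)"
        using p u su s s0 pi_gt3 by (intro frac_le mult_mono) auto
      then have "((1 - s\<^sup>2) / (4 * pi * s)) powr ?d \<le> (2 / s0 * u) powr ?d"
        using p sp by (intro powr_mono2) auto
      then show ?thesis using u s0 by (subst (asm) powr_mult) auto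
    qed
    have m2: "exp (- (1 / 4) * ((norm (x - y))\<^sup>2 / s + s * (norm (x + y))\<^sup>2)) \<le> exp (- r\<^sup>2 / 2 - 3 * (u * r) + K)"
    proof -
      define Q where "Q = (norm (x - y))\<^sup>2 / s + s * (norm (x + y))\<^sup>2"
      have "r\<^sup>2 / 2 + 3 * (u * r) - K \<le> (1 / 4) * Q"
        using mehler_exponent_ge[OF s0(1) s x, of y] by (simp only: r_def u_def K_def Q_def)
      then show ?thesis unfolding Q_def[symmetric] by simp
    qed
    have "subordinator t s * mehler_kernel s x y \<le>
      (4 * t * (A * exp (3 / 2 * (u * r)) / L) / u) * ((2 / s0) powr ?d * u powr ?d * exp (- r\<^sup>2 / 2 - 3 * (u * r) + K))"
      unfolding mehler_kernel_def
    proof (intro mult_mono m1 m2)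
      show "subordinator t s \<le> 4 * t * (A * exp (3 / 2 * (u * r)) / L) / u"
        using sub k32 t u by (elim order_trans) (intro divide_right_mono mult_left_mono, auto)
    qed (use A t u L in auto)
    also have "\<dots> = 4 * (2 / s0) powr ?d * A * exp K * t * (exp (- r\<^sup>2 / 2) / L) * (u powr ?d / u * exp (- (3 / 2 * (u * r))))"
    proof -
      have "exp (- r\<^sup>2 / 2 - 3 * (u * r) + K) = exp (- r\<^sup>2 / 2) * exp K * (exp (- (3 / 2 * (u * r))) * exp (- (3 / 2 * (u * r))))"
        by (simp flip: exp_add)
      moreover have "exp (3 / 2 * (u * r)) * exp (- (3 / 2 * (u * r))) = 1"
        by (simp flip: exp_add)
      moreover have "(4 * t * (A * e1 / L) / u) * (c * U * (g * k * (e2 * e2))) =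
          4 * c * A * k * t * (g / L) * (U / u * e2)" if "e1 * e2 = 1" for e1 e2 c U g k :: real
      proof -
        have "(4 * t * (A * e1 / L) / u) * (c * U * (g * k * (e2 * e2))) =
          4 * c * A * k * t * (g / L) * (U / u * e2) * (e1 * e2)" by (simp add: mult_ac)
        then show ?thesis using that by simp
      qed
      ultimately show ?thesis by simp
    qed
    also have "u powr ?d / u = u powr (?d - 1)" using u by (simp add: powr_diff)
    also have "4 * (2 / s0) powr ?d * A * exp K * t * (exp (- r\<^sup>2 / 2) / L) * (u powr (?d - 1) * exp (- (3 / 2 * (u * r))))
       \<le> 4 * (2 / s0) powr ?d * A * exp K * t * (exp (- r\<^sup>2 / 2) / L) * (u powr (?d - 1) * exp (1 - u * (1 + r)))"
    proof (intro mult_left_mono)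
      \<comment> \<open>Replaces \<open>r\<close> by \<open>1 + r\<close>, which is harmless as \<open>u \<le> 1\<close>.\<close>
      have "0 \<le> u * r" using u r by simp
      then have "u * (1 + r) \<le> 1 + 3 / 2 * (u * r)" using u by (simp add: distrib_left)
      then show "exp (- (3 / 2 * (u * r))) \<le> exp (1 - u * (1 + r))" by simp
    qed (use A t L in auto)
    also have "exp (1 - u * (1 + r)) = exp 1 * exp (- (u * (1 + r)))" by (simp flip: exp_add)
    finally show ?thesis
      unfolding r_def[symmetric] u_def[symmetric] L_def[symmetric] by (simp add: mult_ac)
  qed
  with that[of ?C] A s0 show ?thesis by auto
qed

text \<open>
  The substitution \<open>s = 1 - v/Y\<close> turns this into Euler's integral; with \<open>Y = 1 + |y|\<close> and
  \<open>d\<close> half the dimension it gives the power of \<open>1 + |y|\<close> in \<^const>\<open>Phi\<close>.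
\<close>

lemma nn_integral_powr_exp_near_one:
  assumes d: "0 < d" and Y: "0 < Y"
  shows "(\<integral>\<^sup>+s. ennreal ((1 - s) powr (d - 1) * exp (- ((1 - s) * Y))) * indicator {s0..<1} s \<partial>lborel)
    \<le> ennreal (Gamma d * Y powr (- d))"
proof -
  let ?f = "\<lambda>s. ennreal ((1 - s) powr (d - 1) * exp (- ((1 - s) * Y))) * indicator {s0..<1} s"
  have "(\<integral>\<^sup>+v. ?f (1 + - (1 / Y) * v) \<partial>lborel) \<le>
     (\<integral>\<^sup>+v. ennreal (Y powr (1 - d)) * ennreal (indicator {0..} v * v powr (d - 1) / exp v) \<partial>lborel)"
  proof (intro nn_integral_mono)
    fix v :: real
    show "?f (1 + - (1 / Y) * v) \<le> ennreal (Y powr (1 - d)) * ennreal (indicator {0..} v * v powr (d - 1) / exp v)"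
    proof (cases "0 < v")
      case True
      have "(v / Y) powr (d - 1) = Y powr (1 - d) * v powr (d - 1)"
        using True Y by (simp add: powr_divide powr_diff field_simps)
      then show ?thesis
        using True Y by (auto simp: ennreal_mult'[symmetric] exp_minus divide_inverse mult_ac split: split_indicator)
    next
      case False
      then have "\<not> (1 + - (1 / Y) * v < 1)" using Y by (simp add: zero_less_divide_iff)
      then show ?thesis by simp
    qed
  qed
  also have "\<dots> = ennreal (Y powr (1 - d)) * ennreal (Gamma d)"
    by (subst Gamma_conv_nn_integral_real[OF d], rule nn_integral_cmult) measurable
  finally have le: "(\<integral>\<^sup>+v. ?f (1 + - (1 / Y) * v) \<partial>lborel) \<le> ennreal (Y powr (1 - d)) * ennreal (Gamma d)" .
  have "(\<integral>\<^sup>+s. ?f s \<partial>lborel) = ennreal \<bar>- (1 / Y)\<bar> * (\<integral>\<^sup>+v. ?f (1 + - (1 / Y) * v) \<partial>lborel)"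
    using Y by (intro nn_integral_real_affine) auto
  also have "\<dots> \<le> ennreal \<bar>- (1 / Y)\<bar> * (ennreal (Y powr (1 - d)) * ennreal (Gamma d))"
    by (intro mult_left_mono le) simp
  also have "\<dots> = ennreal (Gamma d * Y powr (- d))"
  proof -
    have "\<bar>- (1 / Y)\<bar> * (Y powr (1 - d) * Gamma d) = Gamma d * Y powr (- d)"
      using Y by (simp add: powr_diff powr_minus divide_inverse)
    then show ?thesis
      by (simp only: ennreal_mult'[symmetric] abs_ge_zero powr_ge_zero)
  qed
  finally show ?thesis .
qed

lemma nn_integral_subordinated_mehler_near_one:
  assumes s0: "0 < s0" "s0 < 1"
  obtains C where "0 < C"
    "\<And>t (x::'a::euclidean_space) y. \<lbrakk>0 < t; norm x \<le> X\<rbrakk>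
       \<Longrightarrow> (\<integral>\<^sup>+s. ennreal (subordinator t s * mehler_kernel s x y) * indicator {s0..<1} s \<partial>lborel) \<le> ennreal (C * t * Phi y)"
proof -
  let ?d = "real DIM('a) / 2"
  obtain C where C: "0 < C" "\<And>t s (x::'a) y. \<lbrakk>0 < t; s0 \<le> s; s < 1; norm x \<le> X\<rbrakk>
       \<Longrightarrow> subordinator t s * mehler_kernel s x y \<le>
         C * t * (exp (- (norm y)\<^sup>2 / 2) / ln (exp 1 + norm y) powr (3 / 2)) *
         ((1 - s) powr (real DIM('a) / 2 - 1) * exp (- ((1 - s) * (1 + norm y))))"
    using subordinated_mehler_near_one[OF s0, where X = X and 'a = 'a] by blast
  have "(\<integral>\<^sup>+s. ennreal (subordinator t s * mehler_kernel s x y) * indicator {s0..<1} s \<partial>lborel)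
    \<le> ennreal (C * Gamma ?d * t * Phi y)" if t: "0 < t" and x: "norm x \<le> X" for t and x y :: 'a
  proof -
    let ?D = "C * t * (exp (- (norm y)\<^sup>2 / 2) / ln (exp 1 + norm y) powr (3 / 2))"
    have D: "0 \<le> ?D" using C t by simp
    have Y: "0 < 1 + norm y" by (simp add: add_pos_nonneg)
    have "(\<integral>\<^sup>+s. ennreal (subordinator t s * mehler_kernel s x y) * indicator {s0..<1} s \<partial>lborel)
      \<le> (\<integral>\<^sup>+s. ennreal ?D * (ennreal ((1 - s) powr (?d - 1) * exp (- ((1 - s) * (1 + norm y)))) * indicator {s0..<1} s) \<partial>lborel)"
    proof (intro nn_integral_mono)
      fix s
      show "ennreal (subordinator t s * mehler_kernel s x y) * indicator {s0..<1} s
        \<le> ennreal ?D * (ennreal ((1 - s) powr (?d - 1) * exp (- ((1 - s) * (1 + norm y)))) * indicator {s0..<1} s)"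
        using C(2)[OF t _ _ x, of s y] D
        by (auto simp: ennreal_mult'[symmetric] intro!: ennreal_leI split: split_indicator)
    qed
    also have "\<dots> = ennreal ?D * (\<integral>\<^sup>+s. ennreal ((1 - s) powr (?d - 1) * exp (- ((1 - s) * (1 + norm y)))) * indicator {s0..<1} s \<partial>lborel)"
      by (rule nn_integral_cmult) auto
    also have "\<dots> \<le> ennreal ?D * ennreal (Gamma ?d * (1 + norm y) powr (- ?d))"
      using Y by (intro mult_left_mono nn_integral_powr_exp_near_one) auto
    also have "\<dots> = ennreal (C * Gamma ?d * t * Phi y)"
      using D Y by (simp add: ennreal_mult'[symmetric] Phi_def powr_minus field_simps)
    finally show ?thesis .
  qed
  with that[of "C * Gamma ?d"] C(1) show ?thesis by (auto simp: Gamma_real_pos)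
qed

section \<open>Measures that integrate the weight\<close>

definition subordinated_mehler :: "real \<Rightarrow> 'a::euclidean_space \<Rightarrow> real \<times> 'a \<Rightarrow> real" where
  "subordinated_mehler t x = (\<lambda>(s, y). indicator {0<..<1} s * (subordinator t s * mehler_kernel s x y))"

text \<open>
  The region of \<open>(s, y)\<close> in which cancellation is needed. It is cut out by a ball about the moving centre
  and not about \<open>x\<close> or \<open>x\<^sub>0\<close>, so that each slice of the kernel remains a radial function restricted to
  a ball.
\<close>

definition near_centre :: "real \<Rightarrow> real \<Rightarrow> 'a::euclidean_space \<Rightarrow> (real \<times> 'a) set" where
  "near_centre s0 \<delta> x = {(s, y). 0 < s \<and> s < s0 \<and> norm (y - mehler_centre s x) < \<delta>}"

lemma subordinated_mehler_measurable [measurable]: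
  "subordinated_mehler t (x::'a::euclidean_space) \<in> borel_measurable (borel \<Otimes>\<^sub>M borel)"
  unfolding subordinated_mehler_def mehler_kernel_def by measurable

lemma near_centre_measurable [measurable]:
  "near_centre s0 \<delta> (x::'a::euclidean_space) \<in> sets (borel \<Otimes>\<^sub>M borel)"
proof -
  have "Measurable.pred (borel \<Otimes>\<^sub>M borel) (\<lambda>(s, y). 0 < s \<and> s < s0 \<and> norm (y - mehler_centre s x) < \<delta>)"
    unfolding mehler_centre_def by measurable
  then show ?thesis
    unfolding near_centre_def pred_def by (simp add: space_pair_measure)
qed

lemma subordinated_mehler_nonneg: "0 \<le> t \<Longrightarrow> 0 \<le> subordinated_mehler t x p"
  by (auto simp: subordinated_mehler_def split: prod.split split_indicator
      intro!: mult_nonneg_nonneg subordinator_nonneg mehler_kernel_nonneg)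

text \<open>
  For fixed \<open>t\<close> the factor \<open>exp (- t\<^sup>2/\<kappa>(s))\<close> kills the singularity at \<open>s = 0\<close>. The bound depends on
  \<open>t\<close> and serves only to show integrability.
\<close>

lemma subordinated_mehler_bounded_near_centre:
  assumes t: "0 < t" and s0: "s0 \<le> 1 / 8"
  obtains C where "0 < C" "\<And>p. p \<in> near_centre s0 \<delta> (x::'a::euclidean_space) \<Longrightarrow> subordinated_mehler t x p \<le> C"
proof -
  let ?p = "real DIM('a) / 2 + 3 / 2"
  obtain C where C: "0 < C" "\<And>v. 0 \<le> v \<Longrightarrow> v powr ?p \<le> C * exp (t\<^sup>2 / 8 * v)"
    using powr_le_exp[of ?p "t\<^sup>2 / 8"] t by auto
  have "subordinated_mehler t x (s, y) \<le> 6 * t * C" if s: "0 < s" "s < s0" for s and y :: 'a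
  proof -
    have k: "0 < kappa s" "kappa s \<le> 8 * s" using kappa_pos[of s] kappa_le[of s] s s0 by auto
    have e: "exp (- t\<^sup>2 / kappa s) \<le> exp (- (t\<^sup>2 / 8 * (1 / s)))"
      using k s t by (simp add: divide_left_mono)
    have "subordinator t s \<le> 6 * t * s powr (- (3 / 2)) * exp (- t\<^sup>2 / kappa s)"
      using subordinator_le[OF t] s s0 by auto
    also have "\<dots> \<le> 6 * t * s powr (- (3 / 2)) * exp (- (t\<^sup>2 / 8 * (1 / s)))"
      using t by (intro mult_left_mono e) auto
    finally have sub: "subordinator t s \<le> 6 * t * s powr (- (3 / 2)) * exp (- (t\<^sup>2 / 8 * (1 / s)))" .
    have "mehler_kernel s x y \<le> s powr (- (real DIM('a) / 2)) * exp (- ((norm (y - mehler_centre s x))\<^sup>2 / (4 * s)))"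
      using s s0 by (intro mehler_kernel_le) auto
    also have "\<dots> \<le> s powr (- (real DIM('a) / 2)) * 1"
      using s by (intro mult_left_mono) auto
    finally have meh: "mehler_kernel s x y \<le> s powr (- (real DIM('a) / 2))" by simp
    have "subordinated_mehler t x (s, y) = subordinator t s * mehler_kernel s x y"
      using s s0 by (simp add: subordinated_mehler_def)
    also have "\<dots> \<le> (6 * t * s powr (- (3 / 2)) * exp (- (t\<^sup>2 / 8 * (1 / s)))) * s powr (- (real DIM('a) / 2))"
      using t by (intro mult_mono sub meh mehler_kernel_nonneg) auto
    also have "\<dots> = 6 * t * ((1 / s) powr ?p * exp (- (t\<^sup>2 / 8 * (1 / s))))"
    proof -
      have "(1 / s) powr ?p = s powr (- ?p)" by (subst powr_minus_divide) (use s in \<open>simp add: powr_divide\<close>)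
      also have "\<dots> = s powr (- (3 / 2)) * s powr (- (real DIM('a) / 2))"
        by (subst powr_add[symmetric]) (simp add: algebra_simps)
      finally show ?thesis by (simp add: mult_ac)
    qed
    also have "\<dots> \<le> 6 * t * C"
    proof (intro mult_left_mono)
      show "(1 / s) powr ?p * exp (- (t\<^sup>2 / 8 * (1 / s))) \<le> C"
        using C(2)[of "1 / s"] s by (simp add: exp_minus field_simps)
    qed (use t in auto)
    finally show ?thesis .
  qed
  then show ?thesis using that[of "6 * t * C"] t C(1) by (auto simp: near_centre_def)
qed

locale phi_measure =
  fixes M :: "'a::euclidean_space measure"
  assumes sets_M [simp, measurable_cong]: "sets M = sets borel"
    and finite_Phi: "(\<integral>\<^sup>+y. ennreal (Phi y) \<partial>M) < \<infinity>"
begin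

lemma space_M [simp]: "space M = UNIV"
  using sets_eq_imp_space_eq[OF sets_M] by simp

text \<open>
  Local finiteness follows from the integrability of \<^const>\<open>Phi\<close>, which is bounded below by a positive
  constant on bounded sets.
\<close>

lemma emeasure_bounded_finite:
  assumes A: "A \<in> sets borel" "bounded A"
  shows "emeasure M A < \<infinity>"
proof -
  obtain R where R: "\<And>y. y \<in> A \<Longrightarrow> norm y \<le> R" using A(2) unfolding bounded_iff by blast
  obtain c where c: "0 < c" "\<And>y::'a. norm y \<le> R \<Longrightarrow> c \<le> Phi y" using Phi_bounded_below[of R] by metis
  have "ennreal c * emeasure M A = (\<integral>\<^sup>+y. ennreal c * indicator A y \<partial>M)"
    using A by (simp add: nn_integral_cmult_indicator)
  also have "\<dots> \<le> (\<integral>\<^sup>+y. ennreal (Phi y) \<partial>M)"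
    using R c by (intro nn_integral_mono) (auto split: split_indicator intro!: ennreal_leI)
  finally have "ennreal c * emeasure M A < \<infinity>" using finite_Phi by simp
  then show ?thesis using c(1) by (auto simp: ennreal_mult_less_top)
qed

lemma sigma_finite: "sigma_finite_measure M"
proof
  let ?A = "range (\<lambda>n::nat. ball (0::'a) (real n))"
  have "\<Union> ?A = UNIV"
    using reals_Archimedean2 by (auto simp: set_eq_iff)
  moreover have "\<forall>a\<in>?A. emeasure M a \<noteq> \<infinity>"
    using emeasure_bounded_finite by (auto simp: less_top[symmetric])
  ultimately show "\<exists>A. countable A \<and> A \<subseteq> sets M \<and> \<Union> A = space M \<and> (\<forall>a\<in>A. emeasure M a \<noteq> \<infinity>)"
    by (intro exI[of _ ?A]) auto
qed

sublocale sigma_finite_measure M by (rule sigma_finite)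

sublocale P: pair_sigma_finite lborel M ..

lemma pair_sets [measurable_cong]: "sets (lborel \<Otimes>\<^sub>M M) = sets (borel \<Otimes>\<^sub>M borel)"
  by (intro sets_pair_measure_cong) auto

text \<open>
  For \<open>s \<in> (0,1)\<close> off the set \<^const>\<open>near_centre\<close> either \<open>s \<ge> s\<^sub>0\<close>, or \<open>s < s\<^sub>0\<close> and \<open>y\<close> is at distance at least \<open>\<delta>\<close> from
  the centre. In both cases integration in \<open>s\<close> leaves at most a multiple of \<open>t \<Phi>(y)\<close>.
\<close>

lemma nn_integral_far_from_centre:
  assumes s0: "0 < s0" "s0 \<le> 1 / 8" and \<delta>: "0 < \<delta>"
  obtains C where "0 \<le> C" "\<And>t x. \<lbrakk>0 < t; norm x \<le> X\<rbrakk> \<Longrightarrow>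
    (\<integral>\<^sup>+p. ennreal (subordinated_mehler t x p) * indicator (- near_centre s0 \<delta> x) p \<partial>(lborel \<Otimes>\<^sub>M M)) \<le> ennreal (C * t)"
proof -
  obtain C1 where C1: "0 < C1"
    "\<And>t s (x::'a) y. \<lbrakk>0 < t; 0 < s; s \<le> 1 / 8; norm x \<le> X; \<delta> \<le> norm (y - mehler_centre s x)\<rbrakk>
       \<Longrightarrow> subordinator t s * mehler_kernel s x y \<le> C1 * t * Phi y"
    using subordinated_mehler_off_centre[OF \<delta>, where X = X and 'a = 'a] by blast
  have s1: "s0 < 1" using s0 by simp
  obtain C2 where C2: "0 < C2"
    "\<And>t (x::'a) y. \<lbrakk>0 < t; norm x \<le> X\<rbrakk>
       \<Longrightarrow> (\<integral>\<^sup>+s. ennreal (subordinator t s * mehler_kernel s x y) * indicator {s0..<1} s \<partial>lborel) \<le> ennreal (C2 * t * Phi y)"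
    using nn_integral_subordinated_mehler_near_one[OF s0(1) s1, where X = X and 'a = 'a] by blast
  obtain I where I: "0 \<le> I" "(\<integral>\<^sup>+y. ennreal (Phi y) \<partial>M) = ennreal I"
    using finite_Phi by (cases "\<integral>\<^sup>+y. ennreal (Phi y) \<partial>M") auto
  have "(\<integral>\<^sup>+p. ennreal (subordinated_mehler t x p) * indicator (- near_centre s0 \<delta> x) p \<partial>(lborel \<Otimes>\<^sub>M M)) \<le> ennreal ((C1 + C2) * I * t)"
    if t: "0 < t" and x: "norm x \<le> X" for t and x :: 'a
  proof -
    let ?F = "\<lambda>p. ennreal (subordinated_mehler t x p) * indicator (- near_centre s0 \<delta> x) p"
    have "(\<integral>\<^sup>+s. ?F (s, y) \<partial>lborel) \<le> ennreal ((C1 + C2) * t) * ennreal (Phi y)" for y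
    proof -
      have le: "?F (s, y) \<le> ennreal (C1 * t * Phi y) * indicator {0<..<s0} s
          + ennreal (subordinator t s * mehler_kernel s x y) * indicator {s0..<1} s" for s
        using C1(2)[OF t _ _ x, of s y] s0
        by (auto simp: subordinated_mehler_def near_centre_def not_less split: split_indicator intro!: ennreal_leI)
      have m: "(\<lambda>s. ennreal (subordinator t s * mehler_kernel s x y) * indicator {s0..<1} s) \<in> borel_measurable lborel"
        unfolding mehler_kernel_def by measurable
      have "(\<integral>\<^sup>+s. ?F (s, y) \<partial>lborel) \<le> (\<integral>\<^sup>+s. ennreal (C1 * t * Phi y) * indicator {0<..<s0} s
          + ennreal (subordinator t s * mehler_kernel s x y) * indicator {s0..<1} s \<partial>lborel)"
        by (intro nn_integral_mono le)
      also have "\<dots> = (\<integral>\<^sup>+s. ennreal (C1 * t * Phi y) * indicator {0<..<s0} s \<partial>lborel) +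
          (\<integral>\<^sup>+s. ennreal (subordinator t s * mehler_kernel s x y) * indicator {s0..<1} s \<partial>lborel)"
        by (rule nn_integral_add[OF _ m]) auto
      also have "\<dots> \<le> ennreal (C1 * t * Phi y) + ennreal (C2 * t * Phi y)"
      proof (intro add_mono C2(2) t x)
        have "(\<integral>\<^sup>+s. ennreal (C1 * t * Phi y) * indicator {0<..<s0} s \<partial>lborel) = ennreal (C1 * t * Phi y) * ennreal s0"
          using s0 by (simp add: nn_integral_cmult_indicator)
        also have "\<dots> \<le> ennreal (C1 * t * Phi y) * 1"
          using s0 by (intro mult_left_mono) (auto simp: ennreal_le_1)
        finally show "(\<integral>\<^sup>+s. ennreal (C1 * t * Phi y) * indicator {0<..<s0} s \<partial>lborel) \<le> ennreal (C1 * t * Phi y)" by simp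
      qed
      also have "\<dots> = ennreal ((C1 + C2) * t) * ennreal (Phi y)"
        using C1(1) C2(1) t Phi_pos[of y]
        by (simp add: ennreal_mult'[symmetric] algebra_simps flip: ennreal_plus)
      finally show ?thesis .
    qed
    note le = this
    have "(\<integral>\<^sup>+p. ?F p \<partial>(lborel \<Otimes>\<^sub>M M)) = (\<integral>\<^sup>+y. \<integral>\<^sup>+s. ?F (s, y) \<partial>lborel \<partial>M)"
      by (rule P.nn_integral_snd[symmetric]) measurable
    also have "\<dots> \<le> (\<integral>\<^sup>+y. ennreal ((C1 + C2) * t) * ennreal (Phi y) \<partial>M)"
      by (intro nn_integral_mono le)
    also have "\<dots> = ennreal ((C1 + C2) * t) * ennreal I"
      using I by (subst nn_integral_cmult) auto
    also have "\<dots> = ennreal ((C1 + C2) * I * t)"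
      using C1(1) C2(1) t I by (simp add: ennreal_mult'[symmetric] mult_ac)
    finally show ?thesis .
  qed
  then show ?thesis using that[of "(C1 + C2) * I"] C1(1) C2(1) I by auto
qed

lemma integrable_subordinated_mehler:
  assumes t: "0 < t"
  shows "integrable (lborel \<Otimes>\<^sub>M M) (subordinated_mehler t x)"
proof (rule integrableI_nonneg)
  let ?N = "near_centre (1 / 8) 1 x"
  obtain C where "0 \<le> C" and C': "\<And>u z. \<lbrakk>0 < u; norm z \<le> norm x\<rbrakk> \<Longrightarrow>
    (\<integral>\<^sup>+p. ennreal (subordinated_mehler u z p) * indicator (- near_centre (1 / 8) 1 z) p \<partial>(lborel \<Otimes>\<^sub>M M)) \<le> ennreal (C * u)"
    by (rule nn_integral_far_from_centre[of "1 / 8" 1 "norm x"]) auto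
  have C: "(\<integral>\<^sup>+p. ennreal (subordinated_mehler t x p) * indicator (- ?N) p \<partial>(lborel \<Otimes>\<^sub>M M)) \<le> ennreal (C * t)"
    by (rule C'[OF t order_refl])
  obtain K where K: "0 < K" "\<And>p. p \<in> ?N \<Longrightarrow> subordinated_mehler t x p \<le> K"
    using subordinated_mehler_bounded_near_centre[OF t, of "1 / 8" 1 x] by auto
  have sub: "?N \<subseteq> {0<..<1} \<times> ball 0 (norm x + 1)"
  proof
    fix p assume p: "p \<in> ?N"
    obtain s y where sy: "p = (s, y)" by fastforce
    have "norm (mehler_centre s x) \<le> norm x"
      using p norm_mehler_centre_le[of s x] by (auto simp: near_centre_def sy)
    moreover have "norm y \<le> norm (y - mehler_centre s x) + norm (mehler_centre s x)"
      using norm_triangle_ineq[of "y - mehler_centre s x" "mehler_centre s x"] by simp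
    ultimately show "p \<in> {0<..<1} \<times> ball 0 (norm x + 1)"
      using p by (auto simp: near_centre_def sy)
  qed
  have "(\<integral>\<^sup>+p. ennreal (subordinated_mehler t x p) * indicator ?N p \<partial>(lborel \<Otimes>\<^sub>M M))
     \<le> (\<integral>\<^sup>+p. ennreal K * indicator ({0<..<1::real} \<times> ball 0 (norm x + 1)) p \<partial>(lborel \<Otimes>\<^sub>M M))"
    using K sub by (intro nn_integral_mono) (auto split: split_indicator intro!: ennreal_leI)
  also have "\<dots> = ennreal K * emeasure M (ball 0 (norm x + 1))"
    by (subst nn_integral_cmult_indicator) (auto simp: emeasure_pair_measure_Times)
  also have "\<dots> < \<infinity>"
    using emeasure_bounded_finite[of "ball 0 (norm x + 1)"] by (simp add: ennreal_mult_less_top)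
  finally have near: "(\<integral>\<^sup>+p. ennreal (subordinated_mehler t x p) * indicator ?N p \<partial>(lborel \<Otimes>\<^sub>M M)) < \<infinity>" .
  have "(\<integral>\<^sup>+p. ennreal (subordinated_mehler t x p) \<partial>(lborel \<Otimes>\<^sub>M M)) =
    (\<integral>\<^sup>+p. ennreal (subordinated_mehler t x p) * indicator ?N p + ennreal (subordinated_mehler t x p) * indicator (- ?N) p \<partial>(lborel \<Otimes>\<^sub>M M))"
    by (intro nn_integral_cong) (auto split: split_indicator)
  also have "\<dots> = (\<integral>\<^sup>+p. ennreal (subordinated_mehler t x p) * indicator ?N p \<partial>(lborel \<Otimes>\<^sub>M M)) +
      (\<integral>\<^sup>+p. ennreal (subordinated_mehler t x p) * indicator (- ?N) p \<partial>(lborel \<Otimes>\<^sub>M M))"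
    by (intro nn_integral_add) measurable
  also have "\<dots> < \<infinity>" using near order_le_less_trans[OF C] by simp
  finally show "(\<integral>\<^sup>+p. ennreal (subordinated_mehler t x p) \<partial>(lborel \<Otimes>\<^sub>M M)) < \<infinity>" .
  show "AE p in lborel \<Otimes>\<^sub>M M. 0 \<le> subordinated_mehler t x p"
    using t by (intro AE_I2 subordinated_mehler_nonneg) simp
qed measurable

lemma integral_poisson_hermite_kernel:
  assumes t: "0 < t"
  shows "integrable M (poisson_hermite_kernel t x)"
    and "(\<integral>y. poisson_hermite_kernel t x y \<partial>M) = (\<integral>p. subordinated_mehler t x p \<partial>(lborel \<Otimes>\<^sub>M M))"
proof -
  have eq: "poisson_hermite_kernel t x = (\<lambda>y. \<integral>s. subordinated_mehler t x (s, y) \<partial>lborel)"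
    by (auto simp: poisson_hermite_kernel_eq set_lebesgue_integral_def subordinated_mehler_def fun_eq_iff)
  have i: "integrable (lborel \<Otimes>\<^sub>M M) (case_prod (\<lambda>s y. subordinated_mehler t x (s, y)))"
    using integrable_subordinated_mehler[OF t] by simp
  show "integrable M (poisson_hermite_kernel t x)"
    unfolding eq by (rule P.integrable_snd[OF i])
  show "(\<integral>y. poisson_hermite_kernel t x y \<partial>M) = (\<integral>p. subordinated_mehler t x p \<partial>(lborel \<Otimes>\<^sub>M M))"
    unfolding eq using P.integral_snd[OF i] by simp
qed

text \<open>
  Write the Gaussian at distance \<open>\<rho> < \<delta>\<close> as its value at \<open>\<delta>\<close> plus the integral over \<open>r \<in> (\<rho>, \<delta>)\<close> of
  minus its radial derivative, and exchange the integrals.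
\<close>

lemma gaussian_layer_cake:
  assumes a: "0 < a" and \<delta>: "0 < \<delta>"
  shows "integrable lborel (\<lambda>r. indicator {0..\<delta>} r * (2 * a * r * exp (- (a * r\<^sup>2))) * measure M (ball z r))" (is ?I)
    and "(\<integral>y. indicator (ball z \<delta>) y * exp (- (a * (norm (y - z))\<^sup>2)) \<partial>M) =
      exp (- (a * \<delta>\<^sup>2)) * measure M (ball z \<delta>) +
      (\<integral>r. indicator {0..\<delta>} r * (2 * a * r * exp (- (a * r\<^sup>2))) * measure M (ball z r) \<partial>lborel)" (is ?E)
proof -
  let ?w = "\<lambda>r. indicator {0..\<delta>} r * (2 * a * r * exp (- (a * r\<^sup>2))) :: real"
  let ?f = "\<lambda>r y. ?w r * indicator (ball z r) y"
  have "(\<lambda>p. indicator {0..\<delta>} (fst p) * (2 * a * fst p * exp (- (a * (fst p)\<^sup>2))) *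
      (if dist z (snd p) < fst p then 1 else 0)) \<in> borel_measurable (borel \<Otimes>\<^sub>M borel :: (real \<times> 'a) measure)"
    by measurable
  also have "(\<lambda>p. indicator {0..\<delta>} (fst p) * (2 * a * fst p * exp (- (a * (fst p)\<^sup>2))) *
      (if dist z (snd p) < fst p then 1 else 0)) = case_prod ?f"
    by (auto simp: fun_eq_iff indicator_def)
  finally have m: "case_prod ?f \<in> borel_measurable (borel \<Otimes>\<^sub>M borel)" .
  have B: "ball z \<delta> \<in> sets borel" "bounded (ball z \<delta>)" by auto
  note fin = emeasure_bounded_finite[OF B]
  have i: "integrable (lborel \<Otimes>\<^sub>M M) (case_prod ?f)"
  proof (rule Bochner_Integration.integrable_bound)
    have "emeasure (lborel \<Otimes>\<^sub>M M) ({0..\<delta>} \<times> ball z \<delta>) < \<infinity>"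
      using fin \<delta> by (simp add: emeasure_pair_measure_Times ennreal_mult_less_top)
    then show "integrable (lborel \<Otimes>\<^sub>M M) (\<lambda>p. (2 * a * \<delta>) * indicator ({0..\<delta>} \<times> ball z \<delta>) p :: real)"
      by (intro integrable_mult_right integrable_real_indicator) auto
    show "case_prod ?f \<in> borel_measurable (lborel \<Otimes>\<^sub>M M)" using m by measurable
    show "AE p in lborel \<Otimes>\<^sub>M M. norm (case_prod ?f p) \<le> norm ((2 * a * \<delta>) * indicator ({0..\<delta>} \<times> ball z \<delta>) p :: real)"
    proof (rule AE_I2, clarify)
      fix r :: real and y :: 'a
      have "2 * a * r * exp (- (a * r\<^sup>2)) \<le> 2 * a * \<delta> * 1" if "0 \<le> r" "r \<le> \<delta>"
        using that a by (intro mult_mono) auto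
      then show "norm (?f r y) \<le> norm ((2 * a * \<delta>) * indicator ({0..\<delta>} \<times> ball z \<delta>) (r, y) :: real)"
        using a \<delta> by (auto split: split_indicator)
    qed
  qed
  have inner1: "(\<integral>y. ?f r y \<partial>M) = ?w r * measure M (ball z r)" for r
    by simp
  show ?I
    using P.integrable_fst[OF i] unfolding inner1 .
  have inner2: "indicator (ball z \<delta>) y * exp (- (a * (norm (y - z))\<^sup>2)) =
      exp (- (a * \<delta>\<^sup>2)) * indicator (ball z \<delta>) y + (\<integral>r. ?f r y \<partial>lborel)" for y
  proof (cases "y \<in> ball z \<delta>")
    case True
    define \<rho> where "\<rho> = norm (y - z)"
    have \<rho>: "0 \<le> \<rho>" "\<rho> < \<delta>" using True by (auto simp: \<rho>_def dist_norm norm_minus_commute)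
    have dz: "dist z y = \<rho>" by (simp add: \<rho>_def dist_norm norm_minus_commute)
    have "(\<integral>r. ?f r y \<partial>lborel) = (\<integral>r. (2 * a * r * exp (- (a * r\<^sup>2))) * indicator {\<rho>..\<delta>} r \<partial>lborel)"
    proof (rule integral_cong_AE)
      \<comment> \<open>The two integrands differ at most at \<open>r = \<rho>\<close>.\<close>
      show "AE r in lborel. ?f r y = (2 * a * r * exp (- (a * r\<^sup>2))) * indicator {\<rho>..\<delta>} r"
        using AE_lborel_singleton[of \<rho>] by eventually_elim (use \<rho> in \<open>auto simp: dz indicator_def\<close>)
      show "(\<lambda>r. ?f r y) \<in> borel_measurable lborel"
        using measurable_Pair2'[of y M lborel] measurable_compose[OF _ m, of "\<lambda>r. (r, y)" lborel] by simp
    qed measurable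
    also have "\<dots> = - exp (- (a * \<delta>\<^sup>2)) - - exp (- (a * \<rho>\<^sup>2))"
    proof (rule integral_FTC_Icc_real)
      show "\<rho> \<le> \<delta>" using \<rho> by simp
      show "((\<lambda>r. - exp (- (a * r\<^sup>2))) has_real_derivative 2 * a * r * exp (- (a * r\<^sup>2))) (at r)" for r
        by (auto intro!: derivative_eq_intros)
    qed (auto intro!: continuous_intros)
    finally show ?thesis using True by (simp add: \<rho>_def)
  next
    case False
    then have "(\<lambda>r. ?f r y) = (\<lambda>r. 0)" by (intro ext) (auto simp: indicator_def)
    then have "(\<integral>r. ?f r y \<partial>lborel) = 0" by (simp only: Bochner_Integration.integral_zero)
    moreover have "indicat_real (ball z \<delta>) y = 0" using False by (simp only: indicator_simps not_False_eq_True)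
    ultimately show ?thesis by (simp only: mult_zero_left mult_zero_right add_0_left)
  qed
  have "(\<integral>y. indicator (ball z \<delta>) y * exp (- (a * (norm (y - z))\<^sup>2)) \<partial>M) =
     (\<integral>y. exp (- (a * \<delta>\<^sup>2)) * indicator (ball z \<delta>) y \<partial>M) + (\<integral>y. \<integral>r. ?f r y \<partial>lborel \<partial>M)"
    unfolding inner2 using fin P.integrable_snd[OF i]
    by (intro Bochner_Integration.integral_add integrable_mult_right integrable_real_indicator) auto
  also have "(\<integral>y. \<integral>r. ?f r y \<partial>lborel \<partial>M) = (\<integral>r. \<integral>y. ?f r y \<partial>M \<partial>lborel)"
    by (rule P.Fubini_integral[OF i])
  finally show ?E unfolding inner1 by simp
qed

end

section \<open>Gaussians against measures that are small on small balls\<close>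

definition mehler_amplitude :: "real \<Rightarrow> 'a::euclidean_space \<Rightarrow> real" where
  "mehler_amplitude s x = ((1 - s\<^sup>2) / (4 * pi * s)) powr (real DIM('a) / 2) * exp (- (s / (1 + s\<^sup>2) * (norm x)\<^sup>2))"

definition mehler_rate :: "real \<Rightarrow> real" where
  "mehler_rate s = (1 + s\<^sup>2) / (4 * s)"

lemma mehler_kernel_eq:
  "0 < s \<Longrightarrow> mehler_kernel s x y =
     mehler_amplitude s x * exp (- (mehler_rate s * (norm (y - mehler_centre s x))\<^sup>2))"
  unfolding mehler_amplitude_def mehler_rate_def by (rule mehler_kernel_shift)

lemma mehler_amplitude_nonneg: "0 \<le> mehler_amplitude s x"
  by (simp add: mehler_amplitude_def)

lemma mehler_rate_pos: "0 < s \<Longrightarrow> 0 < mehler_rate s"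
  by (simp add: mehler_rate_def add_pos_nonneg)

lemma (in phi_measure) integral_near_centre:
  fixes x :: 'a and \<delta> :: real
  assumes t: "0 < t" and s0: "s0 \<le> 1 / 8"
  defines "J \<equiv> \<lambda>s. \<integral>y. indicator (ball (mehler_centre s x) \<delta>) y * exp (- (mehler_rate s * (norm (y - mehler_centre s x))\<^sup>2)) \<partial>M"
  shows "integrable lborel (\<lambda>s. indicator {0<..<s0} s * (subordinator t s * mehler_amplitude s x) * J s)"
    and "(\<integral>p. subordinated_mehler t x p * indicator (near_centre s0 \<delta> x) p \<partial>(lborel \<Otimes>\<^sub>M M)) =
      (\<integral>s. indicator {0<..<s0} s * (subordinator t s * mehler_amplitude s x) * J s \<partial>lborel)"
proof -
  let ?f = "\<lambda>s y. subordinated_mehler t x (s, y) * indicator (near_centre s0 \<delta> x) (s, y)"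
  have "integrable (lborel \<Otimes>\<^sub>M M) (\<lambda>p. subordinated_mehler t x p * indicator (near_centre s0 \<delta> x) p)"
    by (intro integrable_real_mult_indicator integrable_subordinated_mehler t) measurable
  then have i: "integrable (lborel \<Otimes>\<^sub>M M) (case_prod ?f)" by (simp add: case_prod_beta')
  have "?f s y = indicator {0<..<s0} s * (subordinator t s * mehler_amplitude s x) *
    (indicator (ball (mehler_centre s x) \<delta>) y * exp (- (mehler_rate s * (norm (y - mehler_centre s x))\<^sup>2)))" for s y
    using s0 by (auto simp: subordinated_mehler_def near_centre_def mehler_kernel_eq dist_norm norm_minus_commute
        split: split_indicator)
  then have inner: "(\<integral>y. ?f s y \<partial>M) = indicator {0<..<s0} s * (subordinator t s * mehler_amplitude s x) * J s" for s
    unfolding J_def by (simp only: integral_mult_right_zero)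
  show "integrable lborel (\<lambda>s. indicator {0<..<s0} s * (subordinator t s * mehler_amplitude s x) * J s)"
    using P.integrable_fst[OF i] unfolding inner .
  show "(\<integral>p. subordinated_mehler t x p * indicator (near_centre s0 \<delta> x) p \<partial>(lborel \<Otimes>\<^sub>M M)) =
      (\<integral>s. indicator {0<..<s0} s * (subordinator t s * mehler_amplitude s x) * J s \<partial>lborel)"
    using P.integral_fst[OF i] unfolding inner by (simp add: case_prod_beta')
qed

text \<open>
  After the layer cake formula only \<open>\<mu>(B\<^sub>r(z))\<close> with \<open>r \<le> \<delta>\<close> enters, and this is where the cancellation
  between the measures \<open>M i\<close> is used. The growth \<open>(\<rho> + r)\<^sup>n\<close> is traded for \<open>(\<rho> + 1/\<surd>a)\<^sup>n\<close>, where
  \<open>1/\<surd>a\<close> is the width of the Gaussian, at the price of half of the exponent.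
\<close>

lemma norm_sum_gaussian_ball_le:
  fixes M :: "'i \<Rightarrow> 'a::euclidean_space measure" and c :: "'i \<Rightarrow> complex"
  assumes phi: "\<And>i. i \<in> I \<Longrightarrow> phi_measure (M i)"
    and a: "0 < a" and \<delta>: "0 < \<delta>" and \<rho>: "0 \<le> \<rho>" and \<epsilon>: "0 \<le> \<epsilon>"
    and small: "\<And>r. 0 < r \<Longrightarrow> r \<le> \<delta> \<Longrightarrow>
      norm (\<Sum>i\<in>I. c i * complex_of_real (measure (M i) (ball z r))) \<le> \<epsilon> * (\<rho> + r) ^ n"
    and C: "\<And>v. 0 \<le> v \<Longrightarrow> (1 + v) ^ n * exp (- (1 / 2 * v\<^sup>2)) \<le> C"
  shows "norm (\<Sum>i\<in>I. c i * complex_of_real (\<integral>y. indicator (ball z \<delta>) y * exp (- (a * (norm (y - z))\<^sup>2)) \<partial>M i))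
    \<le> 2 * C * \<epsilon> * (\<rho> + 1 / sqrt a) ^ n"
proof -
  let ?\<mu> = "\<lambda>r. \<Sum>i\<in>I. c i * complex_of_real (measure (M i) (ball z r))"
  let ?w = "\<lambda>r. indicator {0..\<delta>} r * (2 * a * r * exp (- (a * r\<^sup>2))) :: real"
  let ?b = "1 / sqrt a"
  define D where "D = C * \<epsilon> * (\<rho> + ?b) ^ n"
  have C0: "0 \<le> C" using C[of 0] by simp
  have b: "0 < ?b" using a by simp
  have D: "0 \<le> D" using C0 \<epsilon> \<rho> b by (auto simp: D_def)
  \<comment> \<open>The hypothesis on \<open>C\<close> is used with \<open>v = r / b\<close>, where \<open>b\<close> is the width of the Gaussian.\<close>
  have growth: "\<epsilon> * (\<rho> + r) ^ n * exp (- (a * r\<^sup>2)) \<le> D * exp (- (a / 2 * r\<^sup>2))" if r: "0 \<le> r" for r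
  proof -
    have sq: "(sqrt a * r)\<^sup>2 = a * r\<^sup>2" using a by (simp add: power_mult_distrib)
    have "\<rho> + r \<le> (\<rho> + ?b) * (1 + sqrt a * r)"
      using a r \<rho> by (simp add: algebra_simps)
    then have "(\<rho> + r) ^ n \<le> ((\<rho> + ?b) * (1 + sqrt a * r)) ^ n"
      using r \<rho> by (intro power_mono) auto
    then have "(\<rho> + r) ^ n * exp (- (1 / 2 * (sqrt a * r)\<^sup>2)) \<le>
        (\<rho> + ?b) ^ n * ((1 + sqrt a * r) ^ n * exp (- (1 / 2 * (sqrt a * r)\<^sup>2)))"
      by (simp add: power_mult_distrib mult_right_mono)
    also have "\<dots> \<le> (\<rho> + ?b) ^ n * C"
      using a r \<rho> by (intro mult_left_mono C) auto
    finally have "(\<rho> + r) ^ n * exp (- (a / 2 * r\<^sup>2)) \<le> (\<rho> + ?b) ^ n * C"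
      unfolding sq by simp
    then have "\<epsilon> * ((\<rho> + r) ^ n * exp (- (a / 2 * r\<^sup>2))) * exp (- (a / 2 * r\<^sup>2)) \<le> \<epsilon> * ((\<rho> + ?b) ^ n * C) * exp (- (a / 2 * r\<^sup>2))"
      using \<epsilon> by (intro mult_right_mono mult_left_mono) auto
    moreover have "exp (- (a * r\<^sup>2)) = exp (- (a / 2 * r\<^sup>2)) * exp (- (a / 2 * r\<^sup>2))"
      by (simp flip: exp_add)
    ultimately show ?thesis by (simp add: D_def mult_ac)
  qed
  have "(\<integral>y. indicator (ball z \<delta>) y * exp (- (a * (norm (y - z))\<^sup>2)) \<partial>M i) =
      exp (- (a * \<delta>\<^sup>2)) * measure (M i) (ball z \<delta>) + (\<integral>r. ?w r * measure (M i) (ball z r) \<partial>lborel)"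
    and int: "integrable lborel (\<lambda>r. ?w r * measure (M i) (ball z r))" if "i \<in> I" for i
    using phi_measure.gaussian_layer_cake[OF phi[OF that] a \<delta>] by auto
  then have "(\<Sum>i\<in>I. c i * complex_of_real (\<integral>y. indicator (ball z \<delta>) y * exp (- (a * (norm (y - z))\<^sup>2)) \<partial>M i)) =
    (\<Sum>i\<in>I. c i * complex_of_real (exp (- (a * \<delta>\<^sup>2)) * measure (M i) (ball z \<delta>) + (\<integral>r. ?w r * measure (M i) (ball z r) \<partial>lborel)))"
    by (intro sum.cong) auto
  also have "\<dots> = complex_of_real (exp (- (a * \<delta>\<^sup>2))) * ?\<mu> \<delta> + (\<Sum>i\<in>I. c i * complex_of_real (\<integral>r. ?w r * measure (M i) (ball z r) \<partial>lborel))"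
    by (simp add: sum.distrib distrib_left sum_distrib_left mult_ac)
  also have "(\<Sum>i\<in>I. c i * complex_of_real (\<integral>r. ?w r * measure (M i) (ball z r) \<partial>lborel))
     = (\<integral>r. (\<Sum>i\<in>I. c i * complex_of_real (?w r * measure (M i) (ball z r))) \<partial>lborel)"
    using int by (subst Bochner_Integration.integral_sum) (auto simp del: of_real_mult simp: integral_complex_of_real)
  also have "(\<lambda>r. \<Sum>i\<in>I. c i * complex_of_real (?w r * measure (M i) (ball z r))) = (\<lambda>r. complex_of_real (?w r) * ?\<mu> r)"
    by (auto simp: sum_distrib_left mult_ac intro!: ext sum.cong)
  finally have eq: "(\<Sum>i\<in>I. c i * complex_of_real (\<integral>y. indicator (ball z \<delta>) y * exp (- (a * (norm (y - z))\<^sup>2)) \<partial>M i)) =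
    complex_of_real (exp (- (a * \<delta>\<^sup>2))) * ?\<mu> \<delta> + (\<integral>r. complex_of_real (?w r) * ?\<mu> r \<partial>lborel)" .
  have int': "integrable lborel (\<lambda>r. complex_of_real (?w r) * ?\<mu> r)"
  proof -
    have "integrable lborel (\<lambda>r. \<Sum>i\<in>I. c i * complex_of_real (?w r * measure (M i) (ball z r)))"
      using int by (intro Bochner_Integration.integrable_sum integrable_mult_right integrable_of_real) auto
    then show ?thesis by (simp add: sum_distrib_left mult_ac)
  qed
  let ?g = "\<lambda>r. (2 * a * r * exp (- (a / 2 * r\<^sup>2))) * indicator {0..\<delta>} r :: real"
  have g: "has_bochner_integral lborel ?g (- 2 * exp (- (a / 2 * \<delta>\<^sup>2)) - - 2 * exp (- (a / 2 * 0\<^sup>2)))"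
  proof (rule has_bochner_integral_FTC_Icc_real)
    show "0 \<le> \<delta>" using \<delta> by simp
    show "((\<lambda>r. - 2 * exp (- (a / 2 * r\<^sup>2))) has_real_derivative 2 * a * r * exp (- (a / 2 * r\<^sup>2))) (at r)" for r
      by (auto intro!: derivative_eq_intros)
  qed (auto intro!: continuous_intros)
  have "norm (\<integral>r. complex_of_real (?w r) * ?\<mu> r \<partial>lborel) \<le> (\<integral>r. D * ?g r \<partial>lborel)"
  proof (rule Bochner_Integration.integral_norm_bound_integral[OF int'])
    show "integrable lborel (\<lambda>r. D * ?g r)"
      using g by (intro integrable_mult_right) (auto simp: has_bochner_integral_iff)
    fix r
    show "norm (complex_of_real (?w r) * ?\<mu> r) \<le> D * ?g r"
    proof (cases "0 < r \<and> r \<le> \<delta>")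
      case True
      have "norm (complex_of_real (?w r) * ?\<mu> r) = 2 * a * r * (exp (- (a * r\<^sup>2)) * norm (?\<mu> r))"
        using True a by (simp add: norm_mult)
      also have "\<dots> \<le> 2 * a * r * (exp (- (a * r\<^sup>2)) * (\<epsilon> * (\<rho> + r) ^ n))"
        using True a by (intro mult_left_mono small) auto
      also have "\<dots> = 2 * a * r * (\<epsilon> * (\<rho> + r) ^ n * exp (- (a * r\<^sup>2)))" by (simp add: mult_ac)
      also have "\<dots> \<le> 2 * a * r * (D * exp (- (a / 2 * r\<^sup>2)))"
        using True a by (intro mult_left_mono growth) auto
      also have "\<dots> = D * ?g r" using True by simp
      finally show ?thesis .
    next
      case False
      then have "?w r = 0" by (auto simp: indicator_def)
      then have "norm (complex_of_real (?w r) * ?\<mu> r) = 0" by (simp only: of_real_0 mult_zero_left norm_zero)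
      also have "0 \<le> D * ?g r" using D a by (auto split: split_indicator)
      finally show ?thesis .
    qed
  qed
  also have "\<dots> = D * (2 - 2 * exp (- (a / 2 * \<delta>\<^sup>2)))"
    using g by (simp add: has_bochner_integral_iff)
  finally have 1: "norm (\<integral>r. complex_of_real (?w r) * ?\<mu> r \<partial>lborel) \<le> D * (2 - 2 * exp (- (a / 2 * \<delta>\<^sup>2)))" .
  have "norm (complex_of_real (exp (- (a * \<delta>\<^sup>2))) * ?\<mu> \<delta>) = exp (- (a * \<delta>\<^sup>2)) * norm (?\<mu> \<delta>)"
    by (simp only: norm_mult norm_of_real abs_exp_cancel)
  also have "\<dots> \<le> exp (- (a * \<delta>\<^sup>2)) * (\<epsilon> * (\<rho> + \<delta>) ^ n)"
    using \<delta> by (intro mult_left_mono small) auto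
  also have "\<dots> \<le> D * exp (- (a / 2 * \<delta>\<^sup>2))" using growth[of \<delta>] \<delta> by (simp add: mult_ac)
  finally have 2: "norm (complex_of_real (exp (- (a * \<delta>\<^sup>2))) * ?\<mu> \<delta>) \<le> D * exp (- (a / 2 * \<delta>\<^sup>2))" .
  have "D * exp (- (a / 2 * \<delta>\<^sup>2)) + D * (2 - 2 * exp (- (a / 2 * \<delta>\<^sup>2))) \<le> 2 * D"
    using D by (simp add: algebra_simps)
  then show ?thesis
    unfolding eq using 1 2 norm_triangle_ineq[of "complex_of_real (exp (- (a * \<delta>\<^sup>2))) * ?\<mu> \<delta>" "\<integral>r. complex_of_real (?w r) * ?\<mu> r \<partial>lborel"]
    by (simp add: D_def mult_ac)
qed

lemma affine_power_gaussian_bounded: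
  assumes "0 \<le> (A::real)" "0 \<le> B" "0 < c"
  obtains C where "0 < C" "\<And>v. 0 \<le> v \<Longrightarrow> (A * v + B) ^ n * exp (- (c * v\<^sup>2)) \<le> C"
proof -
  obtain C where C: "0 < C" "\<And>v. 0 \<le> v \<Longrightarrow> v powr real n \<le> C * exp (2 * c * v)"
    using powr_le_exp[of "real n" "2 * c"] assms by auto
  have "(A * v + B) ^ n * exp (- (c * v\<^sup>2)) \<le> (A + B) ^ n * (C * exp (3 * c)) + 1" if v: "0 \<le> v" for v
  proof -
    have "(A * v + B) ^ n \<le> ((A + B) * (1 + v)) ^ n"
      using v assms by (intro power_mono) (auto simp: algebra_simps)
    also have "\<dots> = (A + B) ^ n * (1 + v) powr real n"
      using v by (simp add: power_mult_distrib powr_realpow)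
    also have "\<dots> \<le> (A + B) ^ n * (C * exp (2 * c * (1 + v)))"
      using assms v by (intro mult_left_mono C) auto
    finally have "(A * v + B) ^ n * exp (- (c * v\<^sup>2)) \<le> (A + B) ^ n * (C * exp (2 * c * (1 + v))) * exp (- (c * v\<^sup>2))"
      by (intro mult_right_mono) auto
    also have "\<dots> = (A + B) ^ n * (C * exp (2 * c * (1 + v) - c * v\<^sup>2))"
      by (simp add: exp_diff exp_minus field_simps)
    also have "\<dots> \<le> (A + B) ^ n * (C * exp (3 * c))"
    proof (intro mult_left_mono)
      have "0 \<le> c * (v - 1)\<^sup>2" using assms by simp
      then show "exp (2 * c * (1 + v) - c * v\<^sup>2) \<le> exp (3 * c)"
        by (simp add: power2_eq_square algebra_simps)
    qed (use assms C in auto)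
    finally show ?thesis by simp
  qed
  then show ?thesis using that[of "(A + B) ^ n * (C * exp (3 * c)) + 1"] assms C(1)
    by (auto simp: add_nonneg_pos)
qed

text \<open>
  The distance of the centre \<open>\<theta> x\<close> to \<open>x\<^sub>0\<close> plus the width of the Gaussian is at most
  \<open>\<surd>s (\<alpha> t/\<surd>s + 2X + 2)\<close>, and the amplitude is at most \<open>s\<close> to the power \<open>- d/2\<close>, so the powers of
  \<open>\<surd>s\<close> cancel. The powers of \<open>t/\<surd>s\<close> are absorbed by half of the exponent \<open>t\<^sup>2/\<kappa>(s)\<close>; what is left of
  the density is again a subordinator, with \<open>t/\<surd>2\<close> in place of \<open>t\<close>, so its total mass is still known.
\<close>

lemma subordinated_scale_bound:
  fixes x x0 :: "'a::euclidean_space"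
  assumes t: "0 < t" and s: "0 < s" "s \<le> 1 / 8" and \<alpha>: "0 < \<alpha>"
    and x: "norm x \<le> X" "norm (x - x0) \<le> \<alpha> * t"
    and C: "\<And>v. 0 \<le> v \<Longrightarrow> (\<alpha> * v + (2 * X + 2)) ^ DIM('a) * exp (- (1 / 16 * v\<^sup>2)) \<le> C"
  shows "subordinator t s * mehler_amplitude s x * (norm (mehler_centre s x - x0) + 1 / sqrt (mehler_rate s)) ^ DIM('a)
    \<le> C * sqrt 2 * subordinator (t / sqrt 2) s"
proof -
  let ?n = "DIM('a)"
  define \<rho> b v where "\<rho> = norm (mehler_centre s x - x0)" and "b = 1 / sqrt (mehler_rate s)" and "v = t / sqrt s"
  have s1: "s < 1" using s by simp
  have X: "0 \<le> X" using x norm_ge_zero order_trans by blast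
  have v: "0 \<le> v" using t s by (simp add: v_def)
  have v2: "v\<^sup>2 = t\<^sup>2 / s" using s by (simp add: v_def power_divide)
  have sb: "0 \<le> subordinator (t / sqrt 2) s" using t s s1 by (intro subordinator_nonneg) auto
  have s2: "s\<^sup>2 \<le> sqrt s"
  proof -
    have "s\<^sup>2 \<le> s" using s by (simp add: power2_eq_square mult_le_cancel_left1)
    also have "s \<le> sqrt s" using s by (intro real_le_rsqrt) (simp add: power2_eq_square mult_le_cancel_left1)
    finally show ?thesis .
  qed
  have "\<rho> \<le> norm (mehler_centre s x - x) + norm (x - x0)"
    unfolding \<rho>_def using norm_triangle_ineq[of "mehler_centre s x - x" "x - x0"] by simp
  also have "\<dots> \<le> 2 * s\<^sup>2 * norm x + \<alpha> * t"
    using norm_mehler_centre_diff_le[OF s(1) s1] x by (intro add_mono) auto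
  also have "\<dots> \<le> 2 * sqrt s * X + \<alpha> * t"
    using s2 x s by (intro add_right_mono mult_mono) auto
  finally have \<rho>: "\<rho> \<le> 2 * sqrt s * X + \<alpha> * t" .
  have "1 / (4 * s) \<le> mehler_rate s" unfolding mehler_rate_def using s by (intro divide_right_mono) auto
  then have "sqrt (1 / (4 * s)) \<le> sqrt (mehler_rate s)" by (rule real_sqrt_le_mono)
  then have "b \<le> 1 / sqrt (1 / (4 * s))" unfolding b_def using s mehler_rate_pos[OF s(1)] by (intro divide_left_mono) auto
  also have "\<dots> = 2 * sqrt s" by (simp add: real_sqrt_divide real_sqrt_mult)
  finally have b: "b \<le> 2 * sqrt s" "0 \<le> b" using mehler_rate_pos[OF s(1)] by (auto simp: b_def)
  have "\<rho> + b \<le> sqrt s * (\<alpha> * v + (2 * X + 2))"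
    using \<rho> b s by (simp add: v_def algebra_simps)
  then have "(\<rho> + b) ^ ?n \<le> (sqrt s * (\<alpha> * v + (2 * X + 2))) ^ ?n"
    using b by (intro power_mono) (auto simp: \<rho>_def)
  then have pw: "(\<rho> + b) ^ ?n \<le> sqrt s ^ ?n * (\<alpha> * v + (2 * X + 2)) ^ ?n" by (simp add: power_mult_distrib)
  have amp: "mehler_amplitude s x \<le> 1 / sqrt s ^ ?n"
  proof -
    have "(1 - s\<^sup>2) / (4 * pi * s) \<le> 1 / (1 * s)"
      using s pi_gt3 by (intro frac_le) auto
    then have "((1 - s\<^sup>2) / (4 * pi * s)) powr (real ?n / 2) \<le> (1 / s) powr (real ?n / 2)"
      using s one_minus_square_pos[OF s(1) s1] by (intro powr_mono2) auto
    also have "\<dots> = 1 / sqrt s ^ ?n"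
      using s by (simp add: powr_divide powr_half_sqrt[symmetric] powr_powr flip: powr_realpow)
    finally have "((1 - s\<^sup>2) / (4 * pi * s)) powr (real ?n / 2) \<le> 1 / sqrt s ^ ?n" .
    moreover have "exp (- (s / (1 + s\<^sup>2) * (norm x)\<^sup>2)) \<le> 1" using s by simp
    ultimately show ?thesis unfolding mehler_amplitude_def using s by (metis mult_mono' mult.right_neutral exp_ge_zero powr_ge_zero)
  qed
  have "mehler_amplitude s x * (\<rho> + b) ^ ?n \<le> (1 / sqrt s ^ ?n) * (sqrt s ^ ?n * (\<alpha> * v + (2 * X + 2)) ^ ?n)"
    using amp pw b s by (intro mult_mono) (auto simp: \<rho>_def)
  also have "\<dots> = (\<alpha> * v + (2 * X + 2)) ^ ?n" using s by simp
  finally have 1: "mehler_amplitude s x * (\<rho> + b) ^ ?n \<le> (\<alpha> * v + (2 * X + 2)) ^ ?n" .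
  have k: "0 < kappa s" "kappa s \<le> 8 * s" using kappa_pos[OF s(1) s1] kappa_le[of s] s by auto
  have e: "exp (- (t\<^sup>2 / (2 * kappa s))) \<le> exp (- (1 / 16 * v\<^sup>2))"
    using k s t unfolding v2 by (simp add: divide_left_mono)
  have split: "subordinator t s = sqrt 2 * exp (- (t\<^sup>2 / (2 * kappa s))) * subordinator (t / sqrt 2) s"
  proof -
    have "- t\<^sup>2 / kappa s = - (t\<^sup>2 / (2 * kappa s)) + - (t / sqrt 2)\<^sup>2 / kappa s"
      using k by (simp add: power_divide field_simps)
    then have "exp (- t\<^sup>2 / kappa s) = exp (- (t\<^sup>2 / (2 * kappa s))) * exp (- (t / sqrt 2)\<^sup>2 / kappa s)"
      by (simp only: exp_add)
    then show ?thesis unfolding subordinator_def by (simp add: mult_ac)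
  qed
  have "subordinator t s * (mehler_amplitude s x * (\<rho> + b) ^ ?n) \<le> subordinator t s * (\<alpha> * v + (2 * X + 2)) ^ ?n"
    using t s s1 by (intro mult_left_mono 1 subordinator_nonneg) auto
  also have "\<dots> = sqrt 2 * subordinator (t / sqrt 2) s * ((\<alpha> * v + (2 * X + 2)) ^ ?n * exp (- (t\<^sup>2 / (2 * kappa s))))"
    unfolding split by simp
  also have "\<dots> \<le> sqrt 2 * subordinator (t / sqrt 2) s * ((\<alpha> * v + (2 * X + 2)) ^ ?n * exp (- (1 / 16 * v\<^sup>2)))"
    using sb \<alpha> v X by (intro mult_left_mono e) auto
  also have "\<dots> \<le> sqrt 2 * subordinator (t / sqrt 2) s * C"
    using sb by (intro mult_left_mono C v) auto
  finally show ?thesis by (simp add: \<rho>_def b_def mult_ac)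
qed

section \<open>Nontangential decay\<close>

text \<open>
  Combines the bound for each \<open>s\<close> with the fact that \<^term>\<open>subordinator (t / sqrt 2)\<close> has mass one.
\<close>

lemma norm_sum_near_centre_le:
  fixes M :: "'i \<Rightarrow> 'a::euclidean_space measure" and c :: "'i \<Rightarrow> complex" and x x0 :: 'a
  assumes phi: "\<And>i. i \<in> I \<Longrightarrow> phi_measure (M i)"
    and t: "0 < t" and s0: "s0 \<le> 1 / 8" and \<alpha>: "0 < \<alpha>" and \<delta>: "0 < \<delta>" and \<epsilon>: "0 \<le> \<epsilon>"
    and x: "norm x \<le> X" "norm (x - x0) \<le> \<alpha> * t"
    and C1: "\<And>v. 0 \<le> v \<Longrightarrow> (1 + v) ^ DIM('a) * exp (- (1 / 2 * v\<^sup>2)) \<le> C1"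
    and C2: "\<And>v. 0 \<le> v \<Longrightarrow> (\<alpha> * v + (2 * X + 2)) ^ DIM('a) * exp (- (1 / 16 * v\<^sup>2)) \<le> C2"
    and small: "\<And>z r. 0 < r \<Longrightarrow> norm (z - x0) + r < \<eta> \<Longrightarrow>
      norm (\<Sum>i\<in>I. c i * complex_of_real (measure (M i) (ball z r))) \<le> \<epsilon> * (norm (z - x0) + r) ^ DIM('a)"
    and centre: "\<And>s. 0 < s \<Longrightarrow> s < s0 \<Longrightarrow> norm (mehler_centre s x - x0) + \<delta> < \<eta>"
  shows "norm (\<Sum>i\<in>I. c i * complex_of_real
      (\<integral>p. subordinated_mehler t x p * indicator (near_centre s0 \<delta> x) p \<partial>(lborel \<Otimes>\<^sub>M M i)))
    \<le> 2 * C1 * \<epsilon> * C2 * sqrt 2"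
proof -
  let ?J = "\<lambda>i s. \<integral>y. indicator (ball (mehler_centre s x) \<delta>) y *
      exp (- (mehler_rate s * (norm (y - mehler_centre s x))\<^sup>2)) \<partial>M i"
  let ?w = "\<lambda>s. indicator {0<..<s0} s * (subordinator t s * mehler_amplitude s x)"
  let ?K = "2 * C1 * \<epsilon> * C2 * sqrt 2"
  let ?g = "\<lambda>s. indicator {0<..<1} s *\<^sub>R subordinator (t / sqrt 2) s"
  have C10: "0 \<le> C1" using C1[of 0] by simp
  have X: "0 \<le> X" using x norm_ge_zero order_trans by blast
  have "0 \<le> (2 * X + 2) ^ DIM('a)" using X by simp
  then have C20: "0 \<le> C2" using C2[of 0] by simp
  have int: "integrable lborel (\<lambda>s. ?w s * ?J i s)"
    and eq: "(\<integral>p. subordinated_mehler t x p * indicator (near_centre s0 \<delta> x) p \<partial>(lborel \<Otimes>\<^sub>M M i)) = (\<integral>s. ?w s * ?J i s \<partial>lborel)"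
    if "i \<in> I" for i
    using phi_measure.integral_near_centre[OF phi[OF that] t s0, of x \<delta>] by auto
  have "(\<Sum>i\<in>I. c i * complex_of_real
      (\<integral>p. subordinated_mehler t x p * indicator (near_centre s0 \<delta> x) p \<partial>(lborel \<Otimes>\<^sub>M M i))) =
      (\<Sum>i\<in>I. c i * complex_of_real (\<integral>s. ?w s * ?J i s \<partial>lborel))"
    by (intro sum.cong refl) (simp only: eq)
  also have "\<dots> = (\<integral>s. (\<Sum>i\<in>I. c i * complex_of_real (?w s * ?J i s)) \<partial>lborel)"
    using int by (subst Bochner_Integration.integral_sum) (auto simp del: of_real_mult simp: integral_complex_of_real)
  finally have e: "(\<Sum>i\<in>I. c i * complex_of_real
      (\<integral>p. subordinated_mehler t x p * indicator (near_centre s0 \<delta> x) p \<partial>(lborel \<Otimes>\<^sub>M M i))) =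
      (\<integral>s. (\<Sum>i\<in>I. c i * complex_of_real (?w s * ?J i s)) \<partial>lborel)" .
  have t2: "0 < t / sqrt 2" using t by simp
  have gi: "integrable lborel ?g" and g1: "(\<integral>s. ?g s \<partial>lborel) = 1"
    using subordinator_integral[OF t2] by (auto simp: set_integrable_def set_lebesgue_integral_def)
  have "norm (\<integral>s. (\<Sum>i\<in>I. c i * complex_of_real (?w s * ?J i s)) \<partial>lborel) \<le> (\<integral>s. ?K * ?g s \<partial>lborel)"
  proof (rule Bochner_Integration.integral_norm_bound_integral)
    show "integrable lborel (\<lambda>s. \<Sum>i\<in>I. c i * complex_of_real (?w s * ?J i s))"
      using int by (intro Bochner_Integration.integrable_sum integrable_mult_right integrable_of_real) auto
    show "integrable lborel (\<lambda>s. ?K * ?g s)" by (intro integrable_mult_right gi)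
    fix s
    show "norm (\<Sum>i\<in>I. c i * complex_of_real (?w s * ?J i s)) \<le> ?K * ?g s"
    proof (cases "s \<in> {0<..<s0}")
      case True
      then have s: "0 < s" "s < s0" "s \<le> 1 / 8" "s < 1" using s0 by auto
      have wn: "0 \<le> subordinator t s * mehler_amplitude s x"
        using t s by (intro mult_nonneg_nonneg subordinator_nonneg mehler_amplitude_nonneg) auto
      let ?\<rho> = "norm (mehler_centre s x - x0)"
      have "(\<Sum>i\<in>I. c i * complex_of_real (?w s * ?J i s)) = complex_of_real (?w s) * (\<Sum>i\<in>I. c i * complex_of_real (?J i s))"
        by (simp add: sum_distrib_left mult_ac)
      then have "norm (\<Sum>i\<in>I. c i * complex_of_real (?w s * ?J i s)) =
          subordinator t s * mehler_amplitude s x * norm (\<Sum>i\<in>I. c i * complex_of_real (?J i s))"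
        using True wn by (simp only: norm_mult norm_of_real indicator_simps mult_1 abs_of_nonneg)
      also have "\<dots> \<le> subordinator t s * mehler_amplitude s x * (2 * C1 * \<epsilon> * (?\<rho> + 1 / sqrt (mehler_rate s)) ^ DIM('a))"
      proof (intro mult_left_mono wn norm_sum_gaussian_ball_le[OF phi _ \<delta> _ \<epsilon> _ C1])
        fix r assume "0 < r" "r \<le> \<delta>"
        then show "norm (\<Sum>i\<in>I. c i * complex_of_real (measure (M i) (ball (mehler_centre s x) r))) \<le> \<epsilon> * (?\<rho> + r) ^ DIM('a)"
          using centre[OF s(1,2)] by (intro small) auto
      qed (use mehler_rate_pos[OF s(1)] in auto)
      also have "\<dots> = 2 * C1 * \<epsilon> * (subordinator t s * mehler_amplitude s x * (?\<rho> + 1 / sqrt (mehler_rate s)) ^ DIM('a))"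
        by (simp add: mult_ac)
      also have "\<dots> \<le> 2 * C1 * \<epsilon> * (C2 * sqrt 2 * subordinator (t / sqrt 2) s)"
        using C10 \<epsilon> by (intro mult_left_mono subordinated_scale_bound[OF t s(1,3) \<alpha> x C2]) auto
      also have "\<dots> = ?K * ?g s" using s by simp
      finally show ?thesis .
    next
      case False
      then have "norm (\<Sum>i\<in>I. c i * complex_of_real (?w s * ?J i s)) = 0"
        by (simp only: indicator_simps not_False_eq_True mult_zero_left of_real_0 mult_zero_right sum.neutral_const norm_zero)
      also have "0 \<le> ?K * ?g s"
        using C10 C20 \<epsilon> t2 by (auto split: split_indicator intro!: mult_nonneg_nonneg subordinator_nonneg)
      finally show ?thesis .
    qed
  qed
  also have "\<dots> = ?K" using g1 by simp
  finally show ?thesis unfolding e .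
qed

lemma nontangential_limitI:
  assumes "\<And>e. 0 < e \<Longrightarrow> \<exists>d>0. \<forall>t x. 0 < t \<longrightarrow> t < d \<longrightarrow> norm (x - x0) < \<alpha> * t \<longrightarrow> norm (u t x - l) \<le> e"
  shows "nontangential_limit \<alpha> x0 u l"
  unfolding nontangential_limit_def
proof (rule tendstoI)
  fix e :: real assume "0 < e"
  then obtain d where d: "0 < d"
    "\<And>t x. 0 < t \<Longrightarrow> t < d \<Longrightarrow> norm (x - x0) < \<alpha> * t \<Longrightarrow> norm (u t x - l) \<le> e / 2"
    using assms[of "e / 2"] by auto
  show "\<forall>\<^sub>F p in at (0, x0) within {(t, x). 0 < t \<and> norm (x - x0) < \<alpha> * t}. dist (case p of (t, x) \<Rightarrow> u t x) l < e"
    unfolding eventually_at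
  proof (intro exI[of _ d] conjI d(1) ballI impI)
    fix p assume p: "p \<in> {(t, x). 0 < t \<and> norm (x - x0) < \<alpha> * t}" "p \<noteq> (0, x0) \<and> dist p (0, x0) < d"
    obtain t x where tx: "p = (t, x)" by fastforce
    have *: "0 < t" "norm (x - x0) < \<alpha> * t" "dist (t, x) (0, x0) < d" using p by (auto simp: tx)
    have "dist t 0 < d" using dist_fst_le[of "(t, x)" "(0, x0)"] * by simp
    then show "dist (case p of (t, x) \<Rightarrow> u t x) l < e"
      using d(2)[of t x] * \<open>0 < e\<close> by (simp add: dist_norm tx)
  qed
qed

text \<open>
  Given \<open>e\<close>, the smallness on balls is used with \<open>\<epsilon>\<close> so small that the part near the centre is at most
  \<open>e/2\<close> for all small \<open>t\<close>. This fixes \<open>\<delta>\<close> and \<open>s\<^sub>0\<close>, and then the far part is \<open>O(t)\<close>.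
\<close>

lemma sum_poisson_hermite_tendsto_zero:
  fixes M :: "'i \<Rightarrow> 'a::euclidean_space measure" and c :: "'i \<Rightarrow> complex" and x0 :: 'a
  assumes I: "finite I" and phi: "\<And>i. i \<in> I \<Longrightarrow> phi_measure (M i)"
    and small: "\<And>\<epsilon>. 0 < \<epsilon> \<Longrightarrow> \<exists>\<eta>>0. \<forall>z r. 0 < r \<longrightarrow> norm (z - x0) + r < \<eta> \<longrightarrow>
      norm (\<Sum>i\<in>I. c i * complex_of_real (measure (M i) (ball z r))) \<le> \<epsilon> * (norm (z - x0) + r) ^ DIM('a)"
    and \<alpha>: "0 < \<alpha>"
  shows "nontangential_limit \<alpha> x0
    (\<lambda>t x. \<Sum>i\<in>I. c i * complex_of_real (\<integral>y. poisson_hermite_kernel t x y \<partial>M i)) 0"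
proof (rule nontangential_limitI)
  fix e :: real assume e: "0 < e"
  define X where "X = norm x0 + \<alpha>"
  have X: "0 \<le> X" using \<alpha> by (simp add: X_def)
  obtain C1 where C1: "0 < C1" "\<And>v::real. 0 \<le> v \<Longrightarrow> (1 * v + 1) ^ DIM('a) * exp (- (1 / 2 * v\<^sup>2)) \<le> C1"
    by (rule affine_power_gaussian_bounded[of 1 1 "1 / 2" "DIM('a)"]) auto
  obtain C2 where C2: "0 < C2" "\<And>v. 0 \<le> v \<Longrightarrow> (\<alpha> * v + (2 * X + 2)) ^ DIM('a) * exp (- (1 / 16 * v\<^sup>2)) \<le> C2"
    by (rule affine_power_gaussian_bounded[of \<alpha> "2 * X + 2" "1 / 16" "DIM('a)"]) (use \<alpha> X in auto)
  \<comment> \<open>The denominator is twice the factor of \<open>\<epsilon>\<close> in \<open>norm_sum_near_centre_le\<close>, which depends on neither \<open>\<delta>\<close> nor \<open>s\<^sub>0\<close>.\<close>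
  define \<epsilon> where "\<epsilon> = e / (2 * (2 * C1 * C2 * sqrt 2))"
  have \<epsilon>: "0 < \<epsilon>" using e C1(1) C2(1) by (simp add: \<epsilon>_def)
  have \<epsilon>e: "2 * C1 * \<epsilon> * C2 * sqrt 2 = e / 2"
  proof -
    define Q where "Q = 2 * C1 * C2 * sqrt 2"
    have "Q > 0" using C1(1) C2(1) by (simp add: Q_def)
    moreover have "2 * C1 * \<epsilon> * C2 * sqrt 2 = Q * \<epsilon>" by (simp add: Q_def mult_ac)
    moreover have "\<epsilon> = e / (2 * Q)" by (simp add: \<epsilon>_def Q_def)
    ultimately show ?thesis by simp
  qed
  obtain \<eta> where \<eta>: "0 < \<eta>" "\<And>z r. 0 < r \<Longrightarrow> norm (z - x0) + r < \<eta> \<Longrightarrow>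
      norm (\<Sum>i\<in>I. c i * complex_of_real (measure (M i) (ball z r))) \<le> \<epsilon> * (norm (z - x0) + r) ^ DIM('a)"
    using small[OF \<epsilon>] by blast
  \<comment> \<open>Of the radius \<open>\<eta>\<close> one quarter each is spent on \<open>r \<le> \<delta>\<close>, on \<open>|x - x\<^sub>0| < \<alpha> t\<close> and on the
    displacement \<open>2 s\<^sup>2 |x|\<close> of the centre.\<close>
  define \<delta> s0 where "\<delta> = \<eta> / 4" and "s0 = min (1 / 8) (\<eta> / (8 * (X + 1)))"
  have \<delta>: "0 < \<delta>" using \<eta>(1) by (simp add: \<delta>_def)
  have "0 < s0" using \<eta>(1) X by (auto simp: s0_def)
  moreover have "s0 \<le> 1 / 8" "s0 \<le> \<eta> / (8 * (X + 1))"
    unfolding s0_def by (rule min.cobounded1, rule min.cobounded2)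
  ultimately have s0: "0 < s0" "s0 \<le> 1 / 8" "s0 \<le> \<eta> / (8 * (X + 1))" by auto
  have "\<exists>K. 0 \<le> K \<and> (\<forall>t x. 0 < t \<longrightarrow> norm x \<le> X \<longrightarrow>
    (\<integral>\<^sup>+p. ennreal (subordinated_mehler t x p) * indicator (- near_centre s0 \<delta> x) p \<partial>(lborel \<Otimes>\<^sub>M M i)) \<le> ennreal (K * t))"
    if "i \<in> I" for i
    by (rule phi_measure.nn_integral_far_from_centre[OF phi[OF that] s0(1,2) \<delta>, of X]) blast
  then obtain K where K: "\<And>i. i \<in> I \<Longrightarrow> 0 \<le> K i"
    "\<And>i t x. i \<in> I \<Longrightarrow> 0 < t \<Longrightarrow> norm x \<le> X \<Longrightarrow>
    (\<integral>\<^sup>+p. ennreal (subordinated_mehler t x p) * indicator (- near_centre s0 \<delta> x) p \<partial>(lborel \<Otimes>\<^sub>M M i)) \<le> ennreal (K i * t)"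
    by metis
  define F where "F = (\<Sum>i\<in>I. norm (c i) * K i)"
  have F: "0 \<le> F" unfolding F_def using K(1) by (intro sum_nonneg mult_nonneg_nonneg) auto
  define d where "d = min 1 (min (\<eta> / (4 * \<alpha>)) (e / (2 * (F + 1))))"
  have d: "0 < d" using \<eta>(1) \<alpha> e F by (auto simp: d_def)
  have "norm (\<Sum>i\<in>I. c i * complex_of_real (\<integral>y. poisson_hermite_kernel t x y \<partial>M i)) \<le> e"
    if t: "0 < t" "t < d" and x: "norm (x - x0) < \<alpha> * t" for t and x :: 'a
  proof -
    have t1: "t < 1" "t < \<eta> / (4 * \<alpha>)" "t < e / (2 * (F + 1))" using t by (auto simp: d_def)
    have "norm x \<le> norm x0 + norm (x - x0)" using norm_triangle_ineq[of x0 "x - x0"] by simp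
    also have "\<dots> \<le> norm x0 + \<alpha> * 1"
      using x t1 \<alpha> by (intro add_left_mono) (meson less_imp_le mult_left_mono order_trans)
    finally have xX: "norm x \<le> X" by (simp add: X_def)
    have at: "\<alpha> * t < \<eta> / 4" using t1(2) \<alpha> by (simp add: field_simps)
    have centre: "norm (mehler_centre s x - x0) + \<delta> < \<eta>" if s: "0 < s" "s < s0" for s
    proof -
      have s1: "s < 1" using s s0 by simp
      have "norm (mehler_centre s x - x0) \<le> norm (mehler_centre s x - x) + norm (x - x0)"
        using norm_triangle_ineq[of "mehler_centre s x - x" "x - x0"] by simp
      also have "norm (mehler_centre s x - x) \<le> 2 * s\<^sup>2 * norm x"
        by (rule norm_mehler_centre_diff_le[OF s(1) s1])
      also have "2 * s\<^sup>2 * norm x \<le> 2 * s0 * (X + 1)"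
      proof (rule mult_mono)
        have "s\<^sup>2 \<le> s" using s s1 by (simp add: power2_eq_square mult_le_cancel_left1)
        then show "2 * s\<^sup>2 \<le> 2 * s0" using s by simp
      qed (use xX s0 in auto)
      also have "2 * s0 * (X + 1) \<le> \<eta> / 4"
        using s0(3) X by (simp add: field_simps)
      finally show ?thesis using x at \<eta>(1) by (simp add: \<delta>_def)
    qed
    let ?N = "near_centre s0 \<delta> x"
    let ?n = "\<lambda>i. \<integral>p. subordinated_mehler t x p * indicator ?N p \<partial>(lborel \<Otimes>\<^sub>M M i)"
    let ?f = "\<lambda>i. \<integral>p. subordinated_mehler t x p * indicator (- ?N) p \<partial>(lborel \<Otimes>\<^sub>M M i)"
    have split: "(\<integral>y. poisson_hermite_kernel t x y \<partial>M i) = ?n i + ?f i" and far: "\<bar>?f i\<bar> \<le> K i * t"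
      if i: "i \<in> I" for i
    proof -
      interpret phi_measure "M i" by (rule phi[OF i])
      have int: "integrable (lborel \<Otimes>\<^sub>M M i) (subordinated_mehler t x)"
        by (rule integrable_subordinated_mehler[OF t(1)])
      have i1: "integrable (lborel \<Otimes>\<^sub>M M i) (\<lambda>p. subordinated_mehler t x p * indicator ?N p)"
        by (intro integrable_real_mult_indicator int) measurable
      have "- ?N \<in> sets (borel \<Otimes>\<^sub>M borel)"
        using sets.compl_sets[OF near_centre_measurable[of s0 \<delta> x]]
        by (simp add: space_pair_measure Compl_eq_Diff_UNIV)
      then have i2: "integrable (lborel \<Otimes>\<^sub>M M i) (\<lambda>p. subordinated_mehler t x p * indicator (- ?N) p)"
        by (intro integrable_real_mult_indicator int) (simp add: pair_sets)
      have "(\<integral>y. poisson_hermite_kernel t x y \<partial>M i) = (\<integral>p. subordinated_mehler t x p \<partial>(lborel \<Otimes>\<^sub>M M i))"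
        by (rule integral_poisson_hermite_kernel(2)[OF t(1)])
      also have "\<dots> = (\<integral>p. subordinated_mehler t x p * indicator ?N p + subordinated_mehler t x p * indicator (- ?N) p \<partial>(lborel \<Otimes>\<^sub>M M i))"
        by (intro Bochner_Integration.integral_cong refl) (auto split: split_indicator)
      also have "\<dots> = ?n i + ?f i" by (rule Bochner_Integration.integral_add[OF i1 i2])
      finally show "(\<integral>y. poisson_hermite_kernel t x y \<partial>M i) = ?n i + ?f i" .
      have nn: "0 \<le> subordinated_mehler t x p * indicator (- ?N) p" for p
        using subordinated_mehler_nonneg[of t x p] t by simp
      have "ennreal (?f i) = (\<integral>\<^sup>+p. ennreal (subordinated_mehler t x p * indicator (- ?N) p) \<partial>(lborel \<Otimes>\<^sub>M M i))"
        using nn by (intro nn_integral_eq_integral[symmetric] i2 AE_I2)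
      also have "\<dots> = (\<integral>\<^sup>+p. ennreal (subordinated_mehler t x p) * indicator (- ?N) p \<partial>(lborel \<Otimes>\<^sub>M M i))"
        by (intro nn_integral_cong) (auto split: split_indicator)
      also have "\<dots> \<le> ennreal (K i * t)" by (rule K(2)[OF i t(1) xX])
      finally have "?f i \<le> K i * t" using K(1)[OF i] t by (simp add: ennreal_le_iff)
      moreover have "0 \<le> ?f i" using nn by (intro Bochner_Integration.integral_nonneg) auto
      ultimately show "\<bar>?f i\<bar> \<le> K i * t" by simp
    qed
    have "(\<Sum>i\<in>I. c i * complex_of_real (\<integral>y. poisson_hermite_kernel t x y \<partial>M i)) =
      (\<Sum>i\<in>I. c i * complex_of_real (?n i)) + (\<Sum>i\<in>I. c i * complex_of_real (?f i))"
      by (simp add: split distrib_left sum.distrib)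
    moreover have "norm (\<Sum>i\<in>I. c i * complex_of_real (?n i)) \<le> 2 * C1 * \<epsilon> * C2 * sqrt 2"
      using \<epsilon> C1(2) by (intro norm_sum_near_centre_le[OF phi t(1) s0(2) \<alpha> \<delta> _ xX _ _ C2(2) \<eta>(2) centre])
        (use x in \<open>auto simp: add.commute\<close>)
    moreover have "norm (\<Sum>i\<in>I. c i * complex_of_real (?f i)) \<le> e / 2"
    proof -
      have "norm (\<Sum>i\<in>I. c i * complex_of_real (?f i)) \<le> (\<Sum>i\<in>I. norm (c i) * (K i * t))"
        by (intro sum_norm_le) (auto simp: norm_mult intro!: mult_left_mono far)
      also have "\<dots> = F * t" unfolding F_def sum_distrib_right by (intro sum.cong) auto
      also have "\<dots> \<le> (F + 1) * t" using t by (intro mult_right_mono) auto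
      also have "\<dots> \<le> e / 2" using t1(3) F by (simp add: field_simps)
      finally show ?thesis .
    qed
    ultimately show ?thesis using norm_triangle_ineq[of "\<Sum>i\<in>I. c i * complex_of_real (?n i)" "\<Sum>i\<in>I. c i * complex_of_real (?f i)"]
      unfolding \<epsilon>e by simp
  qed
  then show "\<exists>d>0. \<forall>t x. 0 < t \<longrightarrow> t < d \<longrightarrow> norm (x - x0) < \<alpha> * t \<longrightarrow>
      norm ((\<Sum>i\<in>I. c i * complex_of_real (\<integral>y. poisson_hermite_kernel t x y \<partial>M i)) - 0) \<le> e"
    using d by (intro exI[of _ d]) auto
qed

section \<open>Lebesgue measure and the nontangential limit\<close>

lemma phi_measure_lborel: "phi_measure (lborel :: 'a::euclidean_space measure)"
  using nn_integral_Phi_lborel[where 'a = 'a] by (simp add: phi_measure_def)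

lemma integral_mehler_kernel_lborel:
  fixes x :: "'a::euclidean_space"
  assumes s: "0 < s" "s < 1"
  shows "(\<integral>y. mehler_kernel s x y \<partial>lborel) =
    ((1 - s\<^sup>2) / (1 + s\<^sup>2)) powr (real DIM('a) / 2) * exp (- (s / (1 + s\<^sup>2) * (norm x)\<^sup>2))"
proof -
  have a: "0 < mehler_rate s" by (rule mehler_rate_pos[OF s(1)])
  have p: "0 < 1 - s\<^sup>2" "0 < 1 + s\<^sup>2" using one_minus_square_pos[OF s] by (auto simp: add_pos_nonneg)
  have m: "mehler_kernel s x \<in> borel_measurable lborel"
    unfolding mehler_kernel_def by measurable
  have "(\<integral>\<^sup>+y. ennreal (mehler_kernel s x y) \<partial>lborel) =
    (\<integral>\<^sup>+y. ennreal (mehler_amplitude s x) * ennreal (exp (- (mehler_rate s * (norm (y - mehler_centre s x))\<^sup>2))) \<partial>lborel)"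
    by (intro nn_integral_cong) (simp add: mehler_kernel_eq[OF s(1)] mehler_amplitude_nonneg ennreal_mult')
  also have "\<dots> = ennreal (mehler_amplitude s x) * ennreal ((pi / mehler_rate s) powr (real DIM('a) / 2))"
    by (subst nn_integral_cmult) (auto simp: nn_integral_gaussian[OF a])
  also have "\<dots> = ennreal (mehler_amplitude s x * (pi / mehler_rate s) powr (real DIM('a) / 2))"
    by (simp add: ennreal_mult' mehler_amplitude_nonneg)
  also have "mehler_amplitude s x * (pi / mehler_rate s) powr (real DIM('a) / 2) =
     ((1 - s\<^sup>2) / (1 + s\<^sup>2)) powr (real DIM('a) / 2) * exp (- (s / (1 + s\<^sup>2) * (norm x)\<^sup>2))"
  proof -
    have "((1 - s\<^sup>2) / (4 * pi * s)) powr (real DIM('a) / 2) * (pi / mehler_rate s) powr (real DIM('a) / 2)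
      = ((1 - s\<^sup>2) / (4 * pi * s) * (pi / mehler_rate s)) powr (real DIM('a) / 2)"
      by (rule powr_mult[symmetric])
    also have "(1 - s\<^sup>2) / (4 * pi * s) * (pi / mehler_rate s) = (1 - s\<^sup>2) / (1 + s\<^sup>2)"
      using s p by (simp add: mehler_rate_def)
    finally show ?thesis by (simp add: mehler_amplitude_def mult_ac)
  qed
  finally have nn: "(\<integral>\<^sup>+y. ennreal (mehler_kernel s x y) \<partial>lborel) =
     ennreal (((1 - s\<^sup>2) / (1 + s\<^sup>2)) powr (real DIM('a) / 2) * exp (- (s / (1 + s\<^sup>2) * (norm x)\<^sup>2)))" .
  show ?thesis
    using m by (subst integral_eq_nn_integral) (auto simp: nn mehler_kernel_nonneg)
qed

text \<open>
  By \<open>integral_mehler_kernel_lborel\<close> the integral is the mean of a function \<open>h\<close> with values in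
  \<open>[0,1]\<close> and with \<open>h s x \<rightarrow> 1\<close> as \<open>s \<rightarrow> 0\<close>, uniformly for bounded \<open>x\<close>. The mass of
  \<^term>\<open>subordinator t\<close> on \<open>s \<ge> \<eta>\<close> is \<open>O(t)\<close>, by comparison with \<^term>\<open>subordinator 1\<close>.
\<close>

lemma poisson_hermite_lborel_tendsto_one:
  fixes x0 :: "'a::euclidean_space"
  assumes \<alpha>: "0 < \<alpha>"
  shows "nontangential_limit \<alpha> x0 (\<lambda>t x. complex_of_real (\<integral>y. poisson_hermite_kernel t x y \<partial>lborel)) 1"
proof (rule nontangential_limitI)
  fix e :: real assume e: "0 < e"
  interpret L: phi_measure "lborel :: 'a measure" by (rule phi_measure_lborel)
  define X where "X = norm x0 + \<alpha>"
  define h where "h s x = ((1 - s\<^sup>2) / (1 + s\<^sup>2)) powr (real DIM('a) / 2) * exp (- (s / (1 + s\<^sup>2) * (norm x)\<^sup>2))"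
    for s and x :: 'a
  let ?h0 = "\<lambda>s. ((1 - s\<^sup>2) / (1 + s\<^sup>2)) powr (real DIM('a) / 2) * exp (- (s / (1 + s\<^sup>2) * X\<^sup>2)) :: real"
  have "(?h0 \<longlongrightarrow> ((1 - 0\<^sup>2) / (1 + 0\<^sup>2)) powr (real DIM('a) / 2) * exp (- (0 / (1 + 0\<^sup>2) * X\<^sup>2))) (at_right 0)"
    by (intro tendsto_intros) auto
  then have "(?h0 \<longlongrightarrow> 1) (at_right 0)" by simp
  then have "\<forall>\<^sub>F s in at_right 0. 1 - e / 2 < ?h0 s" using e by (intro order_tendstoD) auto
  then obtain b where b: "0 < b" "\<And>s. 0 < s \<Longrightarrow> s < b \<Longrightarrow> 1 - e / 2 < ?h0 s"
    unfolding eventually_at_right_field by blast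
  define \<eta> where "\<eta> = min (1 / 2) (b / 2)"
  have "\<eta> \<le> 1 / 2" "\<eta> \<le> b / 2" unfolding \<eta>_def by (rule min.cobounded1, rule min.cobounded2)
  moreover have "0 < \<eta>" using b(1) by (simp add: \<eta>_def)
  ultimately have \<eta>: "0 < \<eta>" "\<eta> < 1" "\<eta> < b" using b(1) by auto
  define E where "E = exp (1 / kappa \<eta>)"
  have h1: "h s x \<le> 1" "0 \<le> h s x" if s: "0 < s" "s < 1" for s x
  proof -
    have "((1 - s\<^sup>2) / (1 + s\<^sup>2)) powr (real DIM('a) / 2) \<le> 1"
      using one_minus_square_pos[OF s] by (intro powr_le1) (auto simp: divide_le_eq add_pos_nonneg)
    moreover have "exp (- (s / (1 + s\<^sup>2) * (norm x)\<^sup>2)) \<le> 1" using s by simp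
    ultimately have "h s x \<le> 1 * 1" unfolding h_def by (intro mult_mono) auto
    then show "h s x \<le> 1" by simp
    show "0 \<le> h s x" by (simp add: h_def)
  qed
  have h2: "1 - h s x \<le> e / 2" if s: "0 < s" "s < \<eta>" and x: "norm x \<le> X" for s x
  proof -
    have "s / (1 + s\<^sup>2) * (norm x)\<^sup>2 \<le> s / (1 + s\<^sup>2) * X\<^sup>2"
      using s x by (intro mult_left_mono power_mono) auto
    then have "?h0 s \<le> h s x" unfolding h_def by (intro mult_left_mono) auto
    then show ?thesis using b(2)[of s] s \<eta> by auto
  qed
  have sub_large: "subordinator t s \<le> t * E * subordinator 1 s" if t: "0 < t" and s: "\<eta> \<le> s" "s < 1" for t s
  proof -
    have s0: "0 < s" using \<eta> s by simp
    have k: "0 < kappa \<eta>" "kappa \<eta> \<le> kappa s"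
      using kappa_pos[OF \<eta>(1,2)] kappa_mono[OF \<eta>(1) s] by auto
    have p: "0 < 1 - s\<^sup>2" using one_minus_square_pos[OF s0 s(2)] .
    have "exp (- t\<^sup>2 / kappa s) \<le> exp (1 / kappa \<eta> + - 1\<^sup>2 / kappa s)"
    proof -
      have "- t\<^sup>2 / kappa s \<le> 0" using k by (simp add: divide_nonneg_pos)
      moreover have "1 / kappa s \<le> 1 / kappa \<eta>" using k by (intro divide_left_mono) auto
      ultimately show ?thesis by simp
    qed
    also have "\<dots> = E * exp (- 1\<^sup>2 / kappa s)" by (simp only: E_def exp_add)
    finally have "4 * t * exp (- t\<^sup>2 / kappa s) / (sqrt pi * kappa s powr (3 / 2) * (1 - s\<^sup>2))
       \<le> 4 * t * (E * exp (- 1\<^sup>2 / kappa s)) / (sqrt pi * kappa s powr (3 / 2) * (1 - s\<^sup>2))"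
      using t k p by (intro divide_right_mono mult_left_mono) auto
    then show ?thesis by (simp add: subordinator_def mult_ac)
  qed
  define d where "d = min 1 (e / (2 * E))"
  have E: "0 < E" by (simp add: E_def)
  have d: "0 < d" using e E by (simp add: d_def)
  have "norm (complex_of_real (\<integral>y. poisson_hermite_kernel t x y \<partial>lborel) - 1) \<le> e"
    if t: "0 < t" "t < d" and x: "norm (x - x0) < \<alpha> * t" for t and x :: 'a
  proof -
    have t1: "t < 1" "t < e / (2 * E)" using t by (auto simp: d_def)
    have "norm x \<le> norm x0 + norm (x - x0)" using norm_triangle_ineq[of x0 "x - x0"] by simp
    also have "\<dots> \<le> norm x0 + \<alpha> * 1"
      using x t1 \<alpha> by (intro add_left_mono) (meson less_imp_le mult_left_mono order_trans)
    finally have xX: "norm x \<le> X" by (simp add: X_def)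
    let ?p = "\<lambda>t s. indicator {0<..<1} s * subordinator t s :: real"
    have pi: "integrable lborel (?p u)" and p1: "(\<integral>s. ?p u s \<partial>lborel) = 1" if "0 < u" for u
      using subordinator_integral[OF that] by (auto simp: set_integrable_def set_lebesgue_integral_def)
    have i: "integrable (lborel \<Otimes>\<^sub>M lborel) (case_prod (\<lambda>s y. subordinated_mehler t x (s, y)))"
      using L.integrable_subordinated_mehler[OF t(1), of x] by simp
    have inner: "(\<integral>y. subordinated_mehler t x (s, y) \<partial>lborel) = ?p t s * h s x" for s
    proof (cases "s \<in> {0<..<1}")
      case True
      then show ?thesis
        using integral_mehler_kernel_lborel[of s x] by (simp add: subordinated_mehler_def h_def)
    qed (simp add: subordinated_mehler_def)
    have phi: "integrable lborel (\<lambda>s. ?p t s * h s x)"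
      using lborel_pair.integrable_fst[OF i] unfolding inner .
    have "(\<integral>y. poisson_hermite_kernel t x y \<partial>lborel) = (\<integral>s. ?p t s * h s x \<partial>lborel)"
      using L.integral_poisson_hermite_kernel(2)[OF t(1), of x] lborel_pair.integral_fst[OF i]
      unfolding inner by simp
    then have "1 - (\<integral>y. poisson_hermite_kernel t x y \<partial>lborel) = (\<integral>s. ?p t s - ?p t s * h s x \<partial>lborel)"
      using p1[OF t(1)] Bochner_Integration.integral_diff[OF pi[OF t(1)] phi] by simp
    moreover have "(\<integral>s. ?p t s - ?p t s * h s x \<partial>lborel) \<le> (\<integral>s. e / 2 * ?p t s + t * E * ?p 1 s \<partial>lborel)"
    proof (rule integral_mono)
      show "integrable lborel (\<lambda>s. ?p t s - ?p t s * h s x)"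
        by (intro Bochner_Integration.integrable_diff pi phi t)
      show "integrable lborel (\<lambda>s. e / 2 * ?p t s + t * E * ?p 1 s)"
        by (intro Bochner_Integration.integrable_add integrable_mult_right pi t) simp
      fix s :: real
      show "?p t s - ?p t s * h s x \<le> e / 2 * ?p t s + t * E * ?p 1 s"
      proof (cases "s \<in> {0<..<1}")
        case True
        then have s: "0 < s" "s < 1" by auto
        have n: "0 \<le> subordinator t s" "0 \<le> subordinator 1 s"
          using t s by (auto intro: subordinator_nonneg)
        have "subordinator t s * (1 - h s x) \<le> e / 2 * subordinator t s + t * E * subordinator 1 s"
        proof (cases "s < \<eta>")
          case True
          have "subordinator t s * (1 - h s x) \<le> subordinator t s * (e / 2)"
            by (intro mult_left_mono h2 n xX s True)
          then have "subordinator t s * (1 - h s x) \<le> e / 2 * subordinator t s" by (simp only: mult.commute)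
          moreover have "0 \<le> t * E * subordinator 1 s" using t E n by simp
          ultimately show ?thesis by (rule add_increasing2[rotated])
        next
          case False
          have "subordinator t s * (1 - h s x) \<le> subordinator t s * 1"
            using h1[OF s, of x] by (intro mult_left_mono n) auto
          moreover have "subordinator t s \<le> t * E * subordinator 1 s"
            using False s by (intro sub_large t) auto
          moreover have "0 \<le> e / 2 * subordinator t s" using e n by simp
          ultimately show ?thesis by linarith
        qed
        then show ?thesis using True by (simp add: right_diff_distrib)
      qed simp
    qed
    moreover have "(\<integral>s. e / 2 * ?p t s + t * E * ?p 1 s \<partial>lborel) = e / 2 + t * E"
      using pi[OF t(1)] pi[of 1] p1[OF t(1)] p1[of 1]
      by (subst Bochner_Integration.integral_add) (auto simp: mult.assoc)
    moreover have "0 \<le> (\<integral>s. ?p t s - ?p t s * h s x \<partial>lborel)"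
    proof (intro Bochner_Integration.integral_nonneg)
      fix s :: real
      show "0 \<le> ?p t s - ?p t s * h s x"
      proof (cases "s \<in> {0<..<1}")
        case True
        then show ?thesis using subordinator_nonneg[of t s] h1[of s x] t by (simp add: mult_left_le)
      qed simp
    qed
    moreover have "t * E \<le> e / 2" using t1(2) E by (simp add: field_simps)
    ultimately have "\<bar>(\<integral>y. poisson_hermite_kernel t x y \<partial>lborel) - 1\<bar> \<le> e" by linarith
    then show ?thesis by (metis norm_of_real of_real_1 of_real_diff)
  qed
  then show "\<exists>d>0. \<forall>t x. 0 < t \<longrightarrow> t < d \<longrightarrow> norm (x - x0) < \<alpha> * t \<longrightarrow>
      norm (complex_of_real (\<integral>y. poisson_hermite_kernel t x y \<partial>lborel) - 1) \<le> e"
    using d by (intro exI[of _ d]) auto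
qed

lemma measures_Phi_variation:
  fixes \<nu> :: "'a::euclidean_space set \<Rightarrow> complex"
  assumes \<nu>: "\<nu> \<in> measures_Phi" and \<mu>: "locally_finite_signed_measure \<mu>" and le: "\<And>A. \<mu> A \<le> norm (\<nu> A)"
  shows "phi_measure (positive_variation \<mu>)"
proof
  have lf: "locally_finite_complex_measure \<nu>" and fin: "(\<integral>\<^sup>+y. ennreal (Phi y) \<partial>total_variation \<nu>) < \<infinity>"
    using \<nu> by (auto simp: measures_Phi_def)
  have "positive_variation \<mu> \<le> total_variation \<nu>"
    by (rule positive_variation_le_total_variation[OF lf \<mu> le])
  then have "(\<integral>\<^sup>+y. ennreal (Phi y) \<partial>positive_variation \<mu>) \<le> (\<integral>\<^sup>+y. ennreal (Phi y) \<partial>total_variation \<nu>)"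
    by (intro nn_integral_mono_measure) auto
  with fin show "(\<integral>\<^sup>+y. ennreal (Phi y) \<partial>positive_variation \<mu>) < \<infinity>" by simp
qed simp

text \<open>
  Specialise the limit to balls centred at \<open>x\<^sub>0\<close>, whose volume is a constant times \<open>r\<^sup>d\<close>. In particular
  the number \<open>l\<close> in the definition of a \<open>\<sigma>\<close>-point is unique.
\<close>

lemma sigma_point_symmetric_derivative:
  fixes \<nu> :: "'a::euclidean_space set \<Rightarrow> complex"
  assumes "((\<lambda>(x, r). norm (minus_lebesgue \<nu> l (ball x r)) / (norm (x - x0) + r) ^ DIM('a)) \<longlongrightarrow> 0)
    (at (x0, 0) within UNIV \<times> {0<..})"
  shows "symmetric_derivative \<nu> x0 = l"
proof -
  let ?B = "\<lambda>r. measure lborel (ball x0 r)"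
  define c where "c = unit_ball_vol (real DIM('a))"
  have c: "0 < c" by (simp add: c_def)
  have "filterlim (\<lambda>r. (x0, r)) (at (x0, 0) within UNIV \<times> {0<..}) (at_right (0::real))"
    unfolding filterlim_at
    by (auto intro!: tendsto_intros simp: eventually_at_filter)
  from filterlim_compose[OF assms this]
  have 1: "((\<lambda>r. norm (minus_lebesgue \<nu> l (ball x0 r)) / r ^ DIM('a)) \<longlongrightarrow> 0) (at_right 0)" by simp
  have "((\<lambda>r. \<nu> (ball x0 r) / complex_of_real (?B r) - l) \<longlongrightarrow> 0) (at_right 0)"
  proof (rule Lim_null_comparison)
    show "((\<lambda>r. norm (minus_lebesgue \<nu> l (ball x0 r)) / r ^ DIM('a) / c) \<longlongrightarrow> 0) (at_right 0)"
      using tendsto_divide[OF 1 tendsto_const[of c]] c by simp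
    show "\<forall>\<^sub>F r in at_right 0. norm (\<nu> (ball x0 r) / complex_of_real (?B r) - l)
        \<le> norm (minus_lebesgue \<nu> l (ball x0 r)) / r ^ DIM('a) / c"
      using eventually_at_right_less[of "0::real"]
    proof eventually_elim
      case (elim r)
      have B: "?B r = c * r ^ DIM('a)" using elim by (simp add: content_ball c_def)
      have B0: "0 < ?B r" unfolding B using c elim by simp
      have "\<nu> (ball x0 r) / complex_of_real (?B r) - l = minus_lebesgue \<nu> l (ball x0 r) / complex_of_real (?B r)"
        using B0 by (simp add: minus_lebesgue_def field_simps)
      then have "norm (\<nu> (ball x0 r) / complex_of_real (?B r) - l) = norm (minus_lebesgue \<nu> l (ball x0 r)) / ?B r"
        using B0 by (simp add: norm_divide)
      then show ?case unfolding B by (simp add: mult.commute)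
    qed
  qed
  then have "((\<lambda>r. \<nu> (ball x0 r) / complex_of_real (?B r)) \<longlongrightarrow> l) (at_right 0)"
    by (simp add: LIM_zero_iff)
  then show ?thesis
    unfolding symmetric_derivative_def by (intro tendsto_Lim) auto
qed

text \<open>
  On a ball the five measures combine to \<open>\<nu> - \<ell> dy\<close>, so the \<open>\<sigma>\<close>-point condition is the smallness
  required by \<open>sum_poisson_hermite_tendsto_zero\<close>.
\<close>

lemma poisson_hermite_nontangential_limit:
  fixes \<nu> :: "'a::euclidean_space set \<Rightarrow> complex"
  assumes \<nu>: "\<nu> \<in> measures_Phi" and \<sigma>: "sigma_point \<nu> x0" and \<alpha>: "0 < \<alpha>"
  shows "nontangential_limit \<alpha> x0 (\<lambda>t x. poisson_hermite t \<nu> x) (symmetric_derivative \<nu> x0)"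
proof -
  obtain l where l: "((\<lambda>(x, r). norm (minus_lebesgue \<nu> l (ball x r)) / (norm (x - x0) + r) ^ DIM('a)) \<longlongrightarrow> 0)
    (at (x0, 0) within UNIV \<times> {0<..})"
    using \<sigma> unfolding sigma_point_def by blast
  have D: "symmetric_derivative \<nu> x0 = l" by (rule sigma_point_symmetric_derivative[OF l])
  let ?re = "\<lambda>E. Re (\<nu> E)" and ?im = "\<lambda>E. Im (\<nu> E)"
  have re: "locally_finite_signed_measure ?re" and im: "locally_finite_signed_measure ?im"
    using \<nu> by (auto simp: measures_Phi_def locally_finite_complex_measure_def)
  define Ms where "Ms = [positive_variation ?re, positive_variation (\<lambda>E. - ?re E),
    positive_variation ?im, positive_variation (\<lambda>E. - ?im E), lborel]"
  define cs where "cs = [1, - 1, \<i>, - \<i>, - l]"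
  have phi: "phi_measure (Ms ! i)" if "i \<in> {..<5}" for i
  proof -
    have "\<forall>M\<in>set Ms. phi_measure M"
      using abs_Re_le_cmod abs_Im_le_cmod
      by (auto simp: Ms_def phi_measure_lborel abs_le_iff intro!: measures_Phi_variation[OF \<nu>] re im
          locally_finite_signed_measure_uminus)
    moreover have "length Ms = 5" by (simp add: Ms_def)
    ultimately show ?thesis using that by (metis lessThan_iff nth_mem)
  qed
  have sum5: "(\<Sum>i\<in>{..<5::nat}. f i) = f 0 + f 1 + f 2 + f 3 + f 4" for f :: "nat \<Rightarrow> complex"
    by (simp add: eval_nat_numeral lessThan_Suc add_ac)
  have fin: "emeasure (positive_variation ?re) (ball z r) < \<infinity>" "emeasure (positive_variation (\<lambda>E. - ?re E)) (ball z r) < \<infinity>"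
    "emeasure (positive_variation ?im) (ball z r) < \<infinity>" "emeasure (positive_variation (\<lambda>E. - ?im E)) (ball z r) < \<infinity>" for z r
    using phi[of 0, THEN phi_measure.emeasure_bounded_finite, of "ball z r"]
      phi[of 1, THEN phi_measure.emeasure_bounded_finite, of "ball z r"]
      phi[of 2, THEN phi_measure.emeasure_bounded_finite, of "ball z r"]
      phi[of 3, THEN phi_measure.emeasure_bounded_finite, of "ball z r"]
    by (simp_all add: Ms_def)
  have ball: "(\<Sum>i\<in>{..<5}. cs ! i * complex_of_real (measure (Ms ! i) (ball z r))) = minus_lebesgue \<nu> l (ball z r)" for z r
    using signed_measure_eq_diff_variation[OF re _ _ fin(1,2)[of z r]]
      signed_measure_eq_diff_variation[OF im _ _ fin(3,4)[of z r]]
    by (simp add: sum5 cs_def Ms_def minus_lebesgue_def complex_eq_iff)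
  have "nontangential_limit \<alpha> x0 (\<lambda>t x. \<Sum>i\<in>{..<5}. cs ! i * complex_of_real (\<integral>y. poisson_hermite_kernel t x y \<partial>(Ms ! i))) 0"
  proof (rule sum_poisson_hermite_tendsto_zero[OF _ phi _ \<alpha>])
    fix \<epsilon> :: real assume \<epsilon>: "0 < \<epsilon>"
    have "\<forall>\<^sub>F p in at (x0, 0) within UNIV \<times> {0<..}.
        dist (case p of (x, r) \<Rightarrow> norm (minus_lebesgue \<nu> l (ball x r)) / (norm (x - x0) + r) ^ DIM('a)) 0 < \<epsilon>"
      by (rule tendstoD[OF l \<epsilon>])
    then obtain \<eta> where \<eta>: "0 < \<eta>" "\<And>p. p \<in> UNIV \<times> {0<..} \<Longrightarrow> p \<noteq> (x0, 0) \<Longrightarrow> dist p (x0, 0) < \<eta> \<Longrightarrow>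
        dist (case p of (x, r) \<Rightarrow> norm (minus_lebesgue \<nu> l (ball x r)) / (norm (x - x0) + r) ^ DIM('a)) 0 < \<epsilon>"
      unfolding eventually_at by blast
    have "norm (minus_lebesgue \<nu> l (ball z r)) \<le> \<epsilon> * (norm (z - x0) + r) ^ DIM('a)"
      if r: "0 < r" "norm (z - x0) + r < \<eta>" for z r
    proof -
      have "dist (z, r) (x0, 0) \<le> dist z x0 + dist r 0"
        unfolding dist_Pair_Pair by (rule sqrt_sum_squares_le_sum) auto
      then have "dist (z, r) (x0, 0) < \<eta>" using r by (simp add: dist_norm)
      then have "norm (minus_lebesgue \<nu> l (ball z r)) / (norm (z - x0) + r) ^ DIM('a) < \<epsilon>"
        using \<eta>(2)[of "(z, r)"] r by (simp add: abs_of_nonneg)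
      moreover have "0 < (norm (z - x0) + r) ^ DIM('a)" using r by (simp add: add_nonneg_pos)
      ultimately show ?thesis by (simp add: divide_less_eq)
    qed
    then show "\<exists>\<eta>>0. \<forall>z r. 0 < r \<longrightarrow> norm (z - x0) + r < \<eta> \<longrightarrow>
      norm (\<Sum>i\<in>{..<5}. cs ! i * complex_of_real (measure (Ms ! i) (ball z r))) \<le> \<epsilon> * (norm (z - x0) + r) ^ DIM('a)"
      unfolding ball using \<eta>(1) by blast
  qed auto
  then have A: "((\<lambda>(t, x). \<Sum>i\<in>{..<5}. cs ! i * complex_of_real (\<integral>y. poisson_hermite_kernel t x y \<partial>(Ms ! i))) \<longlongrightarrow> 0)
      (at (0, x0) within {(t, x). 0 < t \<and> norm (x - x0) < \<alpha> * t})"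
    unfolding nontangential_limit_def .
  have B: "((\<lambda>(t, x). complex_of_real (\<integral>y. poisson_hermite_kernel t x y \<partial>lborel)) \<longlongrightarrow> 1)
      (at (0, x0) within {(t, x). 0 < t \<and> norm (x - x0) < \<alpha> * t})"
    using poisson_hermite_lborel_tendsto_one[OF \<alpha>, of x0] unfolding nontangential_limit_def .
  have eq: "poisson_hermite t \<nu> x =
      (\<Sum>i\<in>{..<5}. cs ! i * complex_of_real (\<integral>y. poisson_hermite_kernel t x y \<partial>(Ms ! i))) +
      l * complex_of_real (\<integral>y. poisson_hermite_kernel t x y \<partial>lborel)" for t x
    unfolding poisson_hermite_def complex_measure_integral_def signed_integral_def integral_complex_of_real sum5
    by (simp add: cs_def Ms_def algebra_simps)
  have "((\<lambda>p. (case p of (t, x) \<Rightarrow> \<Sum>i\<in>{..<5}. cs ! i * complex_of_real (\<integral>y. poisson_hermite_kernel t x y \<partial>(Ms ! i))) +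
      l * (case p of (t, x) \<Rightarrow> complex_of_real (\<integral>y. poisson_hermite_kernel t x y \<partial>lborel))) \<longlongrightarrow> 0 + l * 1)
      (at (0, x0) within {(t, x). 0 < t \<and> norm (x - x0) < \<alpha> * t})"
    by (intro tendsto_add tendsto_mult tendsto_const A B)
  then show ?thesis
    unfolding nontangential_limit_def D eq by (simp add: case_prod_beta')
qed

theorem theorem1p2:
  fixes \<nu> :: "'a::euclidean_space set \<Rightarrow> complex" and x0 :: 'a and l :: complex
  assumes "\<nu> \<in> measures_Phi"
    and "sigma_point \<nu> x0"
    and "l = symmetric_derivative \<nu> x0"
  shows "(DIM('a) \<in> {1, 2, 3} \<longrightarrow>
            (\<forall>\<alpha>>0. nontangential_limit \<alpha> x0 (\<lambda>t x. poisson_hermite t \<nu> x) l)) \<and>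
         (DIM('a) \<ge> 4 \<longrightarrow>
            ((\<lambda>r. measure (total_variation (minus_lebesgue \<nu> l)) (ball x0 r) / r ^ (DIM('a) - 3))
               \<longlongrightarrow> 0) (at_right 0) \<longrightarrow>
            (\<forall>\<alpha>>0. nontangential_limit \<alpha> x0 (\<lambda>t x. poisson_hermite t \<nu> x) l))"
  using poisson_hermite_nontangential_limit[OF assms(1,2)] unfolding assms(3) by blast

end
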